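(* Let $(X,d,\sigma)$ be a compatible metric-topological space with $(X,d)$ complete, let $\phi:X\to(-\infty,\infty]$ be proper and satisfy the LSCC assumptions with coercivity constant $\mathsf B$, and suppose that $\phi$ is $\lambda$-geodesically convex on $X$ for some $\lambda\in\mathbb R$. Let $\varepsilon>0$ with $\frac1{16\varepsilon}>\mathsf B$. Then $$\sqrt{2\,\frac{\phi(u)-V_\varepsilon(u)}{\varepsilon}}=G_\varepsilon(u)=|\tilde\partial V_\varepsilon|(u)\qquad\text{for all }u\in D(\phi).$$
   Context: **Setting.** $(X,d)$ is a complete metric space and $\sigma$ is a Hausdorff topology on $X$; $(X,d,\sigma)$ is called compatible if (MT1) $u_n\to u$ and $v_n\to v$ in $\sigma$ imply $\liminf_n d(u_n,v_n)\ge d(u,v)$; (MT2) for every $\sigma$-open set $U$ and $x\in U$ there exist a $\sigma$-open neighborhood $V$ of $x$ and $\delta>0$ such that $d(y,V)<\delta$ implies $y\in U$, where $d(y,V)=\inf_{v\in V}d(y,v)$. For an interval $I\subset\mathbb R$ and $p\in[1,\infty]$, $AC^p(I;X)$ is the set of curves $u:I\to X$ for which there is $m\in L^p(I)$ with $d(u(s),u(t))\le\int_s^t m(r)\,dr$ for all $s\le t$ in $I$; $AC^p_{\rm loc}(I;X)$ is the set of curves belonging to $AC^p(J;X)$ for every compact interval $J\subset I$. The metric derivative $|u'|(t)=\lim_{s\to t}\frac{d(u(s),u(t))}{|t-s|}$ exists for a.e. $t\in I$. **LSCC assumptions.** $\phi:X\to(-\infty,\infty]$ is proper, $D(\phi)=\{\phi<\infty\}$,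 and: (Lower semicontinuity) if $\sup_{n,m}d(u_n,u_m)<\infty$ and $u_n\to u$ in $\sigma$, then $\liminf_n\phi(u_n)\ge\phi(u)$; (Compactness) every sequence with $\sup_n\phi(u_n)<\infty$ and $\sup_{n,m}d(u_n,u_m)<\infty$ has a $\sigma$-convergent subsequence; (Coercivity) there are $u_*\in X$ and constants $\mathsf A,\mathsf B\ge0$ such that $\phi(u)\ge-\mathsf B\,d^2(u,v)-\mathsf Q(v)$ for all $u,v\in X$, where $\mathsf Q(v)=\mathsf B\,d^2(v,u_* )+\mathsf A$. **Geodesic convexity.** A geodesic is a curve $\gamma:[0,1]\to X$ with $d(\gamma(s),\gamma(t))=|t-s|\,d(\gamma(0),\gamma(1))$ for all $s,t$. $\phi$ is $\lambda$-geodesically convex if for all $v_0,v_1\in D(\phi)$ there is a geodesic $\gamma$ with $\gamma(0)=v_0$, $\gamma(1)=v_1$ and $\phi(\gamma(t))\le(1-t)\phi(v_0)+t\phi(v_1)-\frac\lambda2t(1-t)d^2(v_0,v_1)$ for all $t\in[0,1]$. **WED functional and value function.** $\mu_\varepsilon$ is the probability measure on $(0,\infty)$ with density $\frac1\varepsilon e^{-t/\varepsilon}$; $\mathcal I_\varepsilon[u]=\int_0^\infty\big(\frac\varepsilon2|u'|^2+\phi(u)\big)\,d\mu_\varepsilon$ for $u\in\mathscr C_\varepsilon(x)=\{u\in AC^2_{\rm loc}([0,\infty);X): u(0)=x,\ \int_0^\infty|u'|^2\,d\mu_\varepsilon<\infty\}$. The value function is $V_\varepsilon(x)=\inf_{u\in\mathscr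 C_\varepsilon(x)}\mathcal I_\varepsilon[u]$, $D(V_\varepsilon)=\{V_\varepsilon<\infty\}\supset D(\phi)$. Set $G_\varepsilon(x)=\sqrt{2(\phi(x)-V_\varepsilon(x))/\varepsilon}$ if $x\in D(V_\varepsilon)$ and $G_\varepsilon(x)=\infty$ otherwise. **Conditioned slope.** $|\tilde\partial V_\varepsilon|(u)=\limsup_{v\to u,\ \phi(v)\to\phi(u)}\frac{(V_\varepsilon(u)-V_\varepsilon(v))^+}{d(u,v)}$, where $v\to u$ in $d$. *)

theory Defs
  imports "HOL-Probability.Probability"
begin

text \<open>The metric space is the whole type \<open>'a\<close> with distance \<^const>\<open>dist\<close>; the second topology is
  \<open>\<sigma> :: 'a topology\<close>. In (MT2), \<open>infdist y V\<close> is the infimum of the distances, as \<open>V\<close> is nonempty.\<close>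

definition compatible :: "('a::metric_space) topology \<Rightarrow> bool" where
  "compatible \<sigma> \<longleftrightarrow>
     topspace \<sigma> = UNIV \<and> Hausdorff_space \<sigma> \<and>
     (\<forall>u v u0 v0. limitin \<sigma> u u0 sequentially \<longrightarrow> limitin \<sigma> v v0 sequentially \<longrightarrow>
        ereal (dist u0 v0) \<le> liminf (\<lambda>n. ereal (dist (u n) (v n)))) \<and>
     (\<forall>U x. openin \<sigma> U \<longrightarrow> x \<in> U \<longrightarrow>
        (\<exists>V \<delta>. openin \<sigma> V \<and> x \<in> V \<and> \<delta> > 0 \<and> (\<forall>y. infdist y V < \<delta> \<longrightarrow> y \<in> U)))"

definition AC2 :: "real set \<Rightarrow> (real \<Rightarrow> 'a::metric_space) \<Rightarrow> bool" where
  "AC2 I u \<longleftrightarrow>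
     (\<exists>m :: real \<Rightarrow> real. set_borel_measurable lborel I m \<and>
        set_integrable lborel I (\<lambda>r. (m r)\<^sup>2) \<and>
        (\<forall>s\<in>I. \<forall>t\<in>I. s \<le> t \<longrightarrow> dist (u s) (u t) \<le> (LINT r:{s..t}|lborel. m r)))"

definition AC2_loc :: "real set \<Rightarrow> (real \<Rightarrow> 'a::metric_space) \<Rightarrow> bool" where
  "AC2_loc I u \<longleftrightarrow> (\<forall>a b. {a..b} \<subseteq> I \<longrightarrow> AC2 {a..b} u)"

text \<open>The limit exists only almost everywhere; elsewhere \<^const>\<open>Lim\<close> is unspecified, and the
  integrals below do not see it. Curves on \<open>[0,\<infinity>)\<close> are functions on \<^typ>\<open>real\<close> whose values at
  negative times are irrelevant.\<close>

definition metric_deriv :: "(real \<Rightarrow> 'a::metric_space) \<Rightarrow> real \<Rightarrow> real" where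
  "metric_deriv u t = Lim (at t within {0..}) (\<lambda>s. dist (u s) (u t) / \<bar>t - s\<bar>)"

definition eff_dom :: "('a \<Rightarrow> ereal) \<Rightarrow> 'a set" where
  "eff_dom f = {x. f x < \<infinity>}"

definition proper_fun :: "('a \<Rightarrow> ereal) \<Rightarrow> bool" where
  "proper_fun \<phi> \<longleftrightarrow> (\<forall>x. \<phi> x \<noteq> -\<infinity>) \<and> eff_dom \<phi> \<noteq> {}"

definition LSCC ::
  "('a::metric_space) topology \<Rightarrow> ('a \<Rightarrow> ereal) \<Rightarrow> 'a \<Rightarrow> real \<Rightarrow> real \<Rightarrow> bool" where
  "LSCC \<sigma> \<phi> ustar A B \<longleftrightarrow>
     (\<forall>u u0. (\<exists>C. \<forall>n m. dist (u n) (u m) \<le> C) \<longrightarrow> limitin \<sigma> u u0 sequentially \<longrightarrow>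
        \<phi> u0 \<le> liminf (\<lambda>n. \<phi> (u n))) \<and>
     (\<forall>u :: nat \<Rightarrow> 'a. (SUP n. \<phi> (u n)) < \<infinity> \<longrightarrow> (\<exists>C. \<forall>n m. dist (u n) (u m) \<le> C) \<longrightarrow>
        (\<exists>r u0. strict_mono r \<and> limitin \<sigma> (u \<circ> r) u0 sequentially)) \<and>
     A \<ge> 0 \<and> B \<ge> 0 \<and>
     (\<forall>u v. \<phi> u \<ge> ereal (- B * (dist u v)\<^sup>2 - (B * (dist v ustar)\<^sup>2 + A)))"

definition geodesic :: "(real \<Rightarrow> 'a::metric_space) \<Rightarrow> bool" where
  "geodesic \<gamma> \<longleftrightarrow>
     (\<forall>s\<in>{0..1}. \<forall>t\<in>{0..1}. dist (\<gamma> s) (\<gamma> t) = \<bar>t - s\<bar> * dist (\<gamma> 0) (\<gamma> 1))"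

definition geodesically_convex :: "real \<Rightarrow> (('a::metric_space) \<Rightarrow> ereal) \<Rightarrow> bool" where
  "geodesically_convex l \<phi> \<longleftrightarrow>
     (\<forall>v0\<in>eff_dom \<phi>. \<forall>v1\<in>eff_dom \<phi>. \<exists>\<gamma>. geodesic \<gamma> \<and> \<gamma> 0 = v0 \<and> \<gamma> 1 = v1 \<and>
        (\<forall>t\<in>{0..1}. \<phi> (\<gamma> t) \<le> ereal (1 - t) * \<phi> v0 + ereal t * \<phi> v1
            - ereal (l / 2 * t * (1 - t) * (dist v0 v1)\<^sup>2)))"

text \<open>The integral with values in \<open>[-\<infinity>,\<infinity>]\<close>, as the difference of the integrals of the positive and
  negative parts (\<^const>\<open>e2ennreal\<close> sends negative numbers to \<open>0\<close>).\<close>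

definition ereal_integral :: "'b measure \<Rightarrow> ('b \<Rightarrow> ereal) \<Rightarrow> ereal" where
  "ereal_integral M f =
     enn2ereal (\<integral>\<^sup>+ x. e2ennreal (f x) \<partial>M) - enn2ereal (\<integral>\<^sup>+ x. e2ennreal (- f x) \<partial>M)"

definition wed_measure :: "real \<Rightarrow> real measure" where
  "wed_measure \<epsilon> = density lborel (\<lambda>t. ennreal (indicator {0<..} t * (1 / \<epsilon> * exp (- t / \<epsilon>))))"

definition wed_functional :: "real \<Rightarrow> (('a::metric_space) \<Rightarrow> ereal) \<Rightarrow> (real \<Rightarrow> 'a) \<Rightarrow> ereal" where
  "wed_functional \<epsilon> \<phi> u =
     ereal_integral (wed_measure \<epsilon>) (\<lambda>t. ereal (\<epsilon> / 2 * (metric_deriv u t)\<^sup>2) + \<phi> (u t))"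

definition wed_curves :: "real \<Rightarrow> 'a::metric_space \<Rightarrow> (real \<Rightarrow> 'a) set" where
  "wed_curves \<epsilon> x =
     {u. AC2_loc {0..} u \<and> u 0 = x \<and>
         (\<integral>\<^sup>+ t. ennreal ((metric_deriv u t)\<^sup>2) \<partial>wed_measure \<epsilon>) < \<infinity>}"

definition value_fun :: "real \<Rightarrow> (('a::metric_space) \<Rightarrow> ereal) \<Rightarrow> 'a \<Rightarrow> ereal" where
  "value_fun \<epsilon> \<phi> x = (INF u \<in> wed_curves \<epsilon> x. wed_functional \<epsilon> \<phi> u)"

definition ereal_sqrt :: "ereal \<Rightarrow> ereal" where
  "ereal_sqrt x = (if x = \<infinity> then \<infinity> else ereal (sqrt (real_of_ereal x)))"

definition G_fun :: "real \<Rightarrow> (('a::metric_space) \<Rightarrow> ereal) \<Rightarrow> 'a \<Rightarrow> ereal" where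
  "G_fun \<epsilon> \<phi> x =
     (if x \<in> eff_dom (value_fun \<epsilon> \<phi>)
      then ereal_sqrt (2 * (\<phi> x - value_fun \<epsilon> \<phi> x) / ereal \<epsilon>) else \<infinity>)"

text \<open>The limsup runs over \<open>v \<noteq> u\<close> with \<open>v \<longlongrightarrow> u\<close> and \<open>\<phi> v \<longlongrightarrow> \<phi> u\<close>. It is a supremum in \<open>[0,\<infinity>]\<close>: the outer
  \<open>max 0\<close> only matters if there are no such \<open>v\<close>, where the slope is \<open>0\<close> but \<^const>\<open>Limsup\<close> over the
  trivial filter would be \<open>-\<infinity>\<close>.\<close>

definition conditioned_slope ::
  "(('a::metric_space) \<Rightarrow> ereal) \<Rightarrow> ('a \<Rightarrow> ereal) \<Rightarrow> 'a \<Rightarrow> ereal" where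
  "conditioned_slope \<phi> f u =
     max 0 (Limsup (inf (at u) (filtercomap \<phi> (nhds (\<phi> u))))
              (\<lambda>v. max 0 (f u - f v) / ereal (dist u v)))"

end

theory Submission
  imports Defs
begin

text \<open>
Fix \<open>u\<close> with \<open>P = \<phi> u\<close> finite and write \<open>W\<close> for the value of \<open>u\<close>, \<open>V\<close> for the value of a nearby point \<open>v\<close> and \<open>d\<close>
for \<open>dist u v\<close>. Both inequalities between the slope and \<open>G = sqrt (2 (P - W) / \<epsilon>)\<close> compare two ways of
getting from \<open>u\<close> to \<open>v\<close>.

The slope is at most \<open>G\<close>: move from \<open>u\<close> to \<open>v\<close> along the geodesic of the convexity assumption within time
\<open>s\<close>, then continue nearly optimally (\<open>geodesic_competitor\<close>). This gives
\<open>W - V \<le> (1 - exp (- s / \<epsilon>)) (\<epsilon> d\<^sup>2 / (2 s\<^sup>2) + P + |l| d\<^sup>2 - V) + s / (2 \<epsilon>) max 0 (\<phi> v - P)\<close>, which for \<open>\<phi> v\<close> close to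
\<open>P\<close> and \<open>s = d / k\<close>, with a speed \<open>k\<close> slightly above \<open>G\<close>, is at most \<open>k d\<close> (\<open>slope_upper_bound\<close>).

The slope is at least \<open>G\<close>: follow a nearly optimal curve from \<open>u\<close> until time \<open>t\<close> and let \<open>v\<close> be its position.
By dynamic programming, lower semicontinuity of \<open>\<phi>\<close> and the Cauchy--Schwarz inequality, \<open>W - V\<close> is up to small
errors at least \<open>d\<^sup>2 / (2 t) + (t / \<epsilon>) (P - W)\<close>, and this is at least \<open>G d\<close>
(\<open>slope_from_dynamic_programming\<close>). The point is that \<open>v\<close> must be admissible for the conditioned slope:
\<open>\<phi> v\<close> has to be close to \<open>P\<close>. Comparing the curve with the geodesic between the same endpoints, traversed
in the time for which the kinetic terms cancel, shows that the mean of \<open>\<phi>\<close> along the curve exceeds \<open>P\<close> by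
not much more than half of \<open>\<phi> v - P\<close>. On the other hand \<open>t\<close> can be chosen such that this mean is at least
\<open>11 / 20\<close> of the final excess (\<open>good_time_exists\<close>), so the excess is small
(\<open>potential_excess_bound\<close>). The choice of \<open>t\<close> is bounded away from \<open>0\<close> uniformly over nearly optimal curves,
so the error of near optimality can be made small compared with \<open>t\<close> in advance.

The functional contains the metric derivative as a limit that exists almost everywhere only. Hence the
basis of all estimates is that this limit exists, is measurable and controls distances
(\<open>metric_derivative\<close>), which is proved by Vitali coverings. The bound on \<open>B\<close> enters through
\<open>wed_hardy_inequality\<close>: it makes the kinetic energy of nearly optimal curves bounded and the value
function locally bounded below.
\<close>

section \<open>Lebesgue's differentiation theorem on the line\<close>

text \<open>Outer regularity of the measure \<open>h dt\<close>, for which \<open>E\<close> is null, encloses \<open>E\<close> in an open set of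
arbitrarily small \<open>h dt\<close>-measure. The short intervals inside it with average above \<open>lam\<close> have total
length at most \<open>1 / lam\<close> times this measure as soon as they are disjoint, and Vitali's covering
theorem covers the bad points by disjoint ones, up to a null set. Working inside \<open>(-N, N)\<close> keeps all
measures finite.\<close>

lemma large_average_negligible:
  fixes h :: "real \<Rightarrow> real"
  assumes [measurable]: "h \<in> borel_measurable borel" and pos: "\<And>x. 0 \<le> h x"
    and int: "\<And>a b. set_integrable lborel {a..b} h"
    and E[measurable]: "E \<in> sets borel" and zero: "\<And>x. x \<in> E \<Longrightarrow> h x = 0" and lam: "0 < lam"
  shows "negligible {x \<in> E. \<bar>x\<bar> < N \<and>
     (\<forall>d>0. \<exists>s. \<bar>s - x\<bar> < d \<and> lam * \<bar>s - x\<bar> < (LBINT r:closed_segment x s. h r))}" (is "negligible ?B")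
proof -
  let ?J = "{-N<..<N}"
  define \<nu> where "\<nu> = density lborel (\<lambda>x. ennreal (indicator ?J x * h x))"
  have nu: "emeasure \<nu> S = (\<integral>\<^sup>+x. ennreal (indicator ?J x * h x) * indicator S x \<partial>lborel)" if "S \<in> sets borel" for S
    unfolding \<nu>_def using that by (subst emeasure_density) auto
  have nu_cball: "emeasure \<nu> S = ennreal (LBINT r:S. h r)"
    if "S \<in> sets borel" "S \<subseteq> ?J" for S
  proof -
    have "set_integrable lborel S h"
      by (rule set_integrable_subset[OF int[of "-N" N]]) (use that in \<open>auto\<close>)
    then have "(\<integral>\<^sup>+x. ennreal (indicator S x * h x) \<partial>lborel) = ennreal (LBINT r:S. h r)"
      unfolding set_integrable_def set_lebesgue_integral_def
      by (subst nn_integral_eq_integral) (auto simp: pos)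
    moreover have "emeasure \<nu> S = (\<integral>\<^sup>+x. ennreal (indicator S x * h x) \<partial>lborel)"
      unfolding nu[OF that(1)] using that(2)
      by (intro nn_integral_cong) (auto split: split_indicator)
    ultimately show ?thesis by simp
  qed
  have "finite_measure \<nu>"
  proof
    have "emeasure \<nu> (space \<nu>) = emeasure \<nu> ?J"
      unfolding \<nu>_def by (auto simp: emeasure_density intro!: nn_integral_cong split: split_indicator)
    then show "emeasure \<nu> (space \<nu>) \<noteq> \<infinity>" using nu_cball[of ?J] by simp
  qed
  then have fin: "emeasure \<nu> (space \<nu>) \<noteq> \<infinity>" by (simp add: finite_measure.emeasure_finite)
  show ?thesis
    unfolding negligible_outer_le
  proof (intro allI impI)
    fix e :: real assume "e > 0"
    have "emeasure \<nu> (E \<inter> ?J) = 0"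
      by (subst nu) (auto simp: zero intro!: nn_integral_zero' AE_I2 split: split_indicator)
    moreover have "emeasure \<nu> (E \<inter> ?J) = (INF U \<in> {U. E \<inter> ?J \<subseteq> U \<and> open U}. emeasure \<nu> U)"
      by (rule outer_regular) (use fin in \<open>auto simp: \<nu>_def\<close>)
    ultimately have "(INF U \<in> {U. E \<inter> ?J \<subseteq> U \<and> open U}. emeasure \<nu> U) < ennreal (e * lam)"
      using \<open>e > 0\<close> lam by simp
    then obtain U where U: "E \<inter> ?J \<subseteq> U" "open U" "emeasure \<nu> U < ennreal (e * lam)"
      unfolding INF_less_iff by auto
    define K where "K = {(c::real, r). 0 < r \<and> cball c r \<subseteq> U \<inter> ?J \<and> lam * (2 * r) < (LBINT t:cball c r. h t)}"
    have Kpos: "\<And>i. i \<in> K \<Longrightarrow> 0 < snd i" by (auto simp: K_def)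
    have fine: "\<exists>i. i \<in> K \<and> x \<in> cball (fst i) (snd i) \<and> snd i < d" if x: "x \<in> ?B" and d: "0 < d" for x d
    proof -
      have "x \<in> U \<inter> ?J" "open (U \<inter> ?J)" using x U by (auto simp: subset_iff)
      then obtain \<rho> where \<rho>: "\<rho> > 0" "ball x \<rho> \<subseteq> U \<inter> ?J" by (meson openE)
      obtain s where s: "\<bar>s - x\<bar> < min d \<rho>" "lam * \<bar>s - x\<bar> < (LBINT r:closed_segment x s. h r)"
      proof -
        have "min d \<rho> > 0" using d \<rho> by simp
        then show ?thesis using x that by blast
      qed
      have "(LBINT r:{x}. h r) = 0"
        unfolding set_lebesgue_integral_def
        by (rule integral_eq_zero_AE) (use AE_lborel_singleton[of x] in \<open>eventually_elim, auto\<close>)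
      then have "s \<noteq> x" using s(2) by auto
      define c r where "c = (x + s) / 2" and "r = \<bar>s - x\<bar> / 2"
      have seg: "closed_segment x s = cball c r"
        unfolding closed_segment_eq_real_ivl cball_eq_atLeastAtMost c_def r_def by (auto simp: field_simps abs_if)
      have "cball c r \<subseteq> ball x \<rho>"
      proof -
        have "dist c x + r = \<bar>s - x\<bar>" unfolding c_def r_def dist_real_def by (simp add: field_simps abs_if)
        then show ?thesis using s(1) by (simp add: cball_subset_ball_iff)
      qed
      then have "(c, r) \<in> K" unfolding K_def using \<rho> s(2) \<open>s \<noteq> x\<close> unfolding seg r_def[symmetric]
        by (auto simp: r_def)
      moreover have "x \<in> cball c r" using seg[symmetric] by auto
      moreover have "r < d" using s(1) \<open>s \<noteq> x\<close> d by (auto simp: r_def)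
      ultimately show ?thesis by (intro exI[of _ "(c, r)"]) auto
    qed
    obtain C where C: "countable C" "C \<subseteq> K"
      "pairwise (\<lambda>i j. disjnt (cball (fst i) (snd i)) (cball (fst j) (snd j))) C"
      "negligible (?B - (\<Union>i\<in>C. cball (fst i) (snd i)))"
      by (rule Vitali_covering_theorem_cballs[OF Kpos fine])
    let ?X = "\<lambda>i::real \<times> real. cball (fst i) (snd i)"
    have disj: "disjoint_family_on ?X C"
      using C(3) by (auto simp: disjoint_family_on_def pairwise_def disjnt_def)
    have [measurable]: "(\<Union>i\<in>C. ?X i) \<in> sets borel" using C(1) by (intro sets.countable_UN') auto
    have "ennreal lam * emeasure lborel (\<Union>i\<in>C. ?X i) = (\<integral>\<^sup>+i. ennreal lam * emeasure lborel (?X i) \<partial>count_space C)"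
      by (subst emeasure_UN_countable[OF _ C(1) disj]) (auto simp: nn_integral_cmult)
    also have "\<dots> \<le> (\<integral>\<^sup>+i. emeasure \<nu> (?X i) \<partial>count_space C)"
    proof (intro nn_integral_mono)
      fix i assume "i \<in> space (count_space C)"
      then have i: "i \<in> K" using C by auto
      then have "emeasure \<nu> (?X i) = ennreal (LBINT t:?X i. h t)"
        by (intro nu_cball) (auto simp: K_def)
      moreover have "ennreal lam * emeasure lborel (?X i) = ennreal (lam * (2 * snd i))"
        using i lam by (simp add: K_def cball_eq_atLeastAtMost case_prod_unfold flip: ennreal_mult)
      ultimately show "ennreal lam * emeasure lborel (?X i) \<le> emeasure \<nu> (?X i)"
        using i by (auto simp: K_def intro!: ennreal_leI)
    qed
    also have "\<dots> = emeasure \<nu> (\<Union>i\<in>C. ?X i)"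
      by (subst emeasure_UN_countable[OF _ C(1) disj]) (auto simp: \<nu>_def)
    also have "\<dots> \<le> emeasure \<nu> U"
    proof (intro emeasure_mono)
      have "?X i \<subseteq> U" if "i \<in> C" for i using that C(2) by (cases i) (auto simp: K_def)
      then show "(\<Union>i\<in>C. ?X i) \<subseteq> U" by blast
    qed (use U in \<open>simp add: \<nu>_def\<close>)
    also have "\<dots> \<le> ennreal lam * ennreal e"
      using U(3) lam \<open>e > 0\<close> by (simp add: ennreal_mult' mult.commute less_imp_le)
    finally have le: "emeasure lborel (\<Union>i\<in>C. ?X i) \<le> ennreal e"
      using lam by (subst (asm) ennreal_mult_le_mult_iff) auto
    let ?T = "(?B - (\<Union>i\<in>C. ?X i)) \<union> (\<Union>i\<in>C. ?X i)"
    have U1: "(\<Union>i\<in>C. ?X i) \<in> lmeasurable"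
      using le by (intro fmeasurableI) (auto simp: top.not_eq_extremum intro: le_less_trans)
    have "measure lebesgue (\<Union>i\<in>C. ?X i) \<le> e"
      using le \<open>e > 0\<close> by (simp add: measure_def enn2real_leI)
    then have "measure lebesgue ?T \<le> e"
      using measure_Un_null_set[of "\<Union>i\<in>C. ?X i" lebesgue "?B - (\<Union>i\<in>C. ?X i)"] C(4) U1
      by (simp add: negligible_iff_null_sets Un_commute fmeasurableD)
    moreover have "?T \<in> lmeasurable"
      using U1 negligible_imp_measurable[OF C(4)] by (rule fmeasurable.Un[rotated])
    ultimately show "\<exists>T. ?B \<subseteq> T \<and> T \<in> lmeasurable \<and> measure lebesgue T \<le> e" 
      by (intro exI[of _ ?T]) auto
  qed
qed

lemma average_vanishes_AE:
  fixes h :: "real \<Rightarrow> real"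
  assumes [measurable]: "h \<in> borel_measurable borel" and "\<And>x. 0 \<le> h x"
    and "\<And>a b. set_integrable lborel {a..b} h"
    and [measurable]: "E \<in> sets borel" and "\<And>x. x \<in> E \<Longrightarrow> h x = 0"
  shows "AE x in lborel. x \<in> E \<longrightarrow>
     (\<forall>e>0. \<exists>d>0. \<forall>s. \<bar>s - x\<bar> < d \<longrightarrow> (LBINT r:closed_segment x s. h r) \<le> e * \<bar>s - x\<bar>)"
proof -
  define B where "B n k = {x \<in> E. \<bar>x\<bar> < real n \<and>
     (\<forall>d>0. \<exists>s. \<bar>s - x\<bar> < d \<and> (1 / real (Suc k)) * \<bar>s - x\<bar> < (LBINT r:closed_segment x s. h r))}" for n k :: nat
  have "negligible (B n k)" for n k
    unfolding B_def by (rule large_average_negligible) (use assms in auto)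
  then have "AE x in lebesgue. \<forall>n k. x \<notin> B n k"
    by (auto simp: AE_all_countable negligible_iff_null_sets intro: AE_not_in)
  then have "AE x in lborel. \<forall>n k. x \<notin> B n k"
    by (simp only: AE_completion_iff)
  then show ?thesis
  proof (eventually_elim, intro impI allI)
    fix x e :: real assume x: "\<forall>n k. x \<notin> B n k" "x \<in> E" "0 < e"
    obtain n where n: "\<bar>x\<bar> < real n" using reals_Archimedean2 by blast
    obtain k where k: "1 / real (Suc k) < e" using x(3) by (metis inverse_eq_divide reals_Archimedean)
    have "x \<notin> B n k" using x(1) by blast
    then have "\<not> (\<forall>d>0. \<exists>s. \<bar>s - x\<bar> < d \<and> (1 / real (Suc k)) * \<bar>s - x\<bar> < (LBINT r:closed_segment x s. h r))"
      unfolding B_def using n x(2) by blast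
    then obtain d where d: "d > 0"
      "\<And>s. \<bar>s - x\<bar> < d \<Longrightarrow> (LBINT r:closed_segment x s. h r) \<le> (1 / real (Suc k)) * \<bar>s - x\<bar>"
      by (meson not_le)
    show "\<exists>d>0. \<forall>s. \<bar>s - x\<bar> < d \<longrightarrow> (LBINT r:closed_segment x s. h r) \<le> e * \<bar>s - x\<bar>"
      using d(1) by (intro exI[of _ d]) (auto intro!: order.trans[OF d(2)] mult_right_mono less_imp_le[OF k])
  qed
qed

lemma set_integrable_const_Icc: "set_integrable lborel {a..b::real} (\<lambda>_. c::real)"
  by (rule borel_integrable_atLeastAtMost') (rule continuous_on_const)

text \<open>For rational \<open>p > f x\<close> split \<open>f \<le> p + max 0 (f - p)\<close>: the second summand vanishes on \<open>{f \<le> p}\<close>, so its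
averages tend to \<open>0\<close> there, and the averages of \<open>f\<close> end up at most \<open>p\<close> in the limit.\<close>

lemma Lebesgue_differentiation_upper:
  fixes f :: "real \<Rightarrow> real"
  assumes f: "integrable lborel f"
  shows "AE x in lborel. \<forall>e>0. \<exists>d>0. \<forall>s. \<bar>s - x\<bar> < d \<longrightarrow>
     (LBINT r:closed_segment x s. f r) \<le> (f x + e) * \<bar>s - x\<bar>"
proof -
  have [measurable]: "f \<in> borel_measurable borel" using f by auto
  define h where "h p x = max 0 (f x - p)" for p x
  have fint: "set_integrable lborel {a..b} f" for a b
    using f unfolding set_integrable_def by (intro integrable_mult_indicator) auto
  have hint: "set_integrable lborel {a..b} (h p)" for p a b
  proof -
    have "set_integrable lborel {a..b} (\<lambda>x. (f x - p + \<bar>f x - p\<bar>) / 2)"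
      using fint by (intro set_integrable_divide set_integral_add set_integral_diff set_integrable_abs set_integrable_const_Icc) auto
    moreover have "h p = (\<lambda>x. (f x - p + \<bar>f x - p\<bar>) / 2)" by (auto simp: h_def fun_eq_iff max_def abs_if)
    ultimately show ?thesis by simp
  qed
  have "AE x in lborel. \<forall>p\<in>\<rat>. x \<in> {x. f x \<le> p} \<longrightarrow>
     (\<forall>e>0. \<exists>d>0. \<forall>s. \<bar>s - x\<bar> < d \<longrightarrow> (LBINT r:closed_segment x s. h p r) \<le> e * \<bar>s - x\<bar>)"
    by (subst AE_ball_countable[OF countable_rat], intro ballI average_vanishes_AE hint) (auto simp: h_def)
  then show ?thesis
  proof (eventually_elim, intro impI allI)
    fix x e :: real
    assume x: "\<forall>p\<in>\<rat>. x \<in> {x. f x \<le> p} \<longrightarrow>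
     (\<forall>e>0. \<exists>d>0. \<forall>s. \<bar>s - x\<bar> < d \<longrightarrow> (LBINT r:closed_segment x s. h p r) \<le> e * \<bar>s - x\<bar>)" and "0 < e"
    obtain p where p: "p \<in> \<rat>" "f x < p" "p < f x + e / 2"
      using Rats_dense_in_real[of "f x" "f x + e/2"] \<open>0 < e\<close> by auto
    with x \<open>0 < e\<close> obtain d where d: "d > 0"
      "\<And>s. \<bar>s - x\<bar> < d \<Longrightarrow> (LBINT r:closed_segment x s. h p r) \<le> (e/2) * \<bar>s - x\<bar>"
      by (metis (no_types, lifting) half_gt_zero less_imp_le mem_Collect_eq)
    show "\<exists>d>0. \<forall>s. \<bar>s - x\<bar> < d \<longrightarrow> (LBINT r:closed_segment x s. f r) \<le> (f x + e) * \<bar>s - x\<bar>"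
    proof (intro exI[of _ d] conjI allI impI)
      fix s assume s: "\<bar>s - x\<bar> < d"
      have "(LBINT r:closed_segment x s. f r) \<le> (LBINT r:closed_segment x s. p + h p r)"
        using fint hint[of _ _ p] hint[of _ _ p, unfolded h_def] unfolding closed_segment_eq_real_ivl
        by (auto intro!: set_integral_mono set_integral_add set_integrable_const_Icc simp: h_def)
      also have "\<dots> = p * \<bar>s - x\<bar> + (LBINT r:closed_segment x s. h p r)"
        using hint unfolding closed_segment_eq_real_ivl
        by (auto simp: set_integral_add set_integrable_const_Icc set_integral_const)
      also have "\<dots> \<le> (f x + e / 2) * \<bar>s - x\<bar> + (e/2) * \<bar>s - x\<bar>"
        using d(2)[OF s] p by (intro add_mono mult_right_mono) auto
      finally show "(LBINT r:closed_segment x s. f r) \<le> (f x + e) * \<bar>s - x\<bar>"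
        by (simp add: algebra_simps)
    qed (fact d)
  qed
qed

theorem Lebesgue_differentiation:
  fixes f :: "real \<Rightarrow> real"
  assumes f: "integrable lborel f"
  shows "AE x in lborel. \<forall>e>0. \<exists>d>0. \<forall>s. \<bar>s - x\<bar> < d \<longrightarrow>
     \<bar>(LBINT r:closed_segment x s. f r) - f x * \<bar>s - x\<bar>\<bar> \<le> e * \<bar>s - x\<bar>"
proof -
  have "integrable lborel (\<lambda>x. - f x)" using f by simp
  from Lebesgue_differentiation_upper[OF this] Lebesgue_differentiation_upper[OF f]
  show ?thesis
  proof (eventually_elim, intro impI allI)
    fix x e :: real assume "0 < e"
      and 1: "\<forall>e>0. \<exists>d>0. \<forall>s. \<bar>s - x\<bar> < d \<longrightarrow> (LBINT r:closed_segment x s. - f r) \<le> (- f x + e) * \<bar>s - x\<bar>"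
      and 2: "\<forall>e>0. \<exists>d>0. \<forall>s. \<bar>s - x\<bar> < d \<longrightarrow> (LBINT r:closed_segment x s. f r) \<le> (f x + e) * \<bar>s - x\<bar>"
    obtain d1 d2 where "d1 > 0" "d2 > 0" 
      and d1: "\<And>s. \<bar>s - x\<bar> < d1 \<Longrightarrow> (LBINT r:closed_segment x s. - f r) \<le> (- f x + e) * \<bar>s - x\<bar>"
      and d2: "\<And>s. \<bar>s - x\<bar> < d2 \<Longrightarrow> (LBINT r:closed_segment x s. f r) \<le> (f x + e) * \<bar>s - x\<bar>"
      using 1[rule_format, OF \<open>0 < e\<close>] 2[rule_format, OF \<open>0 < e\<close>] by blast
    have minus: "(LBINT r:closed_segment x s. - f r) = - (LBINT r:closed_segment x s. f r)" for s
      unfolding set_lebesgue_integral_def by simp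
    show "\<exists>d>0. \<forall>s. \<bar>s - x\<bar> < d \<longrightarrow> \<bar>(LBINT r:closed_segment x s. f r) - f x * \<bar>s - x\<bar>\<bar> \<le> e * \<bar>s - x\<bar>"
    proof (intro exI[of _ "min d1 d2"] conjI allI impI)
      fix s assume "\<bar>s - x\<bar> < min d1 d2"
      then show "\<bar>(LBINT r:closed_segment x s. f r) - f x * \<bar>s - x\<bar>\<bar> \<le> e * \<bar>s - x\<bar>"
        using d1[of s] d2[of s] unfolding minus by (simp add: algebra_simps abs_le_iff)
    qed (use \<open>d1 > 0\<close> \<open>d2 > 0\<close> in simp)
  qed
qed

section \<open>The metric derivative\<close>

text \<open>The triangle inequality over finitely many disjoint intervals, the gaps between them being crossed
at the price of the dominating function \<open>m\<close>. The induction peels off the rightmost interval and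
moves the right endpoint of \<open>{a..b}\<close> to its left end. The intervals are given by centre and radius,
as Vitali's theorem delivers them.\<close>

lemma dist_le_finite_pieces:
  fixes u :: "real \<Rightarrow> 'a::metric_space" and m :: "real \<Rightarrow> real"
  assumes m: "integrable lborel m" "\<And>x. 0 \<le> m x"
    and um: "\<And>s t. s \<le> t \<Longrightarrow> dist (u s) (u t) \<le> (LBINT r:{s..t}. m r)"
  shows "finite F \<Longrightarrow> (\<And>i. i \<in> F \<Longrightarrow> 0 \<le> snd i \<and> cball (fst i) (snd i) \<subseteq> {a..b}) \<Longrightarrow>
    pairwise (\<lambda>i j. disjnt (cball (fst i) (snd i)) (cball (fst j) (snd j))) F \<Longrightarrow> a \<le> b \<Longrightarrow>
    dist (u a) (u b) \<le> (\<Sum>i\<in>F. dist (u (fst i - snd i)) (u (fst i + snd i)))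
       + (LBINT r:{a..b} - (\<Union>i\<in>F. cball (fst i) (snd i)). m r)"
proof (induction F arbitrary: b rule: finite_ranking_induct[where f = fst])
  case empty
  then show ?case using um by simp
next
  case (insert x S)
  show ?case
  proof (cases "x \<in> S")
    case True
    then show ?thesis using insert by (simp add: insert_absorb)
  next
    case False
    let ?X = "\<lambda>i::real \<times> real. cball (fst i) (snd i)"
    let ?U = "\<Union>i\<in>S. ?X i"
    define l r where "l = fst x - snd x" and "r = fst x + snd x"
    have x: "0 \<le> snd x" "?X x = {l..r}" using insert(4)[of x] by (auto simp: l_def r_def cball_eq_atLeastAtMost)
    then have lr: "a \<le> l" "l \<le> r" "r \<le> b" using insert(4)[of x] by (auto simp: l_def r_def)
    have left: "0 \<le> snd i" "?X i \<subseteq> {a..<l}" if "i \<in> S" for i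
    proof -
      show i: "0 \<le> snd i" using insert(4)[of i] that by auto
      have "i \<noteq> x" using that False by auto
      then have "disjnt (?X i) (?X x)" using pairwiseD[OF insert(5), of i x] that by auto
      moreover have "fst i \<le> fst x" using insert(2) that by auto
      ultimately have "fst i + snd i < l" using i x(1)
        by (force simp: disjnt_iff cball_eq_atLeastAtMost l_def dest: spec[of _ "max l (fst i)"])
      then show "?X i \<subseteq> {a..<l}" using insert(4)[of i] that by (auto simp: cball_eq_atLeastAtMost)
    qed
    have IH: "dist (u a) (u l) \<le> (\<Sum>i\<in>S. dist (u (fst i - snd i)) (u (fst i + snd i)))
         + (LBINT r:{a..l} - ?U. m r)"
    proof (rule insert(3))
      show "0 \<le> snd i \<and> ?X i \<subseteq> {a..l}" if "i \<in> S" for i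
        using left[OF that] by (auto simp: subset_iff less_imp_le)
    qed (use lr insert(5) in \<open>auto simp: pairwise_insert\<close>)
    have [measurable]: "?U \<in> sets borel" using insert(1) by (intro sets.finite_UN) auto
    have mi: "integrable lborel (\<lambda>x. indicator A x *\<^sub>R m x)" if "A \<in> sets borel" for A
      using that m(1) by (intro integrable_mult_indicator) auto
    have "(LBINT r:{a..l} - ?U. m r) + (LBINT r:{r..b}. m r) =
          (LINT t|lborel. indicator ({a..l} - ?U) t *\<^sub>R m t + indicator {r..b} t *\<^sub>R m t)"
      unfolding set_lebesgue_integral_def by (intro Bochner_Integration.integral_add[symmetric] mi) auto
    also have "\<dots> = (LBINT r:{a..b} - (\<Union>i\<in>insert x S. ?X i). m r)"
      unfolding set_lebesgue_integral_def
    proof (rule integral_cong_AE)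
      show "AE t in lborel. indicator ({a..l} - ?U) t *\<^sub>R m t + indicator {r..b} t *\<^sub>R m t =
        indicator ({a..b} - (\<Union>i\<in>insert x S. ?X i)) t *\<^sub>R m t"
        using AE_lborel_singleton[of l] AE_lborel_singleton[of r]
      proof eventually_elim
        case (elim t)
        have 1: "t \<notin> ?U" if "l \<le> t" using left(2) that by fastforce
        have 2: "t \<in> (\<Union>i\<in>insert x S. ?X i) \<longleftrightarrow> l \<le> t \<and> t \<le> r \<or> t \<in> ?U" using x(2) by auto
        consider "t < l" | "l < t" "t < r" | "r < t" using elim by linarith
        then show ?case
          by cases (use 1 2 lr in \<open>simp_all add: indicator_def\<close>)
      qed
    qed (use m(1) in \<open>auto simp: x(2)\<close>)
    finally have split: "(LBINT r:{a..l} - ?U. m r) + (LBINT r:{r..b}. m r) =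
       (LBINT r:{a..b} - (\<Union>i\<in>insert x S. ?X i). m r)" .
    have "dist (u a) (u b) \<le> dist (u a) (u l) + dist (u l) (u r) + dist (u r) (u b)"
      using dist_triangle[of "u a" "u b" "u l"] dist_triangle[of "u l" "u b" "u r"] by linarith
    also have "\<dots> \<le> ((\<Sum>i\<in>S. dist (u (fst i - snd i)) (u (fst i + snd i)))
         + (LBINT r:{a..l} - ?U. m r)) + dist (u l) (u r) + (LBINT r:{r..b}. m r)"
      using IH um[OF lr(3)] by simp
    also have "\<dots> = (\<Sum>i\<in>insert x S. dist (u (fst i - snd i)) (u (fst i + snd i)))
        + (LBINT r:{a..b} - (\<Union>i\<in>insert x S. ?X i). m r)"
      unfolding split[symmetric] using insert(1) False by (simp add: l_def r_def)
    finally show ?thesis .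
  qed
qed

lemma continuous_if_dist_le_integral:
  fixes u :: "real \<Rightarrow> 'a::metric_space" and m :: "real \<Rightarrow> real"
  assumes m: "integrable lborel m"
    and um: "\<And>s t. s \<le> t \<Longrightarrow> dist (u s) (u t) \<le> (LBINT r:{s..t}. m r)"
  shows "continuous_on UNIV u"
proof (rule continuous_at_imp_continuous_on, rule ballI)
  fix t :: real
  let ?a = "t - 1" and ?b = "t + 1"
  let ?M = "\<lambda>s. integral {?a..s} m"
  have si: "set_integrable lborel {a..b} m" for a b
    using m unfolding set_integrable_def by (intro integrable_mult_indicator) auto
  have mi: "m integrable_on {a..b}" "integral {a..b} m = (LBINT r:{a..b}. m r)" for a b
    using set_borel_integral_eq_integral[OF si] by auto
  have "continuous_on {?a..?b} ?M" by (rule indefinite_integral_continuous_1) (rule mi)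
  then have "(?M \<longlongrightarrow> ?M t) (at t within {?a..?b})" by (auto simp: continuous_on_def)
  then have M: "(?M \<longlongrightarrow> ?M t) (at t)" by (subst (asm) at_within_interior) auto
  have "eventually (\<lambda>s. s \<in> {?a<..<?b}) (at t)"
    by (rule eventually_at_in_open') auto
  then have "eventually (\<lambda>s. dist (u s) (u t) \<le> \<bar>?M s - ?M t\<bar>) (at t)"
  proof eventually_elim
    case (elim s)
    have *: "dist (u p) (u q) \<le> \<bar>?M q - ?M p\<bar>" if "?a \<le> p" "p \<le> q" for p q
      using um[OF that(2)] Henstock_Kurzweil_Integration.integral_combine[OF that mi(1)] mi(2)[of p q] by simp
    show ?case using *[of s t] *[of t s] elim by (cases "s \<le> t") (auto simp: dist_commute abs_minus_commute)
  qed
  then have le: "eventually (\<lambda>s. norm (dist (u s) (u t)) \<le> \<bar>?M s - ?M t\<bar>) (at t)"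
    by (rule eventually_mono) simp
  have "((\<lambda>s. \<bar>?M s - ?M t\<bar>) \<longlongrightarrow> \<bar>?M t - ?M t\<bar>) (at t)"
    by (rule tendsto_rabs[OF tendsto_diff[OF M tendsto_const]])
  then have "((\<lambda>s. \<bar>?M s - ?M t\<bar>) \<longlongrightarrow> 0) (at t)" by simp
  with le have "((\<lambda>s. dist (u s) (u t)) \<longlongrightarrow> 0) (at t)"
    by (rule Lim_null_comparison)
  then show "isCont u t" unfolding isCont_def by (rule iffD2[OF tendsto_dist_iff])
qed

text \<open>The lower limit of the difference quotients. As an infimum over \<open>h\<close> of continuous functions, taken
over countably many scales, it is Borel measurable.\<close>

definition lower_speed :: "(real \<Rightarrow> 'a::metric_space) \<Rightarrow> real \<Rightarrow> ennreal" where
  "lower_speed u t = (SUP n::nat. INF h\<in>{h. 0 < \<bar>h\<bar> \<and> \<bar>h\<bar> < 1 / real (Suc n)}. ennreal (dist (u (t + h)) (u t) / \<bar>h\<bar>))"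

lemma lower_speed_measurable:
  assumes u: "continuous_on UNIV u"
  shows "lower_speed u \<in> borel_measurable borel"
proof -
  have "(\<lambda>t. INF h\<in>{h. 0 < \<bar>h\<bar> \<and> \<bar>h\<bar> < 1 / real (Suc n)}. ennreal (dist (u (t + h)) (u t) / \<bar>h\<bar>)) \<in> borel_measurable borel" for n
  proof (rule borel_measurableI_less)
    fix y :: ennreal
    have "open {t. ennreal (dist (u (t + h)) (u t) / \<bar>h\<bar>) < y}" if "0 < \<bar>h\<bar>" for h
    proof (intro open_Collect_less continuous_on_ennreal continuous_intros)
      show "continuous_on UNIV (\<lambda>t. u (t + h))"
        by (rule continuous_on_compose2[OF u]) (auto intro!: continuous_intros)
      show "continuous_on UNIV u" by (rule u)
    qed (use that in auto)
    then have "open (\<Union>h\<in>{h. 0 < \<bar>h\<bar> \<and> \<bar>h\<bar> < 1 / real (Suc n)}. {t. ennreal (dist (u (t + h)) (u t) / \<bar>h\<bar>) < y})"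
      by (intro open_UN ballI) auto
    moreover have "{t \<in> space borel. (INF h\<in>{h. 0 < \<bar>h\<bar> \<and> \<bar>h\<bar> < 1 / real (Suc n)}. ennreal (dist (u (t + h)) (u t) / \<bar>h\<bar>)) < y}
      = (\<Union>h\<in>{h. 0 < \<bar>h\<bar> \<and> \<bar>h\<bar> < 1 / real (Suc n)}. {t. ennreal (dist (u (t + h)) (u t) / \<bar>h\<bar>) < y})"
      by (auto simp: INF_less_iff)
    ultimately show "{t \<in> space borel. (INF h\<in>{h. 0 < \<bar>h\<bar> \<and> \<bar>h\<bar> < 1 / real (Suc n)}. ennreal (dist (u (t + h)) (u t) / \<bar>h\<bar>)) < y} \<in> sets borel"
      by auto
  qed
  then show ?thesis unfolding lower_speed_def[abs_def] by (intro borel_measurable_SUP) auto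
qed

lemma lower_speed_witness:
  assumes lt: "lower_speed u t < ennreal c" and d: "0 < d"
  shows "\<exists>h. 0 < \<bar>h\<bar> \<and> \<bar>h\<bar> < d \<and> dist (u (t + h)) (u t) / \<bar>h\<bar> < c"
proof -
    obtain n where n: "1 / real (Suc n) < d" using d by (metis inverse_eq_divide reals_Archimedean)
    have "(INF h\<in>{h. 0 < \<bar>h\<bar> \<and> \<bar>h\<bar> < 1 / real (Suc n)}. ennreal (dist (u (t + h)) (u t) / \<bar>h\<bar>)) \<le> lower_speed u t"
      unfolding lower_speed_def by (rule SUP_upper) simp
    then have "(INF h\<in>{h. 0 < \<bar>h\<bar> \<and> \<bar>h\<bar> < 1 / real (Suc n)}. ennreal (dist (u (t + h)) (u t) / \<bar>h\<bar>)) < ennreal c"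
      using lt by (rule le_less_trans)
    then obtain h where "0 < \<bar>h\<bar>" "\<bar>h\<bar> < 1 / real (Suc n)" "ennreal (dist (u (t + h)) (u t) / \<bar>h\<bar>) < ennreal c"
      unfolding INF_less_iff by auto
    then show ?thesis using n by (intro exI[of _ h]) (auto simp: ennreal_less_iff)
  qed
lemma lower_speed_le:
  fixes u :: "real \<Rightarrow> 'a::metric_space" and m :: "real \<Rightarrow> real"
  assumes m: "integrable lborel m" "\<And>x. 0 \<le> m x"
    and um: "\<And>s t. s \<le> t \<Longrightarrow> dist (u s) (u t) \<le> (LBINT r:{s..t}. m r)"
  shows "AE t in lborel. lower_speed u t \<le> ennreal (m t)"
proof -
  have seg: "dist (u s) (u t) \<le> (LBINT r:closed_segment t s. m r)" for s t
    using um[of s t] um[of t s] by (auto simp: closed_segment_eq_real_ivl dist_commute)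
  show ?thesis
    using Lebesgue_differentiation[OF m(1)]
  proof eventually_elim
    case (elim t)
    have "lower_speed u t \<le> ennreal (m t) + ennreal e" if e: "0 < e" for e
      unfolding lower_speed_def
    proof (rule SUP_least)
      fix n :: nat
      obtain d where d: "d > 0" "\<And>s. \<bar>s - t\<bar> < d \<Longrightarrow> \<bar>(LBINT r:closed_segment t s. m r) - m t * \<bar>s - t\<bar>\<bar> \<le> e * \<bar>s - t\<bar>"
        using elim e by blast
      define p where "p = 1 / real (Suc n)"
      define h where "h = min d p / 2"
      have "0 < p" by (simp add: p_def)
      then have h: "0 < h" "h < d" "h < p" using d(1) by (auto simp: h_def min_def)
      have eq: "\<bar>t + h - t\<bar> = h" using h(1) by simp
      have "\<bar>(LBINT r:closed_segment t (t + h). m r) - m t * h\<bar> \<le> e * h"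
        using d(2)[of "t + h", unfolded eq, OF h(2)] .
      then have "dist (u (t + h)) (u t) \<le> m t * h + e * h"
        using seg[of "t+h" t] by linarith
      then have "dist (u (t + h)) (u t) \<le> (m t + e) * h" by (simp only: distrib_right)
      then have "dist (u (t + h)) (u t) / \<bar>h\<bar> \<le> m t + e" using h by (simp add: field_simps)
      then have "ennreal (dist (u (t + h)) (u t) / \<bar>h\<bar>) \<le> ennreal (m t) + ennreal e"
        using ennreal_leI[of _ "m t + e"] m(2)[of t] e by (simp add: ennreal_plus)
      then show "(INF h\<in>{h. 0 < \<bar>h\<bar> \<and> \<bar>h\<bar> < 1 / real (Suc n)}. ennreal (dist (u (t + h)) (u t) / \<bar>h\<bar>)) \<le> ennreal (m t) + ennreal e"
        by (rule INF_lower2[rotated]) (use h[unfolded p_def] in simp)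
    qed
    then show ?case by (rule ennreal_le_epsilon) auto
  qed
qed

text \<open>If almost every time lies in arbitrarily short intervals across which \<open>u\<close> moves by at most the
integral of \<open>g\<close> plus \<open>\<eta>\<close> per unit length, the same holds across \<open>[a, b]\<close>. By Vitali such
intervals exhaust \<open>[a, b]\<close> up to a null set; finitely many of them leave out a set on which the
integral of \<open>m\<close> is as small as desired, and the gaps cost no more than that.\<close>

lemma dist_le_integral_if_fine_pieces:
  fixes u :: "real \<Rightarrow> 'a::metric_space" and m g :: "real \<Rightarrow> real"
  assumes m: "integrable lborel m" "\<And>x. 0 \<le> m x"
    and um: "\<And>s t. s \<le> t \<Longrightarrow> dist (u s) (u t) \<le> (LBINT r:{s..t}. m r)"
    and gi: "integrable lborel g" and g0: "\<And>t. 0 \<le> g t" and "a < b" and \<eta>: "0 < \<eta>"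
    and fine_pieces: "AE t in lborel. \<forall>d>0. \<exists>h. 0 < \<bar>h\<bar> \<and> \<bar>h\<bar> < d \<and>
        dist (u (t + h)) (u t) \<le> (LBINT r:closed_segment t (t + h). g r) + \<eta> * \<bar>h\<bar>"
  shows "dist (u a) (u b) \<le> (LBINT r:{a..b}. g r) + \<eta> * (b - a)"
proof -
  have [measurable]: "m \<in> borel_measurable borel" "g \<in> borel_measurable borel" using m(1) gi by auto
  have gset: "set_integrable lborel A g" if "A \<in> sets borel" for A
    unfolding set_integrable_def using that gi by (intro integrable_mult_indicator) auto
  let ?X = "\<lambda>i::real \<times> real. cball (fst i) (snd i)"
  define S where "S = {t \<in> {a<..<b}. \<forall>d>0. \<exists>h. 0 < \<bar>h\<bar> \<and> \<bar>h\<bar> < d \<and>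
        dist (u (t + h)) (u t) \<le> (LBINT r:closed_segment t (t + h). g r) + \<eta> * \<bar>h\<bar>}"
  define K where "K = {i. 0 < snd i \<and> ?X i \<subseteq> {a..b} \<and>
     dist (u (fst i - snd i)) (u (fst i + snd i)) \<le> (LBINT r:?X i. g r) + \<eta> * (2 * snd i)}"
  have Kpos: "\<And>i. i \<in> K \<Longrightarrow> 0 < snd i" by (auto simp: K_def)
  have fine: "\<exists>i. i \<in> K \<and> x \<in> ?X i \<and> snd i < d" if x: "x \<in> S" and d: "0 < d" for x d
  proof -
    define d' where "d' = min d (min (x - a) (b - x))"
    have d': "0 < d'" "d' \<le> d" "d' \<le> x - a" "d' \<le> b - x"
      using d x by (auto simp: d'_def S_def)
    obtain h where h: "0 < \<bar>h\<bar>" "\<bar>h\<bar> < d'"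
      "dist (u (x + h)) (u x) \<le> (LBINT r:closed_segment x (x + h). g r) + \<eta> * \<bar>h\<bar>"
      using x d'(1) unfolding S_def by blast
    define i where "i = (x + h / 2, \<bar>h\<bar> / 2)"
    have Xi: "?X i = closed_segment x (x + h)"
      by (auto simp: i_def closed_segment_eq_real_ivl cball_eq_atLeastAtMost abs_if field_simps)
    have ends: "fst i - snd i = (if h > 0 then x else x + h)" "fst i + snd i = (if h > 0 then x + h else x)"
      by (auto simp: i_def)
    have "dist (u (fst i - snd i)) (u (fst i + snd i)) = dist (u (x + h)) (u x)"
      unfolding ends by (simp add: dist_commute)
    moreover have "?X i \<subseteq> {a..b}"
      unfolding cball_eq_atLeastAtMost ends using h(2) d' by auto
    ultimately have "i \<in> K" unfolding K_def using h(1,3) Xi by (simp add: i_def)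
    moreover have "snd i < d" using h d' by (simp add: i_def)
    ultimately show ?thesis using Xi by (intro exI[of _ i]) auto
  qed
  obtain C where C: "countable C" "C \<subseteq> K"
    "pairwise (\<lambda>i j. disjnt (?X i) (?X j)) C" "negligible (S - (\<Union>i\<in>C. ?X i))"
    by (rule Vitali_covering_theorem_cballs[OF Kpos fine])
  have Xint: "(LBINT r:?X i. g r + \<eta>) = (LBINT r:?X i. g r) + \<eta> * (2 * snd i)" if "0 < snd i" for i
    using that gset unfolding cball_eq_atLeastAtMost
    by (auto simp: set_integral_add set_integrable_const_Icc set_integral_const)
  have g\<eta>: "set_integrable lborel {p..q} (\<lambda>r. g r + \<eta>)" for p q
    using gset by (intro set_integral_add set_integrable_const_Icc) auto
  have step: "dist (u a) (u b) \<le> (LBINT r:{a..b}. g r) + \<eta> * (b - a)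
      + (LBINT r:{a..b} - (\<Union>i\<in>F. ?X i). m r)" if F: "finite F" "F \<subseteq> C" for F
  proof -
    have FK: "F \<subseteq> K" using F C by auto
    have XFab: "(\<Union>i\<in>F. ?X i) \<subseteq> {a..b}" using FK by (auto simp: K_def)
    have meas: "(\<Union>i\<in>F. ?X i) \<in> sets lborel" using F(1) by (intro sets.finite_UN) auto
    have "(\<Sum>i\<in>F. dist (u (fst i - snd i)) (u (fst i + snd i))) \<le> (\<Sum>i\<in>F. LBINT r:?X i. g r + \<eta>)"
    proof (rule sum_mono)
      fix i assume "i \<in> F"
      then have "i \<in> K" using FK by auto
      then show "dist (u (fst i - snd i)) (u (fst i + snd i)) \<le> (LBINT r:?X i. g r + \<eta>)"
        unfolding Xint[OF Kpos[OF \<open>i \<in> K\<close>]] by (simp add: K_def)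
    qed
    also have "\<dots> = (LBINT r:(\<Union>i\<in>F. ?X i). g r + \<eta>)"
    proof (rule set_integral_finite_Union[where A = ?X and I = F and M = lborel and f = "\<lambda>r. g r + \<eta>", symmetric])
      show "disjoint_family_on ?X F"
        using pairwiseD[OF pairwise_subset[OF C(3) F(2)]] by (simp add: disjoint_family_on_def disjnt_def)
      show "set_integrable lborel (?X i) (\<lambda>r. g r + \<eta>)" if "i \<in> F" for i
        unfolding cball_eq_atLeastAtMost by (rule g\<eta>)
      show "finite F" by (rule F(1))
      show "?X i \<in> sets lborel" if "i \<in> F" for i by simp
    qed
    also have "\<dots> \<le> (LBINT r:{a..b}. g r + \<eta>)"
      unfolding set_lebesgue_integral_def
    proof (rule integral_mono)
      show "integrable lborel (\<lambda>x. indicator (\<Union>i\<in>F. ?X i) x *\<^sub>R (g x + \<eta>))"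
        using set_integrable_subset[OF g\<eta>[of a b] meas XFab] by (simp add: set_integrable_def)
      show "integrable lborel (\<lambda>x. indicator {a..b} x *\<^sub>R (g x + \<eta>))"
        using g\<eta> by (simp add: set_integrable_def)
      show "indicator (\<Union>i\<in>F. ?X i) x *\<^sub>R (g x + \<eta>) \<le> indicator {a..b} x *\<^sub>R (g x + \<eta>)" for x
      proof -
        have "indicator A x *\<^sub>R c \<le> indicator B x *\<^sub>R c" if "A \<subseteq> B" "0 \<le> c" for A B :: "real set" and c :: real
          using that by (auto simp: indicator_def)
        then show ?thesis using XFab g0[of x] \<eta> by simp
      qed
    qed
    also have "\<dots> = (LBINT r:{a..b}. g r) + \<eta> * (b - a)"
      using gset \<open>a < b\<close> by (simp add: set_integral_add set_integrable_const_Icc set_integral_const mult.commute)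
    finally have "(\<Sum>i\<in>F. dist (u (fst i - snd i)) (u (fst i + snd i))) \<le> (LBINT r:{a..b}. g r) + \<eta> * (b - a)" .
    moreover have "dist (u a) (u b) \<le> (\<Sum>i\<in>F. dist (u (fst i - snd i)) (u (fst i + snd i)))
     + (LBINT r:{a..b} - (\<Union>i\<in>F. ?X i). m r)"
    proof (rule dist_le_finite_pieces[where u = u and m = m and F = F and a = a and b = b, OF m um F(1)])
      show "0 \<le> snd i \<and> ?X i \<subseteq> {a..b}" if "i \<in> F" for i using FK that by (auto simp: K_def)
      show "pairwise (\<lambda>i j. disjnt (?X i) (?X j)) F" using C(3) F(2) by (rule pairwise_subset)
    qed (use \<open>a < b\<close> in simp_all)
    ultimately show ?thesis by simp
  qed
  define F where "F n = {i \<in> C. to_nat_on C i \<le> n}" for n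
  have F: "finite (F n)" "F n \<subseteq> C" for n
  proof -
    have "inj_on (to_nat_on C) (F n)" using C(1) by (auto simp: F_def inj_on_def)
    moreover have "to_nat_on C ` F n \<subseteq> {..n}" by (auto simp: F_def)
    ultimately show "finite (F n)" using finite_imageD finite_subset by blast
  qed (auto simp: F_def)
  have [measurable]: "(\<Union>i\<in>C. ?X i) \<in> sets borel" using C(1) by (intro sets.countable_UN') auto
  have [measurable]: "(\<Union>i\<in>F n. ?X i) \<in> sets borel" for n using F(1) by (intro sets.finite_UN) auto
  have "(\<lambda>n. LBINT r:{a..b} - (\<Union>i\<in>F n. ?X i). m r) \<longlonglongrightarrow> (LBINT r:{a..b} - (\<Union>i\<in>C. ?X i). m r)"
    unfolding set_lebesgue_integral_def
  proof (rule integral_dominated_convergence[where w = m])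
    show "AE x in lborel. (\<lambda>n. indicator ({a..b} - (\<Union>i\<in>F n. ?X i)) x *\<^sub>R m x)
        \<longlonglongrightarrow> indicator ({a..b} - (\<Union>i\<in>C. ?X i)) x *\<^sub>R m x"
    proof (rule AE_I2)
      fix x
      have "eventually (\<lambda>n. indicator ({a..b} - (\<Union>i\<in>F n. ?X i)) x *\<^sub>R m x = indicator ({a..b} - (\<Union>i\<in>C. ?X i)) x *\<^sub>R m x) sequentially"
      proof (cases "x \<in> (\<Union>i\<in>C. ?X i)")
        case True
        then obtain i where i: "i \<in> C" "x \<in> ?X i" by auto
        show ?thesis using eventually_ge_at_top[of "to_nat_on C i"]
          by eventually_elim (use i in \<open>auto simp: F_def indicator_def\<close>)
      next
        case False
        then show ?thesis using F(2) by (intro always_eventually) (auto simp: indicator_def)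
      qed
      then show "(\<lambda>n. indicator ({a..b} - (\<Union>i\<in>F n. ?X i)) x *\<^sub>R m x)
        \<longlonglongrightarrow> indicator ({a..b} - (\<Union>i\<in>C. ?X i)) x *\<^sub>R m x" by (rule tendsto_eventually)
    qed
    show "AE x in lborel. norm (indicator ({a..b} - (\<Union>i\<in>F n. ?X i)) x *\<^sub>R m x) \<le> m x" for n
      using m(2) by (intro AE_I2) (simp add: indicator_def)
  qed (simp_all add: m(1))
  moreover have "(LBINT r:{a..b} - (\<Union>i\<in>C. ?X i). m r) = 0"
    unfolding set_lebesgue_integral_def
  proof (rule integral_eq_zero_AE)
    have "AE x in lebesgue. x \<notin> S - (\<Union>i\<in>C. ?X i)"
      by (rule AE_not_in) (use C(4) in \<open>simp add: negligible_iff_null_sets\<close>)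
    then have "AE x in lborel. x \<notin> S - (\<Union>i\<in>C. ?X i)" by (simp only: AE_completion_iff)
    with fine_pieces AE_lborel_singleton[of a] AE_lborel_singleton[of b]
    show "AE x in lborel. indicator ({a..b} - (\<Union>i\<in>C. ?X i)) x *\<^sub>R m x = 0"
    proof eventually_elim
      case (elim x)
      have "x \<in> S" if "x \<in> {a..b}" using that elim unfolding S_def by auto
      then show ?case using elim(4) by (auto simp: indicator_def)
    qed
  qed
  ultimately have "(\<lambda>n. (LBINT r:{a..b}. g r) + \<eta> * (b - a) + (LBINT r:{a..b} - (\<Union>i\<in>F n. ?X i). m r))
     \<longlonglongrightarrow> (LBINT r:{a..b}. g r) + \<eta> * (b - a) + 0"
    by (intro tendsto_add tendsto_const) simp
  then have "dist (u a) (u b) \<le> (LBINT r:{a..b}. g r) + \<eta> * (b - a) + 0"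
    by (rule LIMSEQ_le_const) (intro exI allI impI step F)
  then show ?thesis by simp
qed

text \<open>The lower speed \<open>g\<close> already controls the distance: at a Lebesgue point of \<open>g\<close> there are short
intervals across which \<open>u\<close> moves by at most the integral of \<open>g\<close> up to a small multiple of their
length, which is the hypothesis of the covering lemma. Differentiating the resulting bound by
Lebesgue's theorem gives upper limits of the difference quotients at most \<open>g\<close>, which is their lower
limit, so they converge.\<close>

theorem metric_derivative:
  fixes u :: "real \<Rightarrow> 'a::metric_space" and m :: "real \<Rightarrow> real"
  assumes m: "integrable lborel m" "\<And>x. 0 \<le> m x"
    and um: "\<And>s t. s \<le> t \<Longrightarrow> dist (u s) (u t) \<le> (LBINT r:{s..t}. m r)"
  obtains g where "g \<in> borel_measurable borel" "\<And>t. 0 \<le> g t" "AE t in lborel. g t \<le> m t"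
    "\<And>s t. s \<le> t \<Longrightarrow> dist (u s) (u t) \<le> (LBINT r:{s..t}. g r)"
    "AE t in lborel. ((\<lambda>s. dist (u s) (u t) / \<bar>t - s\<bar>) \<longlongrightarrow> g t) (at t)"
proof -
  have [measurable]: "m \<in> borel_measurable borel" using m(1) by auto
  have [measurable]: "lower_speed u \<in> borel_measurable borel"
    by (rule lower_speed_measurable[OF continuous_if_dist_le_integral[OF m(1) um]])
  define g where "g t = enn2real (lower_speed u t)" for t
  have [measurable]: "g \<in> borel_measurable borel" unfolding g_def by measurable
  have g0: "0 \<le> g t" for t by (simp add: g_def)
  have le_m: "AE t in lborel. lower_speed u t \<le> ennreal (m t)"
    by (rule lower_speed_le[OF m um])
  then have g_ls: "AE t in lborel. lower_speed u t = ennreal (g t)"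
    by eventually_elim (auto simp: g_def le_less_trans)
  have gm: "AE t in lborel. g t \<le> m t"
    using le_m by eventually_elim (auto simp: g_def m(2) intro: enn2real_leI)
  have gi: "integrable lborel g"
    by (rule Bochner_Integration.integrable_bound[OF m(1)]) (use gm in \<open>auto simp: g0 m(2)\<close>)
  have fine_pieces: "AE t in lborel. \<forall>d>0. \<exists>h. 0 < \<bar>h\<bar> \<and> \<bar>h\<bar> < d \<and>
        dist (u (t + h)) (u t) \<le> (LBINT r:closed_segment t (t + h). g r) + \<eta> * \<bar>h\<bar>" if \<eta>: "0 < \<eta>" for \<eta>
    using Lebesgue_differentiation[OF gi] g_ls
  proof (eventually_elim, intro allI impI)
    fix x d assume ldt: "\<forall>e>0. \<exists>d>0. \<forall>s. \<bar>s - x\<bar> < d \<longrightarrow> \<bar>(LBINT r:closed_segment x s. g r) - g x * \<bar>s - x\<bar>\<bar> \<le> e * \<bar>s - x\<bar>"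
      and ls: "lower_speed u x = ennreal (g x)" and "0 < (d::real)"
    have \<eta>2: "0 < \<eta> / 2" using \<eta> by simp
    obtain d1 where d1: "d1 > 0" "\<And>s. \<bar>s - x\<bar> < d1 \<Longrightarrow> \<bar>(LBINT r:closed_segment x s. g r) - g x * \<bar>s - x\<bar>\<bar> \<le> \<eta> / 2 * \<bar>s - x\<bar>"
      using ldt[rule_format, OF \<eta>2] by blast
    have "lower_speed u x < ennreal (g x + \<eta> / 2)" "0 < min d d1"
      using ls \<eta> g0[of x] d1(1) \<open>0 < d\<close> by (auto simp: ennreal_less_iff)
    from lower_speed_witness[OF this] obtain h where
      h: "0 < \<bar>h\<bar>" "\<bar>h\<bar> < d" "\<bar>h\<bar> < d1" "dist (u (x + h)) (u x) / \<bar>h\<bar> < g x + \<eta> / 2"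
      by auto
    have "dist (u (x + h)) (u x) \<le> (g x + \<eta> / 2) * \<bar>h\<bar>" using h(1,4) by (simp add: divide_less_eq)
    then have dh: "dist (u (x + h)) (u x) \<le> g x * \<bar>h\<bar> + \<eta> / 2 * \<bar>h\<bar>" by (simp only: distrib_right)
    have xh: "x + h - x = h" by simp
    have "\<bar>(LBINT r:closed_segment x (x + h). g r) - g x * \<bar>h\<bar>\<bar> \<le> \<eta> / 2 * \<bar>h\<bar>"
      using d1(2)[of "x + h", unfolded xh, OF h(3)] .
    then have "dist (u (x + h)) (u x) \<le> (LBINT r:closed_segment x (x + h). g r) + \<eta> * \<bar>h\<bar>"
      using dh by linarith
    then show "\<exists>h. 0 < \<bar>h\<bar> \<and> \<bar>h\<bar> < d \<and> dist (u (x + h)) (u x) \<le> (LBINT r:closed_segment x (x + h). g r) + \<eta> * \<bar>h\<bar>"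
      using h by blast
  qed
  have main: "dist (u a) (u b) \<le> (LBINT r:{a..b}. g r)" if "a < b" for a b
  proof (rule field_le_epsilon)
    fix e :: real assume "0 < e"
    then have \<eta>: "0 < e / (b - a)" using that by simp
    have "dist (u a) (u b) \<le> (LBINT r:{a..b}. g r) + e / (b - a) * (b - a)"
      by (rule dist_le_integral_if_fine_pieces[where u = u and m = m and g = g and a = a and b = b
            and \<eta> = "e / (b - a)", OF m um gi g0 that \<eta> fine_pieces[OF \<eta>]])
    then show "dist (u a) (u b) \<le> (LBINT r:{a..b}. g r) + e" using that by simp
  qed
  have ug: "dist (u s) (u t) \<le> (LBINT r:{s..t}. g r)" if "s \<le> t" for s t
    using main[of s t] that by (cases "s = t") (auto simp: set_lebesgue_integral_def g0 intro!: integral_nonneg)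
  have segg: "dist (u s) (u t) \<le> (LBINT r:closed_segment t s. g r)" for s t
    using ug[of s t] ug[of t s] by (auto simp: closed_segment_eq_real_ivl dist_commute)
  have "AE t in lborel. ((\<lambda>s. dist (u s) (u t) / \<bar>t - s\<bar>) \<longlongrightarrow> g t) (at t)"
    using Lebesgue_differentiation[OF gi] g_ls
  proof eventually_elim
    case (elim t)
    show ?case
    proof (rule order_tendstoI)
      fix c assume c: "g t < c"
      define e where "e = (c - g t) / 2"
      have "0 < e" using c by (simp add: e_def)
      then obtain d where d: "d > 0" "\<And>s. \<bar>s - t\<bar> < d \<Longrightarrow> \<bar>(LBINT r:closed_segment t s. g r) - g t * \<bar>s - t\<bar>\<bar> \<le> e * \<bar>s - t\<bar>"
        using elim(1) by blast
      show "eventually (\<lambda>s. dist (u s) (u t) / \<bar>t - s\<bar> < c) (at t)"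
        unfolding eventually_at
      proof (intro exI[of _ d] conjI ballI impI)
        fix s assume s: "s \<noteq> t \<and> dist s t < d"
        then have "dist (u s) (u t) \<le> (g t + e) * \<bar>s - t\<bar>"
          using segg[of s t] d(2)[of s] by (auto simp: dist_real_def abs_le_iff algebra_simps)
        also have "\<dots> < c * \<bar>s - t\<bar>" using s c by (intro mult_strict_right_mono) (auto simp: e_def field_simps)
        finally show "dist (u s) (u t) / \<bar>t - s\<bar> < c" using s by (simp add: divide_less_eq abs_minus_commute)
      qed (fact d)
    next
      fix c assume c: "c < g t"
      show "eventually (\<lambda>s. c < dist (u s) (u t) / \<bar>t - s\<bar>) (at t)"
      proof (cases "c < 0")
        case True
        then show ?thesis by (intro always_eventually allI less_le_trans[OF True]) auto
      next
        case False
        then have "ennreal c < lower_speed u t" using c elim(2) by (auto simp: ennreal_less_iff)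
        then obtain n where n: "ennreal c < (INF h\<in>{h. 0 < \<bar>h\<bar> \<and> \<bar>h\<bar> < 1 / real (Suc n)}. ennreal (dist (u (t + h)) (u t) / \<bar>h\<bar>))"
          unfolding lower_speed_def less_SUP_iff by auto
        show ?thesis unfolding eventually_at
        proof (intro exI[of _ "1 / real (Suc n)"] conjI ballI impI)
          fix s assume "s \<noteq> t \<and> dist s t < 1 / real (Suc n)"
          then have "ennreal c < ennreal (dist (u (t + (s - t))) (u t) / \<bar>s - t\<bar>)"
            by (intro less_le_trans[OF n] INF_lower) (auto simp: dist_real_def)
          then show "c < dist (u s) (u t) / \<bar>t - s\<bar>" using False by (simp add: ennreal_less_iff abs_minus_commute)
        qed simp
      qed
    qed
  qed
  then show ?thesis using that[of g] g0 gm ug by simp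
qed

section \<open>Locally square integrable speeds\<close>

text \<open>A global, nonnegative Borel version of the function \<open>m\<close> in the definition of the curves that are
locally \<open>AC\<^sup>2\<close>. Agreement of \<open>g\<close> with the metric derivative is stated separately.\<close>

definition metric_speed :: "(real \<Rightarrow> 'a::metric_space) \<Rightarrow> (real \<Rightarrow> real) \<Rightarrow> bool" where
  "metric_speed u g \<longleftrightarrow> g \<in> borel_measurable borel \<and> (\<forall>t. 0 \<le> g t) \<and>
     (\<forall>b. set_integrable lborel {0..b} (\<lambda>t. (g t)\<^sup>2)) \<and>
     (\<forall>s t. 0 \<le> s \<longrightarrow> s \<le> t \<longrightarrow> dist (u s) (u t) \<le> (LBINT r:{s..t}. g r))"

lemma metric_speedD:
  assumes "metric_speed u g"
  shows metric_speed_measurable: "g \<in> borel_measurable borel"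
    and metric_speed_nonneg: "0 \<le> g t"
    and metric_speed_square_integrable: "set_integrable lborel {0..b} (\<lambda>t. (g t)\<^sup>2)"
    and metric_speed_dist_le: "0 \<le> s \<Longrightarrow> s \<le> t \<Longrightarrow> dist (u s) (u t) \<le> (LBINT r:{s..t}. g r)"
  using assms unfolding metric_speed_def by (blast+)

lemma set_integrable_if_square:
  fixes m :: "real \<Rightarrow> real"
  assumes "set_borel_measurable lborel {a..b} m" "set_integrable lborel {a..b} (\<lambda>t. (m t)\<^sup>2)"
  shows "set_integrable lborel {a..b} m"
proof -
  have "integrable lborel (\<lambda>x. indicator {a..b} x *\<^sub>R (1::real) + indicator {a..b} x *\<^sub>R (m x)\<^sup>2)"
    using assms(2) set_integrable_const_Icc[of a b 1] by (intro Bochner_Integration.integrable_add) (auto simp: set_integrable_def)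
  then show ?thesis
    unfolding set_integrable_def
  proof (rule Bochner_Integration.integrable_bound)
    show "(\<lambda>x. indicator {a..b} x *\<^sub>R m x) \<in> borel_measurable lborel"
      using assms(1) by (simp add: set_borel_measurable_def)
    have "\<bar>y\<bar> \<le> 1 + y\<^sup>2" for y :: real
      using zero_le_power2[of "\<bar>y\<bar> - 1"] by (simp add: power2_eq_square algebra_simps) 
    then show "AE x in lborel. norm (indicator {a..b} x *\<^sub>R m x) \<le> norm (indicator {a..b} x *\<^sub>R (1::real) + indicator {a..b} x *\<^sub>R (m x)\<^sup>2)"
      by (intro AE_I2) (auto simp: indicator_def)
  qed
qed

lemma metric_speed_integrable:
  assumes "metric_speed u g" "0 \<le> a"
  shows "set_integrable lborel {a..b} g"
proof (rule set_integrable_subset)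
  show "set_integrable lborel {0..b} g"
  proof (rule set_integrable_if_square)
    have [measurable]: "g \<in> borel_measurable borel" by (rule metric_speedD[OF assms(1)])
    show "set_borel_measurable lborel {0..b} g" by (simp add: set_borel_measurable_def)
  qed (rule metric_speedD[OF assms(1)])
qed (use assms in auto)

lemma metric_speed_imp_AC2_loc:
  assumes "metric_speed u g"
  shows "AC2_loc {0..} u"
  unfolding AC2_loc_def AC2_def
proof (intro allI impI)
  fix a b :: real assume ab: "{a..b} \<subseteq> {0..}"
  have [measurable]: "g \<in> borel_measurable borel" by (rule metric_speedD[OF assms])
  have "set_integrable lborel {0..b} (\<lambda>r. (g r)\<^sup>2)" by (rule metric_speedD[OF assms])
  then have "set_integrable lborel {a..b} (\<lambda>r. (g r)\<^sup>2)"
    by (rule set_integrable_subset) (use ab in auto)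
  moreover have "set_borel_measurable lborel {a..b} g" by (simp add: set_borel_measurable_def)
  moreover have "\<forall>s\<in>{a..b}. \<forall>t\<in>{a..b}. s \<le> t \<longrightarrow> dist (u s) (u t) \<le> (LBINT r:{s..t}. g r)"
    using ab by (intro ballI impI metric_speed_dist_le[OF assms]) (auto simp: subset_iff)
  ultimately show "\<exists>m. set_borel_measurable lborel {a..b} m \<and> set_integrable lborel {a..b} (\<lambda>r. (m r)\<^sup>2) \<and>
      (\<forall>s\<in>{a..b}. \<forall>t\<in>{a..b}. s \<le> t \<longrightarrow> dist (u s) (u t) \<le> (LBINT r:{s..t}. m r))" by blast
qed

lemma metric_deriv_eqI:
  assumes "0 < t" "((\<lambda>s. dist (u s) (u t) / \<bar>t - s\<bar>) \<longlongrightarrow> c) (at t)"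
  shows "metric_deriv u t = c"
proof -
  have "at t within {0..} = at t" using assms(1) by (intro at_within_interior) auto
  then show ?thesis unfolding metric_deriv_def using assms(2) by (intro tendsto_Lim) auto
qed

text \<open>Freezing a curve outside \<open>[0, b]\<close> extends it to the whole line with an integrable bound, so that the
results on curves defined on the line apply.\<close>

lemma dist_clamp_le_integral:
  fixes u :: "real \<Rightarrow> 'a::metric_space" and m :: "real \<Rightarrow> real"
  assumes mi: "set_integrable lborel {0..b} m" and b: "0 \<le> b"
    and um: "\<And>s t. 0 \<le> s \<Longrightarrow> s \<le> t \<Longrightarrow> t \<le> b \<Longrightarrow> dist (u s) (u t) \<le> (LBINT r:{s..t}. m r)"
  defines "M \<equiv> \<lambda>r. indicator {0..b} r * \<bar>m r\<bar>"
  shows "integrable lborel M"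
    and "s \<le> t \<Longrightarrow> dist (u (max 0 (min b s))) (u (max 0 (min b t))) \<le> (LBINT r:{s..t}. M r)"
proof -
  have "set_integrable lborel {0..b} (\<lambda>r. \<bar>m r\<bar>)" using mi by (rule set_integrable_abs)
  then show Mi: "integrable lborel M" unfolding M_def set_integrable_def by simp
  have M_nonneg: "0 \<le> (LBINT r:{s..t}. M r)"
    unfolding set_lebesgue_integral_def M_def by (intro Bochner_Integration.integral_nonneg) auto
  assume le: "s \<le> t"
  show "dist (u (max 0 (min b s))) (u (max 0 (min b t))) \<le> (LBINT r:{s..t}. M r)"
  proof (cases "t \<le> 0 \<or> b \<le> s")
    case True
    then have "max 0 (min b s) = max 0 (min b t)" using le b by auto
    then show ?thesis using M_nonneg by simp
  next
    case False
    define s' t' where "s' = max 0 s" and "t' = min b t"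
    have st: "0 \<le> s'" "s' \<le> t'" "t' \<le> b" "s \<le> s'" "t' \<le> t"
      using False le b by (auto simp: s'_def t'_def)
    have eq: "max 0 (min b s) = s'" "max 0 (min b t) = t'"
      using False b by (auto simp: s'_def t'_def)
    have "dist (u s') (u t') \<le> (LBINT r:{s'..t'}. m r)" by (rule um[OF st(1-3)])
    also have "\<dots> \<le> (LBINT r:{s..t}. M r)"
      unfolding set_lebesgue_integral_def
    proof (rule integral_mono)
      show "integrable lborel (\<lambda>x. indicator {s'..t'} x *\<^sub>R m x)"
        using set_integrable_subset[OF mi, of "{s'..t'}"] st by (auto simp: set_integrable_def)
      show "integrable lborel (\<lambda>x. indicator {s..t} x *\<^sub>R M x)"
        using Mi by (intro integrable_mult_indicator) auto
      show "indicator {s'..t'} x *\<^sub>R m x \<le> indicator {s..t} x *\<^sub>R M x" for x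
        using st by (auto simp: M_def indicator_def)
    qed
    finally show ?thesis unfolding eq .
  qed
qed

lemma AC2_speed:
  fixes u :: "real \<Rightarrow> 'a::metric_space"
  assumes "AC2 {0..b} u" "0 \<le> b"
  shows "\<exists>g. g \<in> borel_measurable borel \<and> (\<forall>t. 0 \<le> g t) \<and> set_integrable lborel {0..b} (\<lambda>t. (g t)\<^sup>2) \<and>
     (\<forall>s t. 0 \<le> s \<longrightarrow> s \<le> t \<longrightarrow> t \<le> b \<longrightarrow> dist (u s) (u t) \<le> (LBINT r:{s..t}. g r)) \<and>
     (AE t in lborel. 0 < t \<and> t < b \<longrightarrow> metric_deriv u t = g t)"
proof -
  obtain m where m: "set_borel_measurable lborel {0..b} m" "set_integrable lborel {0..b} (\<lambda>r. (m r)\<^sup>2)"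
    and um: "\<And>s t. s \<in> {0..b} \<Longrightarrow> t \<in> {0..b} \<Longrightarrow> s \<le> t \<Longrightarrow> dist (u s) (u t) \<le> (LBINT r:{s..t}. m r)"
    using assms(1) unfolding AC2_def by blast
  define M where "M = (\<lambda>r. indicator {0..b} r * \<bar>m r\<bar>)"
  define v where "v t = u (max 0 (min b t))" for t
  have mi: "set_integrable lborel {0..b} m" by (rule set_integrable_if_square[OF m])
  have um': "dist (u s) (u t) \<le> (LBINT r:{s..t}. m r)" if "0 \<le> s" "s \<le> t" "t \<le> b" for s t
    using um[of s t] that by simp
  have Mi: "integrable lborel M" unfolding M_def by (rule dist_clamp_le_integral(1)[OF mi assms(2) um'])
  have M0: "0 \<le> M r" for r by (simp add: M_def)
  have vM: "dist (v s) (v t) \<le> (LBINT r:{s..t}. M r)" if "s \<le> t" for s t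
    unfolding v_def M_def by (rule dist_clamp_le_integral(2)[OF mi assms(2) um' that])
  obtain g where g: "g \<in> borel_measurable borel" "\<And>t. 0 \<le> g t" "AE t in lborel. g t \<le> M t"
    and vg: "\<And>s t. s \<le> t \<Longrightarrow> dist (v s) (v t) \<le> (LBINT r:{s..t}. g r)"
    and lim: "AE t in lborel. ((\<lambda>s. dist (v s) (v t) / \<bar>t - s\<bar>) \<longlongrightarrow> g t) (at t)"
    using metric_derivative[where u = v and m = M, OF Mi M0 vM] by blast
  have [measurable]: "g \<in> borel_measurable borel" by (rule g)
  have "set_integrable lborel {0..b} (\<lambda>t. (g t)\<^sup>2)"
    unfolding set_integrable_def
  proof (rule Bochner_Integration.integrable_bound)
    show "integrable lborel (\<lambda>r. indicator {0..b} r *\<^sub>R (m r)\<^sup>2)" using m(2) by (simp add: set_integrable_def)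
    show "AE t in lborel. norm (indicator {0..b} t *\<^sub>R (g t)\<^sup>2) \<le> norm (indicator {0..b} t *\<^sub>R (m t)\<^sup>2)"
      using g(3)
    proof eventually_elim
      case (elim t)
      then show ?case using power_mono[OF elim g(2), of 2] by (auto simp: M_def indicator_def)
    qed
  qed simp
  moreover have "dist (u s) (u t) \<le> (LBINT r:{s..t}. g r)" if "0 \<le> s" "s \<le> t" "t \<le> b" for s t
    using vg[OF that(2)] that by (simp add: v_def)
  moreover have "AE t in lborel. 0 < t \<and> t < b \<longrightarrow> metric_deriv u t = g t"
    using lim
  proof (eventually_elim, intro impI)
    fix t assume t: "0 < t \<and> t < b" and l: "((\<lambda>s. dist (v s) (v t) / \<bar>t - s\<bar>) \<longlongrightarrow> g t) (at t)"
    have "eventually (\<lambda>s. s \<in> {0<..<b}) (at t)" using t by (intro eventually_at_in_open') auto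
    then have "eventually (\<lambda>s. dist (v s) (v t) / \<bar>t - s\<bar> = dist (u s) (u t) / \<bar>t - s\<bar>) (at t)"
      by (rule eventually_mono) (use t in \<open>auto simp: v_def\<close>)
    from Lim_transform_eventually[OF l this] show "metric_deriv u t = g t"
      using t by (intro metric_deriv_eqI) auto
  qed
  ultimately show ?thesis using g by blast
qed

text \<open>The compact intervals \<open>[0, n]\<close> yield functions that agree almost everywhere where both are defined,
since each of them is the metric derivative there. They are glued by using the one of index
\<open>\<lceil>t\<rceil> + 1\<close> at time \<open>t\<close>.\<close>

theorem AC2_loc_imp_metric_speed:
  fixes u :: "real \<Rightarrow> 'a::metric_space"
  assumes "AC2_loc {0..} u"
  obtains g where "metric_speed u g" "AE t in lborel. 0 < t \<longrightarrow> metric_deriv u t = g t"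
proof -
  have "\<forall>n. \<exists>g. g \<in> borel_measurable borel \<and> (\<forall>t. 0 \<le> g t) \<and> set_integrable lborel {0..real n} (\<lambda>t. (g t)\<^sup>2) \<and>
     (\<forall>s t. 0 \<le> s \<longrightarrow> s \<le> t \<longrightarrow> t \<le> real n \<longrightarrow> dist (u s) (u t) \<le> (LBINT r:{s..t}. g r)) \<and>
     (AE t in lborel. 0 < t \<and> t < real n \<longrightarrow> metric_deriv u t = g t)"
  proof (intro allI AC2_speed)
    fix n :: nat
    have "{0..real n} \<subseteq> {0..}" by auto
    then show "AC2 {0..real n} u" using assms by (simp add: AC2_loc_def)
  qed simp
  from choice[OF this] obtain G where G': "\<forall>n. G n \<in> borel_measurable borel \<and> (\<forall>t. 0 \<le> G n t) \<and> set_integrable lborel {0..real n} (\<lambda>t. (G n t)\<^sup>2) \<and>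
     (\<forall>s t. 0 \<le> s \<longrightarrow> s \<le> t \<longrightarrow> t \<le> real n \<longrightarrow> dist (u s) (u t) \<le> (LBINT r:{s..t}. G n r)) \<and>
     (AE t in lborel. 0 < t \<and> t < real n \<longrightarrow> metric_deriv u t = G n t)" ..
  have G1: "G n \<in> borel_measurable borel" for n using spec[OF G', of n] by (elim conjE)
  have G2: "0 \<le> G n t" for n t using spec[OF G', of n] by (elim conjE) (rule spec)
  have G3: "set_integrable lborel {0..real n} (\<lambda>t. (G n t)\<^sup>2)" for n using spec[OF G', of n] by (elim conjE)
  have G4: "dist (u s) (u t) \<le> (LBINT r:{s..t}. G n r)" if "0 \<le> s" "s \<le> t" "t \<le> real n" for n s t
    using spec[OF G', of n] that by (elim conjE) blast
  have G5: "AE t in lborel. 0 < t \<and> t < real n \<longrightarrow> metric_deriv u t = G n t" for n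
    using spec[OF G', of n] by (elim conjE)
  define N where "N t = nat \<lceil>t\<rceil> + 1" for t :: real
  have N: "t < real (N t)" for t unfolding N_def by linarith
  define g where "g t = G (N t) t" for t
  have [measurable]: "G n \<in> borel_measurable borel" for n by (rule G1)
  have gm[measurable]: "g \<in> borel_measurable borel"
    unfolding g_def N_def by (rule measurable_compose_countable) measurable
  have der: "AE t in lborel. 0 < t \<longrightarrow> metric_deriv u t = g t"
  proof -
    have "AE t in lborel. \<forall>n. 0 < t \<and> t < real n \<longrightarrow> metric_deriv u t = G n t"
      unfolding AE_all_countable by (intro allI G5)
    then show ?thesis
      by eventually_elim (auto simp: g_def N)
  qed
  have eq: "AE t\<in>{0..real n} in lborel. g t = G n t" for n
    using der G5[of n] AE_lborel_singleton[of 0] AE_lborel_singleton[of "real n"]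
    by eventually_elim auto
  have "metric_speed u g"
    unfolding metric_speed_def
  proof (intro conjI allI impI)
    show "0 \<le> g t" for t by (simp add: g_def G2)
    show "set_integrable lborel {0..b} (\<lambda>t. (g t)\<^sup>2)" for b
    proof -
      obtain n where n: "b \<le> real n" using real_arch_simple by blast
      have "set_integrable lborel {0..real n} (\<lambda>t. (g t)\<^sup>2)"
      proof (rule iffD2[OF set_integrable_cong_AE G3[of n]])
        show "AE t\<in>{0..real n} in lborel. (g t)\<^sup>2 = (G n t)\<^sup>2" using eq[of n] by eventually_elim auto
      qed auto
      then show ?thesis by (rule set_integrable_subset) (use n in auto)
    qed
    show "dist (u s) (u t) \<le> (LBINT r:{s..t}. g r)" if "0 \<le> s" "s \<le> t" for s t
    proof -
      obtain n where n: "t \<le> real n" using real_arch_simple by blast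
      have "(LBINT r:{s..t}. g r) = (LBINT r:{s..t}. G n r)"
      proof (rule set_lebesgue_integral_cong_AE)
        show "AE x\<in>{s..t} in lborel. g x = G n x"
          using eq[of n] by eventually_elim (use n that in auto)
      qed auto
      then show ?thesis using G4[OF that n] by simp
    qed
  qed (rule gm)
  then show ?thesis using der that by blast
qed

lemma metric_speed_continuous:
  fixes u :: "real \<Rightarrow> 'a::metric_space"
  assumes "metric_speed u g"
  shows "continuous_on UNIV (\<lambda>t. u (max 0 t))"
proof (rule continuous_at_imp_continuous_on, rule ballI)
  fix t0 :: real
  define b where "b = \<bar>t0\<bar> + 1"
  have gi: "set_integrable lborel {0..b} g" by (rule metric_speed_integrable[OF assms]) simp
  have b: "0 \<le> b" by (simp add: b_def)
  have ug: "dist (u s) (u t) \<le> (LBINT r:{s..t}. g r)" if "0 \<le> s" "s \<le> t" "t \<le> b" for s t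
    by (rule metric_speed_dist_le[OF assms that(1,2)])
  have clamp: "dist (u (max 0 (min b s))) (u (max 0 (min b t))) \<le> (LBINT r:{s..t}. indicator {0..b} r * \<bar>g r\<bar>)"
    if "s \<le> t" for s t by (rule dist_clamp_le_integral(2)[OF gi b ug that])
  have Mi: "integrable lborel (\<lambda>r. indicator {0..b} r * \<bar>g r\<bar>)" by (rule dist_clamp_le_integral(1)[OF gi b ug])
  have "continuous_on UNIV (\<lambda>t. u (max 0 (min b t)))"
    using Mi clamp by (rule continuous_if_dist_le_integral)
  then have cont: "isCont (\<lambda>t. u (max 0 (min b t))) t0"
    by (simp add: continuous_on_eq_continuous_at)
  have "eventually (\<lambda>t. u (max 0 (min b t)) = u (max 0 t)) (nhds t0)"
  proof -
    have "eventually (\<lambda>t. t \<in> {..<b}) (nhds t0)" by (rule eventually_nhds_in_open) (auto simp: b_def)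
    then show ?thesis by eventually_elim auto
  qed
  from iffD1[OF isCont_cong[OF this] cont] show "isCont (\<lambda>t. u (max 0 t)) t0" .
qed

section \<open>The exponential weight\<close>

definition wed_density :: "real \<Rightarrow> real \<Rightarrow> real" where
  "wed_density \<epsilon> t = indicator {0<..} t * (1 / \<epsilon> * exp (- t / \<epsilon>))"

lemma wed_density_measurable[measurable]: "wed_density \<epsilon> \<in> borel_measurable borel"
  unfolding wed_density_def by measurable

lemma wed_density_nonneg: "0 < \<epsilon> \<Longrightarrow> 0 \<le> wed_density \<epsilon> t"
  by (simp add: wed_density_def)

lemma wed_measure_eq: "wed_measure \<epsilon> = density lborel (\<lambda>t. ennreal (wed_density \<epsilon> t))"
  by (simp add: wed_measure_def wed_density_def)

lemma sets_wed_measure[simp, measurable_cong]: "sets (wed_measure \<epsilon>) = sets borel"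
  by (simp add: wed_measure_def)

lemma space_wed_measure[simp]: "space (wed_measure \<epsilon>) = UNIV"
  by (simp add: wed_measure_def)

lemma borel_measurable_wed_measure:
  "f \<in> borel_measurable (wed_measure \<epsilon>) \<longleftrightarrow> f \<in> borel_measurable borel"
  by (intro arg_cong2[where f = "(\<in>)"] measurable_cong_sets) auto

lemma AE_wed_measure:
  assumes "0 < \<epsilon>"
  shows "(AE t in wed_measure \<epsilon>. P t) \<longleftrightarrow> (AE t in lborel. 0 < t \<longrightarrow> P t)"
proof -
  have "(AE t in wed_measure \<epsilon>. P t) \<longleftrightarrow> (AE t in lborel. 0 < ennreal (wed_density \<epsilon> t) \<longrightarrow> P t)"
    unfolding wed_measure_eq by (subst AE_density) auto
  moreover have "0 < ennreal (wed_density \<epsilon> t) \<longleftrightarrow> 0 < t" for t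
    using assms by (simp add: wed_density_def indicator_def)
  ultimately show ?thesis by simp
qed

lemma nn_integral_exp_tail:
  assumes "0 < c"
  shows "(\<integral>\<^sup>+x. ennreal (exp (- x / c)) * indicator {a..} x \<partial>lborel) = ennreal (c * exp (- a / c))"
proof -
  have "((\<lambda>x. - c * exp (- x / c)) \<longlongrightarrow> - c * 0) at_top"
  proof (intro tendsto_mult tendsto_const filterlim_compose[OF exp_at_bot])
    show "LIM x at_top. - x / c :> at_bot"
    proof -
      have "LIM x at_top. inverse c * x :> at_top"
        using assms by (intro filterlim_tendsto_pos_mult_at_top[OF tendsto_const _ filterlim_ident]) simp
      then show ?thesis by (simp add: filterlim_uminus_at_bot divide_inverse mult.commute)
    qed
  qed
  then have "(\<integral>\<^sup>+x. ennreal (exp (- x / c)) * indicator {a..} x \<partial>lborel) = ennreal (0 - (- c * exp (- a / c)))"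
    using assms by (intro nn_integral_FTC_atLeast[where F = "\<lambda>x. - c * exp (- x / c)"]) (auto intro!: derivative_eq_intros)
  then show ?thesis by simp
qed

lemma prob_space_wed_measure:
  assumes "0 < \<epsilon>"
  shows "prob_space (wed_measure \<epsilon>)"
proof
  have "emeasure (wed_measure \<epsilon>) (space (wed_measure \<epsilon>)) = (\<integral>\<^sup>+t. ennreal (wed_density \<epsilon> t) \<partial>lborel)"
    unfolding wed_measure_eq by (subst emeasure_density) auto
  also have "\<dots> = (\<integral>\<^sup>+t. ennreal (1 / \<epsilon>) * (ennreal (exp (- t / \<epsilon>)) * indicator {0..} t) \<partial>lborel)"
  proof (rule nn_integral_cong_AE)
    show "AE t in lborel. ennreal (wed_density \<epsilon> t) = ennreal (1 / \<epsilon>) * (ennreal (exp (- t / \<epsilon>)) * indicator {0..} t)"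
      using AE_lborel_singleton[of 0]
      by eventually_elim (use assms in \<open>auto simp: wed_density_def indicator_def ennreal_mult'[symmetric]\<close>)
  qed
  also have "\<dots> = ennreal (1 / \<epsilon>) * ennreal (\<epsilon> * exp (- 0 / \<epsilon>))"
    by (subst nn_integral_cmult, simp, subst nn_integral_exp_tail) (use assms in auto)
  also have "\<dots> = 1" using assms by (simp add: ennreal_mult'[symmetric])
  finally show "emeasure (wed_measure \<epsilon>) (space (wed_measure \<epsilon>)) = 1" .
qed

lemma integrable_wed_measure:
  fixes f :: "real \<Rightarrow> real"
  assumes "0 < \<epsilon>" "f \<in> borel_measurable borel"
  shows "integrable (wed_measure \<epsilon>) f \<longleftrightarrow> integrable lborel (\<lambda>t. wed_density \<epsilon> t * f t)"
  unfolding wed_measure_eq using assms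
  by (subst integrable_density) (auto simp: wed_density_nonneg)

lemma integral_wed_measure:
  fixes f :: "real \<Rightarrow> real"
  assumes "0 < \<epsilon>" "f \<in> borel_measurable borel"
  shows "(\<integral>t. f t \<partial>wed_measure \<epsilon>) = (LINT t|lborel. wed_density \<epsilon> t * f t)"
  unfolding wed_measure_eq using assms
  by (subst integral_density) (auto simp: wed_density_nonneg)

text \<open>The memoryless property of the exponential distribution: the part of the integral after time \<open>s\<close> is
the integral of the shifted function, damped by \<open>exp (- s / \<epsilon>)\<close>.\<close>

lemma wed_measure_split:
  fixes f :: "real \<Rightarrow> real"
  assumes \<epsilon>: "0 < \<epsilon>" and f[measurable]: "f \<in> borel_measurable borel" and s: "0 \<le> s"
  shows "integrable (wed_measure \<epsilon>) f \<longleftrightarrow>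
      set_integrable lborel {0..s} (\<lambda>t. 1 / \<epsilon> * exp (- t / \<epsilon>) * f t) \<and> integrable (wed_measure \<epsilon>) (\<lambda>t. f (s + t))"
    and "integrable (wed_measure \<epsilon>) f \<Longrightarrow> (\<integral>t. f t \<partial>wed_measure \<epsilon>) =
      (LBINT t:{0..s}. 1 / \<epsilon> * exp (- t / \<epsilon>) * f t) + exp (- s / \<epsilon>) * (\<integral>t. f (s + t) \<partial>wed_measure \<epsilon>)"
proof -
  define k where "k t = 1 / \<epsilon> * exp (- t / \<epsilon>)" for t
  have [measurable]: "k \<in> borel_measurable borel" unfolding k_def by measurable
  define F1 where "F1 t = indicator {0..s} t *\<^sub>R (k t * f t)" for t
  define F2 where "F2 t = indicator {s<..} t * (k t * f t)" for t
  have [measurable]: "F1 \<in> borel_measurable borel" "F2 \<in> borel_measurable borel"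
    unfolding F1_def F2_def by measurable
  have sum: "AE t in lborel. wed_density \<epsilon> t * f t = F1 t + F2 t"
    using AE_lborel_singleton[of 0]
    by eventually_elim (use s in \<open>auto simp: F1_def F2_def wed_density_def indicator_def k_def\<close>)
  have disj: "F1 t = 0 \<or> F2 t = 0" for t by (auto simp: F1_def F2_def indicator_def)
  have shift: "F2 (s + 1 * t) = exp (- s / \<epsilon>) * (wed_density \<epsilon> t * f (s + t))" for t
    by (auto simp: F2_def wed_density_def indicator_def k_def exp_add[symmetric] add_divide_distrib diff_divide_distrib)
  have int2: "integrable lborel F2 \<longleftrightarrow> integrable (wed_measure \<epsilon>) (\<lambda>t. f (s + t))"
  proof -
    have "integrable lborel F2 \<longleftrightarrow> integrable lborel (\<lambda>t. F2 (s + 1 * t))"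
      by (rule lborel_integrable_real_affine_iff[symmetric]) simp
    also have "\<dots> \<longleftrightarrow> integrable lborel (\<lambda>t. wed_density \<epsilon> t * f (s + t))"
      unfolding shift by (subst integrable_mult_left_iff) auto
    finally show ?thesis using \<epsilon> by (simp add: integrable_wed_measure)
  qed
  have int: "integrable (wed_measure \<epsilon>) f \<longleftrightarrow> integrable lborel F1 \<and> integrable lborel F2"
  proof -
    have "integrable (wed_measure \<epsilon>) f \<longleftrightarrow> integrable lborel (\<lambda>t. F1 t + F2 t)"
      unfolding integrable_wed_measure[OF \<epsilon> f] by (rule integrable_cong_AE) (use sum in auto)
    also have "\<dots> \<longleftrightarrow> integrable lborel F1 \<and> integrable lborel F2"
    proof
      assume *: "integrable lborel (\<lambda>t. F1 t + F2 t)"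
      have "norm (F1 t) \<le> norm (F1 t + F2 t)" "norm (F2 t) \<le> norm (F1 t + F2 t)" for t
        using disj[of t] by auto
      then show "integrable lborel F1 \<and> integrable lborel F2"
        using Bochner_Integration.integrable_bound[OF *, of F1] Bochner_Integration.integrable_bound[OF *, of F2] by simp
    qed simp
    finally show ?thesis .
  qed
  show "integrable (wed_measure \<epsilon>) f \<longleftrightarrow>
      set_integrable lborel {0..s} (\<lambda>t. 1 / \<epsilon> * exp (- t / \<epsilon>) * f t) \<and> integrable (wed_measure \<epsilon>) (\<lambda>t. f (s + t))"
    unfolding int int2 set_integrable_def F1_def[abs_def] k_def ..
  assume "integrable (wed_measure \<epsilon>) f"
  then have i: "integrable lborel F1" "integrable lborel F2" using int by auto
  have "(\<integral>t. f t \<partial>wed_measure \<epsilon>) = (LINT t|lborel. F1 t + F2 t)"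
    unfolding integral_wed_measure[OF \<epsilon> f] by (rule integral_cong_AE) (use sum in auto)
  also have "\<dots> = (LINT t|lborel. F1 t) + (LINT t|lborel. F2 t)" by (rule Bochner_Integration.integral_add[OF i])
  also have "(LINT t|lborel. F2 t) = (LINT t|lborel. F2 (s + 1 * t))"
    by (subst lborel_integral_real_affine[where c = 1 and t = s]) auto
  also have "\<dots> = exp (- s / \<epsilon>) * (\<integral>t. f (s + t) \<partial>wed_measure \<epsilon>)"
    unfolding shift using \<epsilon> by (simp add: integral_wed_measure)
  finally show "(\<integral>t. f t \<partial>wed_measure \<epsilon>) =
      (LBINT t:{0..s}. 1 / \<epsilon> * exp (- t / \<epsilon>) * f t) + exp (- s / \<epsilon>) * (\<integral>t. f (s + t) \<partial>wed_measure \<epsilon>)"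
    by (simp add: set_lebesgue_integral_def F1_def k_def)
qed

text \<open>Cauchy--Schwarz for the integral of \<open>g\<close>, written as \<open>exp (r / 2c) \<cdot> (g exp (- r / 2c))\<close>.\<close>

lemma dist_square_le_weighted:
  fixes u :: "real \<Rightarrow> 'a::metric_space"
  assumes u: "metric_speed u g" and c: "0 < c" and t: "0 \<le> t"
  shows "ennreal ((dist (u t) (u 0))\<^sup>2) \<le>
    ennreal (c * exp (t / c)) * (\<integral>\<^sup>+r. ennreal ((g r)\<^sup>2 * exp (- r / c)) * indicator {0..t} r \<partial>lborel)"
proof -
  have [measurable]: "g \<in> borel_measurable borel" by (rule metric_speed_measurable[OF u])
  have g0: "0 \<le> g r" for r by (rule metric_speed_nonneg[OF u])
  have gi: "integrable lborel (\<lambda>r. indicator {0..t} r *\<^sub>R g r)"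
    using metric_speed_integrable[OF u order.refl] by (simp add: set_integrable_def)
  let ?f1 = "\<lambda>r. ennreal (exp (r / (2 * c))) * indicator {0..t} r"
  let ?f2 = "\<lambda>r. ennreal (g r * exp (- r / (2 * c))) * indicator {0..t} r"
  have "ennreal (dist (u t) (u 0)) \<le> ennreal (LBINT r:{0..t}. g r)"
    using metric_speed_dist_le[OF u order.refl t] by (simp add: dist_commute ennreal_leI)
  also have "\<dots> = (\<integral>\<^sup>+r. ennreal (indicator {0..t} r *\<^sub>R g r) \<partial>lborel)"
    unfolding set_lebesgue_integral_def using gi g0 by (subst nn_integral_eq_integral) auto
  also have "\<dots> = (\<integral>\<^sup>+r. ?f1 r * ?f2 r \<partial>lborel)"
  proof (rule nn_integral_cong)
    fix r
    have "exp (r / (2 * c)) * (g r * exp (- r / (2 * c))) = g r"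
      by (simp add: exp_minus)
    then show "ennreal (indicator {0..t} r *\<^sub>R g r) = ?f1 r * ?f2 r"
      using g0[of r] by (simp add: indicator_def ennreal_mult'[symmetric])
  qed
  finally have "(ennreal (dist (u t) (u 0)))\<^sup>2 \<le> (\<integral>\<^sup>+r. ?f1 r * ?f2 r \<partial>lborel)\<^sup>2"
    by (rule power_mono) simp
  also have "\<dots> \<le> (\<integral>\<^sup>+r. ?f1 r ^ 2 \<partial>lborel) * (\<integral>\<^sup>+r. ?f2 r ^ 2 \<partial>lborel)"
    by (rule Cauchy_Schwarz_nn_integral) auto
  also have "(\<integral>\<^sup>+r. ?f2 r ^ 2 \<partial>lborel) = (\<integral>\<^sup>+r. ennreal ((g r)\<^sup>2 * exp (- r / c)) * indicator {0..t} r \<partial>lborel)"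
  proof (rule nn_integral_cong)
    fix r
    have "(g r * exp (- r / (2 * c)))\<^sup>2 = (g r)\<^sup>2 * exp (- r / c)"
      by (simp add: power_mult_distrib exp_double[symmetric])
    then show "?f2 r ^ 2 = ennreal ((g r)\<^sup>2 * exp (- r / c)) * indicator {0..t} r"
      using g0[of r] by (simp add: indicator_def ennreal_power)
  qed
  also have "(\<integral>\<^sup>+r. ?f1 r ^ 2 \<partial>lborel) = (\<integral>\<^sup>+r. ennreal (exp (r / c)) * indicator {0..t} r \<partial>lborel)"
  proof (rule nn_integral_cong)
    fix r
    have "(exp (r / (2 * c)))\<^sup>2 = exp (r / c)" by (simp add: exp_double[symmetric])
    then show "?f1 r ^ 2 = ennreal (exp (r / c)) * indicator {0..t} r"
      by (simp add: indicator_def ennreal_power)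
  qed
  also have "\<dots> = ennreal (c * exp (t / c) - c * exp (0 / c))"
    by (rule nn_integral_FTC_Icc) (use c t in \<open>auto intro!: derivative_eq_intros\<close>)
  also have "\<dots> \<le> ennreal (c * exp (t / c))" using c by (intro ennreal_leI) simp
  finally show ?thesis by (simp add: ennreal_power mult_right_mono)
qed

text \<open>The weighted Cauchy--Schwarz inequality with \<open>c = 2 \<epsilon>\<close> and Tonelli. The constant is what makes the
energy coercive: if \<open>B < 1 / (16 \<epsilon>)\<close>, then \<open>B\<close> times the left-hand side is at most half of the kinetic
term \<open>\<epsilon> / 2 \<integral> g\<^sup>2\<close>.\<close>

theorem wed_hardy_inequality:
  fixes u :: "real \<Rightarrow> 'a::metric_space"
  assumes u: "metric_speed u g" and \<epsilon>: "0 < \<epsilon>"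
  shows "(\<integral>\<^sup>+t. ennreal ((dist (u t) (u 0))\<^sup>2) \<partial>wed_measure \<epsilon>) \<le>
     ennreal (4 * \<epsilon>\<^sup>2) * (\<integral>\<^sup>+t. ennreal ((g t)\<^sup>2) \<partial>wed_measure \<epsilon>)"
proof -
  have [measurable]: "g \<in> borel_measurable borel" by (rule metric_speed_measurable[OF u])
  define c where "c = 2 * \<epsilon>"
  have c: "0 < c" using \<epsilon> by (simp add: c_def)
  define q where "q r = ennreal ((g r)\<^sup>2 * exp (- r / c))" for r
  have [measurable]: "q \<in> borel_measurable borel" unfolding q_def by measurable
  have "(\<integral>\<^sup>+t. ennreal ((dist (u t) (u 0))\<^sup>2) \<partial>wed_measure \<epsilon>) \<le>
     (\<integral>\<^sup>+t. ennreal (c * exp (t / c)) * (\<integral>\<^sup>+r. q r * indicator {0..t} r \<partial>lborel) \<partial>wed_measure \<epsilon>)"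
    unfolding q_def
  proof (rule nn_integral_mono_AE)
    show "AE t in wed_measure \<epsilon>. ennreal ((dist (u t) (u 0))\<^sup>2) \<le>
      ennreal (c * exp (t / c)) * (\<integral>\<^sup>+r. ennreal ((g r)\<^sup>2 * exp (- r / c)) * indicator {0..t} r \<partial>lborel)"
      unfolding AE_wed_measure[OF \<epsilon>] by (intro AE_I2 impI dist_square_le_weighted[OF u c] less_imp_le)
  qed
  also have "\<dots> = (\<integral>\<^sup>+t. ennreal (wed_density \<epsilon> t) * (ennreal (c * exp (t / c)) * (\<integral>\<^sup>+r. (if 0 \<le> r \<and> r \<le> t then q r else 0) \<partial>lborel)) \<partial>lborel)"
  proof -
    have "q r * indicator {0..t} r = (if 0 \<le> r \<and> r \<le> t then q r else 0)" for r t by (simp add: indicator_def)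
    then show ?thesis unfolding wed_measure_eq by (simp add: nn_integral_density)
  qed
  also have "\<dots> = (\<integral>\<^sup>+t. (\<integral>\<^sup>+r. ennreal (wed_density \<epsilon> t * (c * exp (t / c))) * (if 0 \<le> r \<and> r \<le> t then q r else 0) \<partial>lborel) \<partial>lborel)"
    using c \<epsilon> by (intro nn_integral_cong) (simp add: nn_integral_cmult ennreal_mult wed_density_nonneg mult.assoc)
  also have "\<dots> = (\<integral>\<^sup>+r. (\<integral>\<^sup>+t. ennreal (wed_density \<epsilon> t * (c * exp (t / c))) * (if 0 \<le> r \<and> r \<le> t then q r else 0) \<partial>lborel) \<partial>lborel)"
    by (rule lborel_pair.Fubini') simp
  also have "\<dots> = (\<integral>\<^sup>+r. ennreal (4 * \<epsilon>\<^sup>2) * (ennreal (wed_density \<epsilon> r) * ennreal ((g r)\<^sup>2)) \<partial>lborel)"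
  proof (rule nn_integral_cong_AE)
    show "AE r in lborel. (\<integral>\<^sup>+t. ennreal (wed_density \<epsilon> t * (c * exp (t / c))) * (if 0 \<le> r \<and> r \<le> t then q r else 0) \<partial>lborel)
       = ennreal (4 * \<epsilon>\<^sup>2) * (ennreal (wed_density \<epsilon> r) * ennreal ((g r)\<^sup>2))"
      using AE_lborel_singleton[of 0]
    proof eventually_elim
      case (elim r)
      show ?case
      proof (cases "0 < r")
        case True
        have ex: "1 / \<epsilon> * exp (- t / \<epsilon>) * (c * exp (t / c)) = 2 * exp (- t / c)" for t
        proof -
          have "exp (- t / \<epsilon>) * exp (t / c) = exp (- t / c)"
            using \<epsilon> by (simp add: exp_add[symmetric] c_def field_simps)
          then show ?thesis using \<epsilon> by (simp add: c_def field_simps)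
        qed
        have "(\<integral>\<^sup>+t. ennreal (wed_density \<epsilon> t * (c * exp (t / c))) * (if 0 \<le> r \<and> r \<le> t then q r else 0) \<partial>lborel)
            = (\<integral>\<^sup>+t. (2 * q r) * (ennreal (exp (- t / c)) * indicator {r..} t) \<partial>lborel)"
        proof (rule nn_integral_cong)
          fix t
          show "ennreal (wed_density \<epsilon> t * (c * exp (t / c))) * (if 0 \<le> r \<and> r \<le> t then q r else 0)
            = (2 * q r) * (ennreal (exp (- t / c)) * indicator {r..} t)"
            using True ex[of t] by (auto simp: wed_density_def indicator_def ennreal_mult ac_simps)
        qed
        also have "\<dots> = (2 * q r) * ennreal (c * exp (- r / c))"
          by (subst nn_integral_cmult, simp, subst nn_integral_exp_tail[OF c]) (rule refl)
        also have "\<dots> = ennreal (2 * ((g r)\<^sup>2 * exp (- r / c)) * (c * exp (- r / c)))"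
          unfolding q_def using c by (simp add: ennreal_mult)
        also have "2 * ((g r)\<^sup>2 * exp (- r / c)) * (c * exp (- r / c)) = 4 * \<epsilon>\<^sup>2 * (1 / \<epsilon> * exp (- r / \<epsilon>) * (g r)\<^sup>2)"
        proof -
          have "exp (- r / c) * exp (- r / c) = exp (- r / \<epsilon>)"
            using \<epsilon> by (simp add: exp_add[symmetric] c_def)
          then show ?thesis using \<epsilon> by (simp add: c_def power2_eq_square field_simps)
        qed
        also have "ennreal (4 * \<epsilon>\<^sup>2 * (1 / \<epsilon> * exp (- r / \<epsilon>) * (g r)\<^sup>2)) =
           ennreal (4 * \<epsilon>\<^sup>2) * (ennreal (1 / \<epsilon> * exp (- r / \<epsilon>)) * ennreal ((g r)\<^sup>2))"
        proof -
          have aux: "ennreal (a * (b * c)) = ennreal a * (ennreal b * ennreal c)" if "0 \<le> a" "0 \<le> b" "0 \<le> c" for a b c :: real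
            using that by (simp add: ennreal_mult)
          show ?thesis by (rule aux) (use \<epsilon> in simp_all)
        qed
        also have "1 / \<epsilon> * exp (- r / \<epsilon>) = wed_density \<epsilon> r" using True by (simp add: wed_density_def)
        finally show ?thesis .
      next
        case False
        then show ?thesis using elim by (simp add: wed_density_def)
      qed
    qed
  qed
  also have "\<dots> = ennreal (4 * \<epsilon>\<^sup>2) * (\<integral>\<^sup>+t. ennreal ((g t)\<^sup>2) \<partial>wed_measure \<epsilon>)"
    unfolding wed_measure_eq by (subst nn_integral_density) (auto simp: nn_integral_cmult)
  finally show ?thesis .
qed

lemma ereal_integral_eq_integral:
  fixes f :: "'b \<Rightarrow> ereal" and p :: "'b \<Rightarrow> real"
  assumes p: "integrable M p" and f: "AE x in M. f x = ereal (p x)"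
  shows "ereal_integral M f = ereal (\<integral>x. p x \<partial>M)"
proof -
  have 1: "(\<integral>\<^sup>+x. e2ennreal (f x) \<partial>M) = (\<integral>\<^sup>+x. ennreal (p x) \<partial>M)"
    by (rule nn_integral_cong_AE) (use f in \<open>eventually_elim, simp add: ennreal_def\<close>)
  have 2: "(\<integral>\<^sup>+x. e2ennreal (- f x) \<partial>M) = (\<integral>\<^sup>+x. ennreal (- p x) \<partial>M)"
    by (rule nn_integral_cong_AE) (use f in \<open>eventually_elim, simp add: ennreal_def\<close>)
  have fin: "(\<integral>\<^sup>+x. ennreal (p x) \<partial>M) < \<infinity>" "(\<integral>\<^sup>+x. ennreal (- p x) \<partial>M) < \<infinity>"
    using p unfolding real_integrable_def by (auto simp: top.not_eq_extremum)
  show ?thesis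
    unfolding ereal_integral_def 1 2 real_lebesgue_integral_def[OF p]
    using fin by (cases "\<integral>\<^sup>+x. ennreal (p x) \<partial>M" rule: ennreal_cases; cases "\<integral>\<^sup>+x. ennreal (- p x) \<partial>M" rule: ennreal_cases) auto
qed

lemma ereal_integral_finite:
  fixes f :: "'b \<Rightarrow> ereal"
  assumes f[measurable]: "f \<in> borel_measurable M" and neg: "(\<integral>\<^sup>+x. e2ennreal (- f x) \<partial>M) < \<infinity>"
    and less: "ereal_integral M f < \<infinity>"
  shows "AE x in M. f x = ereal (real_of_ereal (f x))" and "integrable M (\<lambda>x. real_of_ereal (f x))"
proof -
  have pos: "(\<integral>\<^sup>+x. e2ennreal (f x) \<partial>M) < \<infinity>"
    using less neg unfolding ereal_integral_def
    by (cases "\<integral>\<^sup>+x. e2ennreal (f x) \<partial>M" rule: ennreal_cases; cases "\<integral>\<^sup>+x. e2ennreal (- f x) \<partial>M" rule: ennreal_cases) auto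
  have "AE x in M. e2ennreal (f x) \<noteq> \<infinity>" "AE x in M. e2ennreal (- f x) \<noteq> \<infinity>"
    using pos neg nn_integral_PInf_AE[of "\<lambda>x. e2ennreal (f x)" M] nn_integral_PInf_AE[of "\<lambda>x. e2ennreal (- f x)" M]
    by simp_all
  then show eq: "AE x in M. f x = ereal (real_of_ereal (f x))"
  proof eventually_elim
    case (elim x)
    then show ?case by (cases "f x") auto
  qed
  have "(\<integral>\<^sup>+x. ennreal (real_of_ereal (f x)) \<partial>M) = (\<integral>\<^sup>+x. e2ennreal (f x) \<partial>M)"
    by (rule nn_integral_cong_AE) (use eq in \<open>eventually_elim, metis ennreal.abs_eq ennreal_def comp_apply e2ennreal_ereal\<close>)
  moreover have "(\<integral>\<^sup>+x. ennreal (- real_of_ereal (f x)) \<partial>M) = (\<integral>\<^sup>+x. e2ennreal (- f x) \<partial>M)"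
    by (rule nn_integral_cong_AE) (use eq in \<open>eventually_elim, metis e2ennreal_ereal uminus_ereal.simps(1)\<close>)
  ultimately show "integrable M (\<lambda>x. real_of_ereal (f x))"
    unfolding real_integrable_def using pos neg by auto
qed

section \<open>Restarting and concatenating curves\<close>

lemma AE_lborel_translate:
  fixes c :: real
  assumes "AE x in lborel. P x"
  shows "AE x in lborel. P (c + x)"
proof -
  obtain N where N: "\<And>x. x \<in> space lborel - N \<Longrightarrow> P x" "N \<in> null_sets lborel"
    using AE_E3[OF assms] by blast
  have [measurable]: "N \<in> sets borel" using N(2) by auto
  have "AE x in lborel. x \<notin> N" by (rule AE_not_in[OF N(2)])
  then have "AE x in lborel. c + 1 * x \<notin> N" by (intro AE_borel_affine[where P = "\<lambda>x. x \<notin> N"]) auto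
  then show ?thesis by eventually_elim (use N(1) in auto)
qed

lemma Lim_eqI: "(\<And>L. (f \<longlongrightarrow> L) F \<longleftrightarrow> (g \<longlongrightarrow> L) G) \<Longrightarrow> Lim F f = Lim G g"
  by (simp add: t2_space_class.Lim_def)

lemma metric_deriv_shift:
  fixes u :: "real \<Rightarrow> 'a::metric_space"
  assumes "0 \<le> t" "0 < r"
  shows "metric_deriv (\<lambda>r. u (t + r)) r = metric_deriv u (t + r)"
  unfolding metric_deriv_def
proof (rule Lim_eqI)
  fix L
  have 1: "at r within {0..} = at r" "at (t + r) within {0..} = at (t + r)"
    using assms by (auto intro!: at_within_interior)
  show "((\<lambda>s. dist (u (t + s)) (u (t + r)) / \<bar>r - s\<bar>) \<longlongrightarrow> L) (at r within {0..}) \<longleftrightarrow>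
     ((\<lambda>s. dist (u s) (u (t + r)) / \<bar>t + r - s\<bar>) \<longlongrightarrow> L) (at (t + r) within {0..})"
    unfolding 1
    using LIM_offset[of "\<lambda>s. dist (u s) (u (t + r)) / \<bar>t + r - s\<bar>" L "t + r" t]
      LIM_offset[of "\<lambda>s. dist (u (t + s)) (u (t + r)) / \<bar>r - s\<bar>" L r "- t"]
    by (auto simp: algebra_simps)
qed

lemma metric_deriv_cong:
  assumes "\<And>s. 0 \<le> s \<Longrightarrow> u s = v s" "0 \<le> t"
  shows "metric_deriv u t = metric_deriv v t"
  unfolding metric_deriv_def
proof (rule Lim_eqI)
  fix L
  have "eventually (\<lambda>s. s \<in> {0..}) (at t within {0..})" by (simp add: eventually_at_filter)
  then have "eventually (\<lambda>s. dist (u s) (u t) / \<bar>t - s\<bar> = dist (v s) (v t) / \<bar>t - s\<bar>) (at t within {0..})"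
    by eventually_elim (use assms in auto)
  then show "((\<lambda>s. dist (u s) (u t) / \<bar>t - s\<bar>) \<longlongrightarrow> L) (at t within {0..}) \<longleftrightarrow>
      ((\<lambda>s. dist (v s) (v t) / \<bar>t - s\<bar>) \<longlongrightarrow> L) (at t within {0..})"
    by (rule tendsto_cong)
qed

lemma set_integral_translate:
  fixes f :: "real \<Rightarrow> real"
  shows "(LBINT r:{a..b}. f (c + r)) = (LBINT r:{c + a..c + b}. f r)"
proof -
  have "(LBINT r:{c + a..c + b}. f r) = (LINT r|lborel. indicator {c + a..c + b} (c + 1 * r) *\<^sub>R f (c + 1 * r))"
    unfolding set_lebesgue_integral_def by (subst lborel_integral_real_affine[where c = 1 and t = c]) auto
  also have "\<dots> = (LBINT r:{a..b}. f (c + r))"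
    unfolding set_lebesgue_integral_def by (intro Bochner_Integration.integral_cong) (auto simp: indicator_def)
  finally show ?thesis ..
qed

lemma set_integrable_translate:
  fixes f :: "real \<Rightarrow> real"
  assumes "set_integrable lborel {c + a..c + b} f"
  shows "set_integrable lborel {a..b} (\<lambda>r. f (c + r))"
proof -
  have "integrable lborel (\<lambda>r. indicator {c + a..c + b} (c + 1 * r) *\<^sub>R f (c + 1 * r))"
    using assms unfolding set_integrable_def by (rule lborel_integrable_real_affine) simp
  then show ?thesis
    unfolding set_integrable_def
    by (rule Bochner_Integration.integrable_cong[THEN iffD1, rotated 2]) (auto simp: indicator_def)
qed

lemma metric_speed_shift:
  assumes u: "metric_speed u g" and t: "0 \<le> t"
  shows "metric_speed (\<lambda>r. u (t + r)) (\<lambda>r. g (t + r))"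
  unfolding metric_speed_def
proof (intro conjI allI impI)
  have [measurable]: "g \<in> borel_measurable borel" by (rule metric_speedD[OF u])
  show "(\<lambda>r. g (t + r)) \<in> borel_measurable borel" by measurable
  show "0 \<le> g (t + r)" for r by (rule metric_speedD[OF u])
  show "set_integrable lborel {0..b} (\<lambda>r. (g (t + r))\<^sup>2)" for b
  proof (rule set_integrable_translate[where f = "\<lambda>r. (g r)\<^sup>2"])
    show "set_integrable lborel {t + 0..t + b} (\<lambda>r. (g r)\<^sup>2)"
      by (rule set_integrable_subset[OF metric_speed_square_integrable[OF u, of "t + b"]]) (use t in auto)
  qed
  show "dist (u (t + r)) (u (t + s)) \<le> (LBINT q:{r..s}. g (t + q))" if "0 \<le> r" "r \<le> s" for r s
    unfolding set_integral_translate using t that by (intro metric_speed_dist_le[OF u]) auto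
qed

lemma geodesicD:
  assumes "geodesic \<gamma>" "0 \<le> a" "a \<le> 1" "0 \<le> b" "b \<le> 1"
  shows "dist (\<gamma> a) (\<gamma> b) = \<bar>b - a\<bar> * dist (\<gamma> 0) (\<gamma> 1)"
proof -
  have "a \<in> {0..1}" "b \<in> {0..1}" using assms by simp_all
  then show ?thesis using assms(1) unfolding geodesic_def by blast
qed

lemma metric_speed_concat:
  fixes \<gamma> v :: "real \<Rightarrow> 'a::metric_space"
  assumes v: "metric_speed v g" and \<gamma>: "geodesic \<gamma>" "\<gamma> 1 = v 0" and s: "0 < s"
  shows "metric_speed (\<lambda>t. if t \<le> s then \<gamma> (t / s) else v (t - s))
     (\<lambda>t. if t \<le> s then dist (\<gamma> 0) (\<gamma> 1) / s else g (t - s))" (is "metric_speed ?w ?h")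
  unfolding metric_speed_def
proof (intro conjI allI impI)
  have gm[measurable]: "g \<in> borel_measurable borel" by (rule metric_speedD[OF v])
  show hm: "?h \<in> borel_measurable borel" by measurable
  show "0 \<le> ?h t" for t using metric_speed_nonneg[OF v] s by simp
  define D where "D = dist (\<gamma> 0) (\<gamma> 1) / s"
  have h1: "?h t = D" if "t \<le> s" for t using that by (simp add: D_def)
  have h2: "?h t = g (- s + t)" if "s < t" for t using that by simp
  have sq: "set_integrable lborel {0..b} (\<lambda>t. (?h t)\<^sup>2)" for b
  proof -
    have "set_integrable lborel {0..s} (\<lambda>t. (?h t)\<^sup>2)"
      by (rule set_integrable_cong[THEN iffD1, OF refl refl _ set_integrable_const_Icc[of 0 s "D\<^sup>2"]]) (simp add: D_def)
    moreover have "set_integrable lborel {s<..b} (\<lambda>t. (?h t)\<^sup>2)"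
    proof (rule set_integrable_cong[THEN iffD1, OF refl refl])
      have "set_integrable lborel {s..b} (\<lambda>t. (g (- s + t))\<^sup>2)"
        using metric_speed_square_integrable[OF v, of "b - s"]
        by (intro set_integrable_translate[where f = "\<lambda>t. (g t)\<^sup>2"]) simp
      then show "set_integrable lborel {s<..b} (\<lambda>t. (g (- s + t))\<^sup>2)"
        by (rule set_integrable_subset) auto
    qed simp
    ultimately have "set_integrable lborel ({0..s} \<union> {s<..b}) (\<lambda>t. (?h t)\<^sup>2)"
      by (rule set_integrable_Un) auto
    then show ?thesis by (rule set_integrable_subset) auto
  qed
  then show "set_integrable lborel {0..b} (\<lambda>t. (?h t)\<^sup>2)" for b .
  have hi: "set_integrable lborel {p..q} ?h" if "0 \<le> p" for p q
  proof (rule set_integrable_subset)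
    show "set_integrable lborel {0..q} ?h"
      by (rule set_integrable_if_square[OF _ sq]) (use hm in \<open>simp add: set_borel_measurable_def\<close>)
  qed (use that in auto)
  have first: "dist (?w p) (?w q) \<le> (LBINT r:{p..q}. ?h r)" if pq: "0 \<le> p" "p \<le> q" "q \<le> s" for p q
  proof -
    have "dist (?w p) (?w q) = \<bar>q / s - p / s\<bar> * dist (\<gamma> 0) (\<gamma> 1)"
      using geodesicD[OF \<gamma>(1), of "p / s" "q / s"] pq s by simp
    also have "\<dots> = D * (q - p)" using pq s by (simp add: D_def field_simps abs_if)
    also have "\<dots> = (LBINT r:{p..q}. D)" using pq by (simp add: set_integral_const)
    also have "\<dots> = (LBINT r:{p..q}. ?h r)"
      by (rule set_lebesgue_integral_cong) (use pq in \<open>auto simp: D_def\<close>)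
    finally show ?thesis by simp
  qed
  have ws: "?w p = v (- s + p)" if "s \<le> p" for p using that s \<gamma>(2) by (auto simp: le_less)
  have second: "dist (?w p) (?w q) \<le> (LBINT r:{p..q}. ?h r)" if pq: "s \<le> p" "p \<le> q" for p q
  proof -
    have "dist (?w p) (?w q) = dist (v (- s + p)) (v (- s + q))"
      using ws[of p] ws[of q] pq by simp
    also have "\<dots> \<le> (LBINT r:{- s + p..- s + q}. g r)"
      using pq by (intro metric_speed_dist_le[OF v]) auto
    also have "\<dots> = (LBINT r:{p..q}. g (- s + r))" by (rule set_integral_translate[symmetric])
    also have "\<dots> = (LBINT r:{p..q}. ?h r)"
    proof (rule set_lebesgue_integral_cong_AE)
      show "AE r\<in>{p..q} in lborel. g (- s + r) = ?h r"
        using AE_lborel_singleton[of s] by eventually_elim (use pq in auto)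
    qed (use hm in simp_all)
    finally show ?thesis .
  qed
  show "dist (?w p) (?w q) \<le> (LBINT r:{p..q}. ?h r)" if pq: "0 \<le> p" "p \<le> q" for p q
  proof -
    consider "q \<le> s" | "s \<le> p" | "p < s" "s < q" by linarith
    then show ?thesis
    proof cases
      case 1
      then show ?thesis using first pq by blast
    next
      case 2
      then show ?thesis using second pq by blast
    next
      case 3
      have "dist (?w p) (?w q) \<le> dist (?w p) (?w s) + dist (?w s) (?w q)" by (rule dist_triangle)
      also have "\<dots> \<le> (LBINT r:{p..s}. ?h r) + (LBINT r:{s..q}. ?h r)"
        using first[of p s] second[of s q] 3 pq by (intro add_mono) auto
      also have "(LBINT r:{s..q}. ?h r) = (LBINT r:{s<..q}. ?h r)"
        unfolding set_lebesgue_integral_def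
      proof (rule integral_cong_AE)
        show "AE x in lborel. indicator {s..q} x *\<^sub>R ?h x = indicator {s<..q} x *\<^sub>R ?h x"
          using AE_lborel_singleton[of s] by eventually_elim (auto simp: indicator_def)
      qed (use hm in simp_all)
      also have "(LBINT r:{p..s}. ?h r) + (LBINT r:{s<..q}. ?h r) = (LBINT r:{p..s} \<union> {s<..q}. ?h r)"
      proof (rule set_integral_Un[symmetric])
        show "set_integrable lborel {p..s} ?h" by (rule hi) (use pq in auto)
        show "set_integrable lborel {s<..q} ?h"
          by (rule set_integrable_subset[OF hi[OF pq(1), of q]]) (use 3 in auto)
      qed auto
      also have "{p..s} \<union> {s<..q} = {p..q}" using 3 by auto
      finally show ?thesis .
    qed
  qed
qed

lemma metric_deriv_geodesic:
  assumes \<gamma>: "geodesic \<gamma>" and s: "0 < s" and t: "0 < t" "t < s" and w: "\<And>r. 0 \<le> r \<Longrightarrow> r \<le> s \<Longrightarrow> w r = \<gamma> (r / s)"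
  shows "metric_deriv w t = dist (\<gamma> 0) (\<gamma> 1) / s"
proof (rule metric_deriv_eqI[OF t(1)])
  have "eventually (\<lambda>r. r \<in> {0<..<s}) (at t)" using t by (intro eventually_at_in_open') auto
  moreover have "eventually (\<lambda>r. r \<noteq> t) (at t)" by (rule eventually_neq_at_within)
  ultimately have "eventually (\<lambda>r. dist (\<gamma> 0) (\<gamma> 1) / s = dist (w r) (w t) / \<bar>t - r\<bar>) (at t)"
  proof eventually_elim
    case (elim r)
    have "dist (w r) (w t) = \<bar>t / s - r / s\<bar> * dist (\<gamma> 0) (\<gamma> 1)"
      using geodesicD[OF \<gamma>, of "r / s" "t / s"] w[of r] w[of t] elim t s by simp
    also have "\<bar>t / s - r / s\<bar> = \<bar>t - r\<bar> / s" using s by (simp add: diff_divide_distrib[symmetric])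
    finally show ?case using elim by simp
  qed
  from tendsto_eventually[OF eventually_mono[OF this sym]]
  show "((\<lambda>r. dist (w r) (w t) / \<bar>t - r\<bar>) \<longlongrightarrow> dist (\<gamma> 0) (\<gamma> 1) / s) (at t)" .
qed

section \<open>Curves of finite energy\<close>

text \<open>The topology \<open>\<sigma>\<close> enters through the lower semicontinuity of \<open>\<phi>\<close> for the metric, the first assumption.\<close>

locale wed_setting =
  fixes \<phi> :: "'a::metric_space \<Rightarrow> ereal" and ustar :: 'a and A B l \<epsilon> :: real
  assumes lsc: "\<And>c. open {y. c < \<phi> y}"
    and phi_not_MInf: "\<And>y. \<phi> y \<noteq> - \<infinity>"
    and coercive: "\<And>u v. ereal (- B * (dist u v)\<^sup>2 - (B * (dist v ustar)\<^sup>2 + A)) \<le> \<phi> u"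
    and A_nonneg: "0 \<le> A" and B_nonneg: "0 \<le> B"
    and convex: "geodesically_convex l \<phi>"
    and eps: "0 < \<epsilon>" and B_small: "B < 1 / (16 * \<epsilon>)"
begin

abbreviation "\<mu> \<equiv> wed_measure \<epsilon>"

abbreviation "weight r \<equiv> 1 / \<epsilon> * exp (- r / \<epsilon>)"

definition Q :: "'a \<Rightarrow> real" where "Q v = B * (dist v ustar)\<^sup>2 + A"

text \<open>The time is clamped at \<open>0\<close> since nothing is known about \<open>u\<close> at negative times, where the function has
to be measurable nevertheless.\<close>

definition potential :: "(real \<Rightarrow> 'a) \<Rightarrow> real \<Rightarrow> real" where
  "potential u t = real_of_ereal (\<phi> (u (max 0 t)))"

text \<open>For these curves the functional is an ordinary real integral, \<open>energy u g\<close>.\<close>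

definition finite_curve :: "(real \<Rightarrow> 'a) \<Rightarrow> (real \<Rightarrow> real) \<Rightarrow> bool" where
  "finite_curve u g \<longleftrightarrow> metric_speed u g \<and> (AE t in lborel. 0 < t \<longrightarrow> metric_deriv u t = g t) \<and>
     integrable \<mu> (\<lambda>t. (g t)\<^sup>2) \<and>
     (AE t in \<mu>. \<phi> (u t) = ereal (potential u t)) \<and> integrable \<mu> (potential u)"

definition energy :: "(real \<Rightarrow> 'a) \<Rightarrow> (real \<Rightarrow> real) \<Rightarrow> real" where
  "energy u g = (\<integral>t. \<epsilon> / 2 * (g t)\<^sup>2 + potential u t \<partial>\<mu>)"

lemma Q_nonneg: "0 \<le> Q v"
  using A_nonneg B_nonneg by (simp add: Q_def)

lemma coercive_Q: "ereal (- B * (dist u v)\<^sup>2 - Q v) \<le> \<phi> u"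
  using coercive[of u v] by (simp add: Q_def)

lemma phi_measurable[measurable]: "\<phi> \<in> borel_measurable borel"
  by (rule borel_measurableI_greater) (use lsc in auto)

lemma curve_measurable:
  assumes "metric_speed u g"
  shows "(\<lambda>t. u (max 0 t)) \<in> borel_measurable borel"
  by (rule borel_measurable_continuous_onI[OF metric_speed_continuous[OF assms]])

lemma phi_curve_measurable:
  assumes "metric_speed u g"
  shows "(\<lambda>t. \<phi> (u (max 0 t))) \<in> borel_measurable borel"
  by (rule measurable_compose[OF curve_measurable[OF assms] phi_measurable])

lemma potential_measurable:
  assumes "metric_speed u g"
  shows "potential u \<in> borel_measurable borel"
  unfolding potential_def[abs_def] using phi_curve_measurable[OF assms] by measurable

lemma AE_wed_pos: "AE t in \<mu>. 0 < t"
  unfolding AE_wed_measure[OF eps] by simp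

lemma dist_square_integrable:
  assumes u: "metric_speed u g" and g: "integrable \<mu> (\<lambda>t. (g t)\<^sup>2)"
  shows "integrable \<mu> (\<lambda>t. (dist (u (max 0 t)) (u 0))\<^sup>2)"
    and "(\<integral>t. (dist (u (max 0 t)) (u 0))\<^sup>2 \<partial>\<mu>) \<le> 4 * \<epsilon>\<^sup>2 * (\<integral>t. (g t)\<^sup>2 \<partial>\<mu>)"
proof -
  let ?W = \<mu> and ?d = "\<lambda>t. (dist (u (max 0 t)) (u 0))\<^sup>2"
  have "(\<lambda>t. dist (u (max 0 t)) (u 0)) \<in> borel_measurable borel"
    by (rule borel_measurable_continuous_onI) (intro continuous_intros metric_speed_continuous[OF u])
  then have m: "?d \<in> borel_measurable ?W" unfolding borel_measurable_wed_measure by measurable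
  have "(\<integral>\<^sup>+t. ennreal (?d t) \<partial>?W) = (\<integral>\<^sup>+t. ennreal ((dist (u t) (u 0))\<^sup>2) \<partial>?W)"
    by (rule nn_integral_cong_AE) (use AE_wed_pos in \<open>eventually_elim, simp\<close>)
  also have "\<dots> \<le> ennreal (4 * \<epsilon>\<^sup>2) * (\<integral>\<^sup>+t. ennreal ((g t)\<^sup>2) \<partial>?W)"
    by (rule wed_hardy_inequality[OF u eps])
  also have "(\<integral>\<^sup>+t. ennreal ((g t)\<^sup>2) \<partial>?W) = ennreal (\<integral>t. (g t)\<^sup>2 \<partial>?W)"
    by (rule nn_integral_eq_integral[OF g]) simp
  finally have le: "(\<integral>\<^sup>+t. ennreal (?d t) \<partial>?W) \<le> ennreal (4 * \<epsilon>\<^sup>2 * (\<integral>t. (g t)\<^sup>2 \<partial>?W))"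
    by (simp add: ennreal_mult')
  show i: "integrable ?W ?d"
    by (rule integrableI_nonneg[OF m]) (use le in \<open>auto intro: le_less_trans\<close>)
  have "ennreal (\<integral>t. ?d t \<partial>?W) \<le> ennreal (4 * \<epsilon>\<^sup>2 * (\<integral>t. (g t)\<^sup>2 \<partial>?W))"
    using le by (subst (asm) nn_integral_eq_integral[OF i]) auto
  then show "(\<integral>t. ?d t \<partial>?W) \<le> 4 * \<epsilon>\<^sup>2 * (\<integral>t. (g t)\<^sup>2 \<partial>?W)"
    by (subst (asm) ennreal_le_iff) (auto intro!: mult_nonneg_nonneg Bochner_Integration.integral_nonneg)
qed

lemma finite_curveI:
  assumes u: "metric_speed u g" "AE t in lborel. 0 < t \<longrightarrow> metric_deriv u t = g t"
    "integrable \<mu> (\<lambda>t. (g t)\<^sup>2)"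
    and q: "AE t in \<mu>. \<phi> (u t) = ereal (q t)" "integrable \<mu> q"
  shows "finite_curve u g"
proof -
  have eq: "AE t in \<mu>. potential u t = q t"
    using q(1) AE_wed_pos by eventually_elim (simp add: potential_def)
  have "integrable \<mu> (potential u)"
    using q(2) by (rule Bochner_Integration.integrable_cong_AE_imp)
      (use eq potential_measurable[OF u(1)] in \<open>auto simp: borel_measurable_wed_measure\<close>)
  moreover have "AE t in \<mu>. \<phi> (u t) = ereal (potential u t)"
    using q(1) eq by eventually_elim simp
  ultimately show ?thesis using u unfolding finite_curve_def by blast
qed

lemma finite_curveD:
  assumes "finite_curve u g"
  shows finite_curve_speed: "metric_speed u g"
    and finite_curve_deriv: "AE t in lborel. 0 < t \<longrightarrow> metric_deriv u t = g t"
    and finite_curve_square: "integrable \<mu> (\<lambda>t. (g t)\<^sup>2)"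
    and finite_curve_AE: "AE t in \<mu>. \<phi> (u t) = ereal (potential u t)"
    and finite_curve_potential: "integrable \<mu> (potential u)"
  using assms unfolding finite_curve_def by (blast+)

lemma finite_curve_in_wed_curves:
  assumes u: "finite_curve u g"
  shows "u \<in> wed_curves \<epsilon> (u 0)"
proof -
  have "AE t in \<mu>. ennreal ((metric_deriv u t)\<^sup>2) = ennreal ((g t)\<^sup>2)"
    unfolding AE_wed_measure[OF eps] using finite_curve_deriv[OF u] by eventually_elim simp
  then have "(\<integral>\<^sup>+ t. ennreal ((metric_deriv u t)\<^sup>2) \<partial>\<mu>) = (\<integral>\<^sup>+ t. ennreal ((g t)\<^sup>2) \<partial>\<mu>)"
    by (rule nn_integral_cong_AE)
  also have "\<dots> = ennreal (\<integral>t. (g t)\<^sup>2 \<partial>\<mu>)"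
    by (rule nn_integral_eq_integral[OF finite_curve_square[OF u]]) simp
  finally show ?thesis
    using metric_speed_imp_AC2_loc[OF finite_curve_speed[OF u]] by (simp add: wed_curves_def)
qed

lemma wed_functional_eq_energy:
  assumes u: "finite_curve u g"
  shows "wed_functional \<epsilon> \<phi> u = ereal (energy u g)"
  unfolding wed_functional_def energy_def
proof (rule ereal_integral_eq_integral)
  show "integrable \<mu> (\<lambda>t. \<epsilon> / 2 * (g t)\<^sup>2 + potential u t)"
    using finite_curve_square[OF u] finite_curve_potential[OF u] by simp
  have "AE t in \<mu>. metric_deriv u t = g t"
    unfolding AE_wed_measure[OF eps] by (rule finite_curve_deriv[OF u])
  then show "AE t in \<mu>. ereal (\<epsilon> / 2 * (metric_deriv u t)\<^sup>2) + \<phi> (u t) = ereal (\<epsilon> / 2 * (g t)\<^sup>2 + potential u t)"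
    using finite_curve_AE[OF u] by eventually_elim simp
qed

lemma value_fun_le_energy:
  assumes u: "finite_curve u g"
  shows "value_fun \<epsilon> \<phi> (u 0) \<le> ereal (energy u g)"
  unfolding value_fun_def wed_functional_eq_energy[OF u, symmetric]
  by (rule INF_lower[OF finite_curve_in_wed_curves[OF u]])

text \<open>The quadratic lower bound for \<open>\<phi>\<close> centred at \<open>u 0\<close> and the Hardy inequality make the negative part of
the integrand integrable, so a finite value of the functional makes the positive part integrable too.\<close>

lemma wed_curves_finite:
  assumes u: "u \<in> wed_curves \<epsilon> x" and fin: "wed_functional \<epsilon> \<phi> u < \<infinity>"
  obtains g where "finite_curve u g" "u 0 = x"
proof -
  let ?W = \<mu>
  have ux: "u 0 = x" and ac: "AC2_loc {0..} u" and fd: "(\<integral>\<^sup>+ t. ennreal ((metric_deriv u t)\<^sup>2) \<partial>?W) < \<infinity>"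
    using u by (auto simp: wed_curves_def)
  obtain g where g: "metric_speed u g" "AE t in lborel. 0 < t \<longrightarrow> metric_deriv u t = g t"
    by (rule AC2_loc_imp_metric_speed[OF ac])
  have gW: "AE t in ?W. metric_deriv u t = g t" unfolding AE_wed_measure[OF eps] by (rule g(2))
  have gm[measurable]: "g \<in> borel_measurable borel" by (rule metric_speed_measurable[OF g(1)])
  have "(\<integral>\<^sup>+ t. ennreal ((metric_deriv u t)\<^sup>2) \<partial>?W) = (\<integral>\<^sup>+ t. ennreal ((g t)\<^sup>2) \<partial>?W)"
    by (rule nn_integral_cong_AE) (use gW in \<open>eventually_elim, simp\<close>)
  then have sq: "integrable ?W (\<lambda>t. (g t)\<^sup>2)"
    using fd by (intro integrableI_nonneg) auto
  define f where "f t = ereal (\<epsilon> / 2 * (g t)\<^sup>2) + \<phi> (u (max 0 t))" for t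
  have fm: "f \<in> borel_measurable ?W"
    unfolding f_def borel_measurable_wed_measure using phi_curve_measurable[OF g(1)] by measurable
  have ff: "AE t in ?W. ereal (\<epsilon> / 2 * (metric_deriv u t)\<^sup>2) + \<phi> (u t) = f t"
    using gW AE_wed_pos by eventually_elim (simp add: f_def)
  have "wed_functional \<epsilon> \<phi> u = ereal_integral ?W f"
  proof -
    have "(\<integral>\<^sup>+t. e2ennreal (ereal (\<epsilon> / 2 * (metric_deriv u t)\<^sup>2) + \<phi> (u t)) \<partial>?W) = (\<integral>\<^sup>+t. e2ennreal (f t) \<partial>?W)"
      by (rule nn_integral_cong_AE) (use ff in \<open>eventually_elim, simp\<close>)
    moreover have "(\<integral>\<^sup>+t. e2ennreal (- (ereal (\<epsilon> / 2 * (metric_deriv u t)\<^sup>2) + \<phi> (u t))) \<partial>?W) = (\<integral>\<^sup>+t. e2ennreal (- f t) \<partial>?W)"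
      by (rule nn_integral_cong_AE) (use ff in \<open>eventually_elim, simp only:\<close>)
    ultimately show ?thesis unfolding wed_functional_def ereal_integral_def by simp
  qed
  then have ffin: "ereal_integral ?W f < \<infinity>" using fin by simp
  define b where "b t = B * (dist (u (max 0 t)) (u 0))\<^sup>2 + Q (u 0)" for t
  interpret W: prob_space ?W by (rule prob_space_wed_measure[OF eps])
  have b: "integrable ?W b" unfolding b_def using dist_square_integrable(1)[OF g(1) sq] by simp
  have b0: "0 \<le> b t" for t using B_nonneg Q_nonneg by (simp add: b_def)
  have fb: "ereal (- b t) \<le> f t" for t
  proof -
    have "ereal (- b t) \<le> 0 + \<phi> (u (max 0 t))" using coercive_Q[of "u (max 0 t)" "u 0"] by (simp add: b_def)
    also have "\<dots> \<le> f t" unfolding f_def using eps by (intro add_right_mono) simp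
    finally show ?thesis .
  qed
  have "(\<integral>\<^sup>+t. e2ennreal (- f t) \<partial>?W) \<le> (\<integral>\<^sup>+t. ennreal (b t) \<partial>?W)"
  proof (rule nn_integral_mono)
    fix t
    have "- f t \<le> ereal (b t)" using fb[of t] by (cases "f t") auto
    then have "e2ennreal (- f t) \<le> e2ennreal (ereal (b t))" by (rule e2ennreal_mono)
    then show "e2ennreal (- f t) \<le> ennreal (b t)" by simp
  qed
  also have "\<dots> < \<infinity>" using nn_integral_eq_integral[OF b] b0 by simp
  finally have neg: "(\<integral>\<^sup>+t. e2ennreal (- f t) \<partial>?W) < \<infinity>" .
  note f = ereal_integral_finite[OF fm neg ffin]
  have "finite_curve u g"
  proof (rule finite_curveI[OF g sq])
    show "AE t in ?W. \<phi> (u t) = ereal (real_of_ereal (f t) - \<epsilon> / 2 * (g t)\<^sup>2)"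
      using f(1) AE_wed_pos
    proof eventually_elim
      case (elim t)
      then show ?case unfolding f_def by (cases "\<phi> (u t)") auto
    qed
    show "integrable ?W (\<lambda>t. real_of_ereal (f t) - \<epsilon> / 2 * (g t)\<^sup>2)" using f(2) sq by simp
  qed
  then show ?thesis using that ux by blast
qed

text \<open>By the Hardy inequality the quadratic decay of \<open>\<phi>\<close> uses up at most half of the kinetic term. Hence
nearly minimising curves have bounded kinetic energy and the value function is locally bounded below.\<close>

lemma energy_lower_bound:
  assumes u: "finite_curve u g"
  shows "\<epsilon> / 4 * (\<integral>t. (g t)\<^sup>2 \<partial>\<mu>) - Q (u 0) \<le> energy u g"
proof -
  let ?W = \<mu>
  interpret W: prob_space ?W by (rule prob_space_wed_measure[OF eps])
  define G where "G = (\<integral>t. (g t)\<^sup>2 \<partial>?W)"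
  have G0: "0 \<le> G" unfolding G_def by (rule Bochner_Integration.integral_nonneg) simp
  note d = dist_square_integrable[OF finite_curve_speed[OF u] finite_curve_square[OF u], folded G_def]
  have "(\<integral>t. - B * (dist (u (max 0 t)) (u 0))\<^sup>2 - Q (u 0) \<partial>?W) \<le> (\<integral>t. potential u t \<partial>?W)"
  proof (rule integral_mono_AE)
    show "AE t in ?W. - B * (dist (u (max 0 t)) (u 0))\<^sup>2 - Q (u 0) \<le> potential u t"
      using finite_curve_AE[OF u] AE_wed_pos
    proof eventually_elim
      case (elim t)
      then show ?case using coercive_Q[of "u t" "u 0"] by simp
    qed
    show "integrable ?W (\<lambda>t. - B * (dist (u (max 0 t)) (u 0))\<^sup>2 - Q (u 0))" using d(1) by simp
  qed (rule finite_curve_potential[OF u])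
  also have "(\<integral>t. - B * (dist (u (max 0 t)) (u 0))\<^sup>2 - Q (u 0) \<partial>?W) =
      - B * (\<integral>t. (dist (u (max 0 t)) (u 0))\<^sup>2 \<partial>?W) - Q (u 0)"
    using d(1) W.prob_space by simp
  finally have 1: "- B * (\<integral>t. (dist (u (max 0 t)) (u 0))\<^sup>2 \<partial>?W) - Q (u 0) \<le> (\<integral>t. potential u t \<partial>?W)" .
  have 2: "B * (\<integral>t. (dist (u (max 0 t)) (u 0))\<^sup>2 \<partial>?W) \<le> B * (4 * \<epsilon>\<^sup>2 * G)"
    by (rule mult_left_mono[OF d(2) B_nonneg])
  have 3: "B * (4 * \<epsilon>\<^sup>2 * G) \<le> 1 / (16 * \<epsilon>) * (4 * \<epsilon>\<^sup>2 * G)"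
    using B_small G0 by (intro mult_right_mono) auto
  have 4: "1 / (16 * \<epsilon>) * (4 * \<epsilon>\<^sup>2 * G) = \<epsilon> / 4 * G" using eps by (simp add: power2_eq_square)
  have "energy u g = \<epsilon> / 2 * G + (\<integral>t. potential u t \<partial>?W)"
    unfolding energy_def G_def using finite_curve_square[OF u] finite_curve_potential[OF u] by simp
  with 1 2 3 4 show ?thesis unfolding G_def[symmetric] by linarith
qed

lemma value_fun_lower_bound: "ereal (- Q x) \<le> value_fun \<epsilon> \<phi> x"
  unfolding value_fun_def
proof (rule INF_greatest)
  fix u assume u: "u \<in> wed_curves \<epsilon> x"
  show "ereal (- Q x) \<le> wed_functional \<epsilon> \<phi> u"
  proof (cases "wed_functional \<epsilon> \<phi> u < \<infinity>")
    case True
    obtain g where g: "finite_curve u g" "u 0 = x" by (rule wed_curves_finite[OF u True])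
    have "0 \<le> \<epsilon> / 4 * (\<integral>t. (g t)\<^sup>2 \<partial>\<mu>)"
      using eps by (intro mult_nonneg_nonneg Bochner_Integration.integral_nonneg) auto
    then show ?thesis
      using energy_lower_bound[OF g(1)] g(2) by (simp add: wed_functional_eq_energy[OF g(1)])
  qed auto
qed

lemma near_minimiser:
  assumes "value_fun \<epsilon> \<phi> x < ereal c"
  obtains u g where "finite_curve u g" "u 0 = x" "energy u g < c"
proof -
  obtain u where u: "u \<in> wed_curves \<epsilon> x" "wed_functional \<epsilon> \<phi> u < ereal c"
    using assms unfolding value_fun_def INF_less_iff by blast
  have "wed_functional \<epsilon> \<phi> u < \<infinity>" by (rule less_trans[OF u(2)]) simp
  then obtain g where g: "finite_curve u g" "u 0 = x" using wed_curves_finite[OF u(1)] by blast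
  then show ?thesis using that[OF g] u(2) by (simp add: wed_functional_eq_energy[OF g(1)])
qed

lemma value_fun_le_phi: "value_fun \<epsilon> \<phi> x \<le> \<phi> x"
proof (cases "\<phi> x")
  case (real r)
  interpret W: prob_space \<mu> by (rule prob_space_wed_measure[OF eps])
  have c: "finite_curve (\<lambda>_. x) (\<lambda>_. 0)"
  proof (rule finite_curveI[where q = "\<lambda>_. r"])
    show "metric_speed (\<lambda>_. x) (\<lambda>_. 0)"
      unfolding metric_speed_def by (simp add: set_integrable_def set_lebesgue_integral_def)
    show "AE t in lborel. 0 < t \<longrightarrow> metric_deriv (\<lambda>_. x) t = 0"
      by (intro AE_I2 impI metric_deriv_eqI) simp_all
  qed (simp_all add: real)
  have "energy (\<lambda>_. x) (\<lambda>_. 0) = r"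
    unfolding energy_def potential_def using W.prob_space by (simp add: real)
  then show ?thesis using value_fun_le_energy[OF c] by (simp add: real)
qed (use phi_not_MInf in auto)


lemma finite_curve_shift:
  assumes u: "finite_curve u g" and t: "0 \<le> t"
  shows "finite_curve (\<lambda>r. u (t + r)) (\<lambda>r. g (t + r))"
proof (rule finite_curveI[where q = "\<lambda>r. potential u (t + r)"])
  note s = finite_curve_speed[OF u]
  have [measurable]: "g \<in> borel_measurable borel" by (rule metric_speed_measurable[OF s])
  show "metric_speed (\<lambda>r. u (t + r)) (\<lambda>r. g (t + r))" by (rule metric_speed_shift[OF s t])
  show "AE r in lborel. 0 < r \<longrightarrow> metric_deriv (\<lambda>r. u (t + r)) r = g (t + r)"
    using AE_lborel_translate[OF finite_curve_deriv[OF u], of t]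
    by eventually_elim (use t in \<open>simp add: metric_deriv_shift\<close>)
  show "integrable \<mu> (\<lambda>r. (g (t + r))\<^sup>2)"
    using wed_measure_split(1)[OF eps _ t, of "\<lambda>r. (g r)\<^sup>2"] finite_curve_square[OF u] by simp
  show "integrable \<mu> (\<lambda>r. potential u (t + r))"
    using wed_measure_split(1)[OF eps potential_measurable[OF s] t] finite_curve_potential[OF u] by simp
  have "AE r in lborel. 0 < r \<longrightarrow> \<phi> (u r) = ereal (potential u r)"
    using finite_curve_AE[OF u] unfolding AE_wed_measure[OF eps] .
  from AE_lborel_translate[OF this, of t]
  show "AE r in \<mu>. \<phi> (u (t + r)) = ereal (potential u (t + r))"
    unfolding AE_wed_measure[OF eps] by eventually_elim (use t in simp)
qed

lemma energy_cong:
  assumes u: "finite_curve u g" and v: "finite_curve v h"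
    and eq: "AE t in \<mu>. (g t)\<^sup>2 = (h t)\<^sup>2" "\<And>t. 0 < t \<Longrightarrow> u t = v t"
  shows "energy u g = energy v h"
  unfolding energy_def
proof (rule integral_cong_AE)
  show "AE t in \<mu>. \<epsilon> / 2 * (g t)\<^sup>2 + potential u t = \<epsilon> / 2 * (h t)\<^sup>2 + potential v t"
    using eq(1) AE_wed_pos by eventually_elim (simp add: potential_def eq(2))
qed (use finite_curve_square[OF u] finite_curve_potential[OF u] finite_curve_square[OF v] finite_curve_potential[OF v]
      in \<open>auto dest!: borel_measurable_integrable\<close>)

lemma energy_split:
  assumes u: "finite_curve u g" and t: "0 \<le> t"
  shows "set_integrable lborel {0..t} (\<lambda>r. weight r * (\<epsilon> / 2 * (g r)\<^sup>2 + potential u r))"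
    and "energy u g = (LBINT r:{0..t}. weight r * (\<epsilon> / 2 * (g r)\<^sup>2 + potential u r))
       + exp (- t / \<epsilon>) * energy (\<lambda>r. u (t + r)) (\<lambda>r. g (t + r))"
proof -
  note s = finite_curve_speed[OF u]
  have [measurable]: "g \<in> borel_measurable borel" by (rule metric_speed_measurable[OF s])
  have [measurable]: "potential u \<in> borel_measurable borel" by (rule potential_measurable[OF s])
  have [measurable]: "potential (\<lambda>r. u (t + r)) \<in> borel_measurable borel"
    by (rule potential_measurable[OF metric_speed_shift[OF s t]])
  have fm: "(\<lambda>r. \<epsilon> / 2 * (g r)\<^sup>2 + potential u r) \<in> borel_measurable borel" by measurable
  have fi: "integrable \<mu> (\<lambda>r. \<epsilon> / 2 * (g r)\<^sup>2 + potential u r)"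
    using finite_curve_square[OF u] finite_curve_potential[OF u] by simp
  note sp = wed_measure_split[OF eps fm t]
  show "set_integrable lborel {0..t} (\<lambda>r. weight r * (\<epsilon> / 2 * (g r)\<^sup>2 + potential u r))"
    using iffD1[OF sp(1) fi] by blast
  have "(\<integral>r. \<epsilon> / 2 * (g (t + r))\<^sup>2 + potential u (t + r) \<partial>\<mu>) = energy (\<lambda>r. u (t + r)) (\<lambda>r. g (t + r))"
    unfolding energy_def
  proof (rule integral_cong_AE)
    show "AE r in \<mu>. \<epsilon> / 2 * (g (t + r))\<^sup>2 + potential u (t + r) = \<epsilon> / 2 * (g (t + r))\<^sup>2 + potential (\<lambda>r. u (t + r)) r"
      using AE_wed_pos by eventually_elim (use t in \<open>simp add: potential_def\<close>)
  qed simp_all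
  then show "energy u g = (LBINT r:{0..t}. weight r * (\<epsilon> / 2 * (g r)\<^sup>2 + potential u r))
       + exp (- t / \<epsilon>) * energy (\<lambda>r. u (t + r)) (\<lambda>r. g (t + r))"
    using sp(2)[OF fi] unfolding energy_def[of u g] by simp
qed

lemma finite_curve_concat:
  assumes v: "finite_curve v g" and \<gamma>: "geodesic \<gamma>" "\<gamma> 1 = v 0" and s: "0 < s"
    and bound: "\<And>\<tau>. 0 \<le> \<tau> \<Longrightarrow> \<tau> \<le> 1 \<Longrightarrow> \<phi> (\<gamma> \<tau>) \<le> ereal C"
  defines "w \<equiv> \<lambda>t. if t \<le> s then \<gamma> (t / s) else v (t - s)"
    and "h \<equiv> \<lambda>t. if t \<le> s then dist (\<gamma> 0) (\<gamma> 1) / s else g (t - s)"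
  shows "finite_curve w h"
    and "energy w h = (LBINT r:{0..s}. weight r * (\<epsilon> / 2 * (dist (\<gamma> 0) (\<gamma> 1) / s)\<^sup>2
       + real_of_ereal (\<phi> (\<gamma> (r / s))))) + exp (- s / \<epsilon>) * energy v g"
proof -
  define D where "D = dist (\<gamma> 0) (\<gamma> 1)"
  note vs = finite_curve_speed[OF v]
  have ws: "metric_speed w h"
    unfolding w_def h_def by (rule metric_speed_concat[OF vs \<gamma> s])
  have [measurable]: "g \<in> borel_measurable borel" by (rule metric_speed_measurable[OF vs])
  have hm[measurable]: "h \<in> borel_measurable borel" by (rule metric_speed_measurable[OF ws])
  have pm[measurable]: "potential w \<in> borel_measurable borel" by (rule potential_measurable[OF ws])
  have w_left: "w r = \<gamma> (r / s)" if "r \<le> s" for r using that by (simp add: w_def)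
  have w_right: "w (s + r) = v r" if "0 \<le> r" for r
    using that s \<gamma>(2) by (cases "r = 0") (auto simp: w_def)
  have h_right: "h (s + r) = g r" if "0 < r" for r using that by (simp add: h_def)
  have phi_\<gamma>: "\<phi> (\<gamma> \<tau>) = ereal (real_of_ereal (\<phi> (\<gamma> \<tau>)))" "real_of_ereal (\<phi> (\<gamma> \<tau>)) \<le> C"
     "- (B * D\<^sup>2 + Q (\<gamma> 0)) \<le> real_of_ereal (\<phi> (\<gamma> \<tau>))" if \<tau>: "0 \<le> \<tau>" "\<tau> \<le> 1" for \<tau>
  proof -
    have "\<phi> (\<gamma> \<tau>) \<noteq> \<infinity>" using bound[OF \<tau>] by auto
    then show eq: "\<phi> (\<gamma> \<tau>) = ereal (real_of_ereal (\<phi> (\<gamma> \<tau>)))"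
      using phi_not_MInf[of "\<gamma> \<tau>"] by (cases "\<phi> (\<gamma> \<tau>)") auto
    show "real_of_ereal (\<phi> (\<gamma> \<tau>)) \<le> C" using bound[OF \<tau>] eq by (metis ereal_less_eq(3))
    have "dist (\<gamma> \<tau>) (\<gamma> 0) = \<tau> * D" using geodesicD[OF \<gamma>(1) \<tau>, of 0] \<tau> by (simp add: D_def)
    also have "\<dots> \<le> 1 * D" using \<tau> by (intro mult_right_mono) (auto simp: D_def)
    finally have "(dist (\<gamma> \<tau>) (\<gamma> 0))\<^sup>2 \<le> D\<^sup>2" by (intro power_mono) auto
    then have "B * (dist (\<gamma> \<tau>) (\<gamma> 0))\<^sup>2 \<le> B * D\<^sup>2" using B_nonneg by (rule mult_left_mono)
    moreover have "- B * (dist (\<gamma> \<tau>) (\<gamma> 0))\<^sup>2 - Q (\<gamma> 0) \<le> real_of_ereal (\<phi> (\<gamma> \<tau>))"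
      using coercive_Q[of "\<gamma> \<tau>" "\<gamma> 0"] eq by (metis ereal_less_eq(3))
    ultimately show "- (B * D\<^sup>2 + Q (\<gamma> 0)) \<le> real_of_ereal (\<phi> (\<gamma> \<tau>))" by simp
  qed
  have unit: "0 \<le> r / s" "r / s \<le> 1" if "0 \<le> r" "r \<le> s" for r using that s by auto
  define M where "M = \<bar>C\<bar> + \<bar>B * D\<^sup>2 + Q (\<gamma> 0)\<bar>"
  have pb: "\<bar>potential w r\<bar> \<le> M" if r: "0 \<le> r" "r \<le> s" for r
  proof -
    have "potential w r = real_of_ereal (\<phi> (\<gamma> (r / s)))" using r by (simp add: potential_def w_left)
    then show ?thesis using phi_\<gamma>(2,3)[OF unit[OF r]] unfolding M_def by linarith
  qed
  have kpot: "set_integrable lborel {0..s} (\<lambda>r. weight r * potential w r)"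
  proof (rule set_integrable_bound)
    show "set_integrable lborel {0..s} (\<lambda>_. 1 / \<epsilon> * M)" by (rule set_integrable_const_Icc)
    show "AE r in lborel. r \<in> {0..s} \<longrightarrow> norm (weight r * potential w r) \<le> norm (1 / \<epsilon> * M)"
    proof (intro AE_I2 impI)
      fix r assume "r \<in> {0..s}"
      then have r: "0 \<le> r" "r \<le> s" by auto
      have "1 / \<epsilon> * (exp (- r / \<epsilon>) * \<bar>potential w r\<bar>) \<le> 1 / \<epsilon> * (1 * M)"
        using eps r pb[OF r] by (intro mult_left_mono mult_mono) auto
      then show "norm (weight r * potential w r) \<le> norm (1 / \<epsilon> * M)"
        using eps by (simp add: abs_mult M_def)
    qed
  qed (simp add: set_borel_measurable_def)
  have ksq: "set_integrable lborel {0..s} (\<lambda>r. weight r * (h r)\<^sup>2)"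
  proof -
    have "set_integrable lborel {0..s} (\<lambda>r. weight r * (D / s)\<^sup>2)"
      by (rule borel_integrable_atLeastAtMost') (use eps in \<open>intro continuous_intros, auto\<close>)
    then show ?thesis
      by (rule set_integrable_cong[THEN iffD1, OF refl refl, rotated]) (simp add: h_def D_def)
  qed
  have sq: "integrable \<mu> (\<lambda>r. (h (s + r))\<^sup>2)"
    using finite_curve_square[OF v]
  proof (rule Bochner_Integration.integrable_cong_AE_imp)
    show "AE r in \<mu>. (g r)\<^sup>2 = (h (s + r))\<^sup>2"
      using AE_wed_pos by eventually_elim (simp add: h_right)
  qed simp
  have pot: "integrable \<mu> (\<lambda>r. potential w (s + r))"
    using finite_curve_potential[OF v]
  proof (rule Bochner_Integration.integrable_cong_AE_imp)
    show "AE r in \<mu>. potential v r = potential w (s + r)"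
      using AE_wed_pos by eventually_elim (use s in \<open>simp add: potential_def w_right\<close>)
  qed simp
  show w: "finite_curve w h"
  proof (rule finite_curveI[OF ws, where q = "potential w"])
    show "AE t in lborel. 0 < t \<longrightarrow> metric_deriv w t = h t"
      using AE_lborel_translate[OF finite_curve_deriv[OF v], of "- s"] AE_lborel_singleton[of s]
    proof eventually_elim
      case (elim t)
      show ?case
      proof (intro impI)
        assume t: "0 < t"
        show "metric_deriv w t = h t"
        proof (cases "t < s")
          case True
          then show ?thesis using metric_deriv_geodesic[OF \<gamma>(1) s t True, of w] w_left by (simp add: h_def)
        next
          case False
          then have ts: "0 < - s + t" using elim by simp
          have "metric_deriv w (s + (- s + t)) = metric_deriv (\<lambda>r. w (s + r)) (- s + t)"
            by (rule metric_deriv_shift[symmetric]) (use s ts in auto)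
          also have "\<dots> = metric_deriv v (- s + t)"
            by (rule metric_deriv_cong) (use w_right ts in auto)
          also have "\<dots> = g (- s + t)" using elim ts by simp
          finally show ?thesis using ts by (simp add: h_def)
        qed
      qed
    qed
    show "integrable \<mu> (\<lambda>t. (h t)\<^sup>2)"
      by (rule iffD2[OF wed_measure_split(1)[OF eps _ less_imp_le[OF s]]]) (use ksq sq in auto)
    show "integrable \<mu> (potential w)"
      by (rule iffD2[OF wed_measure_split(1)[OF eps pm less_imp_le[OF s]]]) (use kpot pot in auto)
    have "AE r in lborel. 0 < r \<longrightarrow> \<phi> (v r) = ereal (potential v r)"
      using finite_curve_AE[OF v] unfolding AE_wed_measure[OF eps] .
    from AE_lborel_translate[OF this, of "- s"] AE_lborel_singleton[of s]
    show "AE t in \<mu>. \<phi> (w t) = ereal (potential w t)"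
      unfolding AE_wed_measure[OF eps]
    proof eventually_elim
      case (elim t)
      show ?case
      proof (intro impI)
        assume t: "0 < t"
        show "\<phi> (w t) = ereal (potential w t)"
        proof (cases "t < s")
          case True
          then show ?thesis using phi_\<gamma>(1)[OF unit[of t]] t by (simp add: potential_def w_left)
        next
          case False
          then have ts: "0 < - s + t" using elim by simp
          then have "w t = v (- s + t)" using w_right[of "- s + t"] by simp
          then show ?thesis using elim ts t by (simp add: potential_def)
        qed
      qed
    qed
  qed
  have "energy (\<lambda>r. w (s + r)) (\<lambda>r. h (s + r)) = energy v g"
  proof (rule energy_cong[OF finite_curve_shift[OF w less_imp_le[OF s]] v])
    show "AE r in \<mu>. (h (s + r))\<^sup>2 = (g r)\<^sup>2"
      using AE_wed_pos by eventually_elim (simp add: h_right)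
  qed (simp add: w_right)
  moreover have "(LBINT r:{0..s}. weight r * (\<epsilon> / 2 * (h r)\<^sup>2 + potential w r)) =
     (LBINT r:{0..s}. weight r * (\<epsilon> / 2 * (dist (\<gamma> 0) (\<gamma> 1) / s)\<^sup>2
       + real_of_ereal (\<phi> (\<gamma> (r / s)))))"
    by (rule set_lebesgue_integral_cong) (auto simp: h_def potential_def w_left)
  ultimately show "energy w h = (LBINT r:{0..s}. weight r * (\<epsilon> / 2 * (dist (\<gamma> 0) (\<gamma> 1) / s)\<^sup>2
       + real_of_ereal (\<phi> (\<gamma> (r / s))))) + exp (- s / \<epsilon>) * energy v g"
    using energy_split(2)[OF w less_imp_le[OF s]] by simp
qed

end

section \<open>Two bounds for differences of the value function\<close>

text \<open>Cauchy--Schwarz, by expanding the integral of the square of \<open>g\<close> minus its mean \<open>I / t\<close>.\<close>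

lemma dist_square_le_energy:
  assumes u: "metric_speed u g" and t: "0 < t"
  shows "(dist (u 0) (u t))\<^sup>2 \<le> t * (LBINT r:{0..t}. (g r)\<^sup>2)"
proof -
  define I J where "I = (LBINT r:{0..t}. g r)" and "J = (LBINT r:{0..t}. (g r)\<^sup>2)"
  have gi: "set_integrable lborel {0..t} g" by (rule metric_speed_integrable[OF u]) simp
  have g2: "set_integrable lborel {0..t} (\<lambda>r. (g r)\<^sup>2)" by (rule metric_speed_square_integrable[OF u])
  have "0 \<le> (LBINT r:{0..t}. (g r - I / t)\<^sup>2)"
    unfolding set_lebesgue_integral_def by (intro Bochner_Integration.integral_nonneg) simp
  also have "\<dots> = (LBINT r:{0..t}. (g r)\<^sup>2 + ((- 2 * (I / t)) * g r + (I / t)\<^sup>2))"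
    by (rule set_lebesgue_integral_cong) (auto simp: power2_eq_square algebra_simps)
  also have "\<dots> = J + ((- 2 * (I / t)) * I + (I / t)\<^sup>2 * t)"
    using gi g2 t set_integrable_const_Icc[of 0 t "(I / t)\<^sup>2"]
    by (simp add: set_integral_add set_integral_const I_def J_def)
  also have "\<dots> = J - I\<^sup>2 / t" using t by (simp add: power2_eq_square)
  finally have "I\<^sup>2 \<le> t * J" using t by (simp add: field_simps)
  moreover have "(dist (u 0) (u t))\<^sup>2 \<le> I\<^sup>2"
    unfolding I_def using metric_speed_dist_le[OF u order.refl less_imp_le[OF t]] by (intro power_mono) auto
  ultimately show ?thesis unfolding J_def by simp
qed

context wed_setting begin

text \<open>The value function as a real function; it takes the meaningless value \<open>0\<close> where the value function is
infinite.\<close>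

definition Vr :: "'a \<Rightarrow> real" where "Vr x = real_of_ereal (value_fun \<epsilon> \<phi> x)"

lemma Vr_le: "value_fun \<epsilon> \<phi> x \<le> ereal c \<Longrightarrow> Vr x \<le> c"
  using value_fun_lower_bound[of x] unfolding Vr_def by (cases "value_fun \<epsilon> \<phi> x") auto

lemma Vr_ge: "- Q x \<le> Vr x"
  using value_fun_lower_bound[of x] Q_nonneg[of x] unfolding Vr_def by (cases "value_fun \<epsilon> \<phi> x") auto

lemma value_fun_eq_Vr:
  assumes "\<phi> x = ereal P"
  shows "value_fun \<epsilon> \<phi> x = ereal (Vr x)" and "Vr x \<le> P" and "- Q x \<le> Vr x"
proof -
  have *: "ereal (- Q x) \<le> value_fun \<epsilon> \<phi> x" "value_fun \<epsilon> \<phi> x \<le> ereal P"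
    using value_fun_lower_bound[of x] value_fun_le_phi[of x] assms by auto
  then show "value_fun \<epsilon> \<phi> x = ereal (Vr x)" unfolding Vr_def by (cases "value_fun \<epsilon> \<phi> x") auto
  with * show "Vr x \<le> P" "- Q x \<le> Vr x" by auto
qed

lemma dynamic_programming:
  assumes u: "finite_curve u g" and t: "0 \<le> t"
  shows "(LBINT r:{0..t}. weight r * (\<epsilon> / 2 * (g r)\<^sup>2 + potential u r))
      + exp (- t / \<epsilon>) * Vr (u t) \<le> energy u g"
proof -
  have "Vr (u t) \<le> energy (\<lambda>r. u (t + r)) (\<lambda>r. g (t + r))"
    using value_fun_le_energy[OF finite_curve_shift[OF u t]] by (intro Vr_le) simp
  then show ?thesis unfolding energy_split(2)[OF u t] by simp
qed

lemma weighted_affine_integral: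
  assumes s: "0 \<le> s"
  shows "set_integrable lborel {0..s} (\<lambda>r. weight r * c + r * e)"
    and "(LBINT r:{0..s}. weight r * c + r * e) = (1 - exp (- s / \<epsilon>)) * c + s\<^sup>2 / 2 * e"
proof -
  show "set_integrable lborel {0..s} (\<lambda>r. weight r * c + r * e)"
    by (rule borel_integrable_atLeastAtMost') (use eps in \<open>intro continuous_intros, auto\<close>)
  have "(\<integral>r. (weight r * c + r * e) * indicator {0..s} r \<partial>lborel) =
      (- exp (- s / \<epsilon>) * c + s\<^sup>2 / 2 * e) - (- exp (- 0 / \<epsilon>) * c + 0\<^sup>2 / 2 * e)"
    by (rule integral_FTC_Icc_real[OF s]) (use eps in \<open>auto intro!: derivative_eq_intros continuous_intros simp: field_simps\<close>)
  then show "(LBINT r:{0..s}. weight r * c + r * e) = (1 - exp (- s / \<epsilon>)) * c + s\<^sup>2 / 2 * e"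
    by (simp add: set_lebesgue_integral_def mult.commute algebra_simps)
qed

text \<open>The upper bound: travel from \<open>x\<close> to \<open>y\<close> along a geodesic in time \<open>s\<close> and go on from \<open>y\<close> nearly
optimally. On the way \<open>\<phi>\<close> is at most its linear interpolation plus a multiple of \<open>(dist x y)\<^sup>2\<close>. As the
fraction \<open>r / s\<close> of the way has mean \<open>1 / 2\<close> on \<open>[0, s]\<close>, an excess of \<open>\<phi> y\<close> over \<open>\<phi> x\<close> only enters with the factor
\<open>1 / 2\<close>; this factor is decisive for the convergence of \<open>\<phi>\<close> below.\<close>

lemma geodesic_competitor:
  assumes x: "\<phi> x = ereal Px" and y: "\<phi> y = ereal Py" and s: "0 < s"
  shows "Vr x \<le> (1 - exp (- s / \<epsilon>)) * (\<epsilon> * (dist x y)\<^sup>2 / (2 * s\<^sup>2) + Px + \<bar>l\<bar> * (dist x y)\<^sup>2)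
     + s / (2 * \<epsilon>) * max 0 (Py - Px) + exp (- s / \<epsilon>) * Vr y"
proof (rule field_le_epsilon)
  fix e :: real assume "0 < e"
  define D where "D = dist x y"
  have "x \<in> eff_dom \<phi>" "y \<in> eff_dom \<phi>" using x y by (auto simp: eff_dom_def)
  then obtain \<gamma> where \<gamma>: "geodesic \<gamma>" "\<gamma> 0 = x" "\<gamma> 1 = y"
    and conv: "\<forall>t\<in>{0..1}. \<phi> (\<gamma> t) \<le> ereal (1 - t) * \<phi> x + ereal t * \<phi> y - ereal (l / 2 * t * (1 - t) * (dist x y)\<^sup>2)"
    using convex unfolding geodesically_convex_def by blast
  have bnd: "\<phi> (\<gamma> \<tau>) \<le> ereal (Px + \<bar>l\<bar> * D\<^sup>2 + \<tau> * max 0 (Py - Px))" if \<tau>: "0 \<le> \<tau>" "\<tau> \<le> 1" for \<tau>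
  proof -
    have "\<tau> \<in> {0..1}" using \<tau> by simp
    then have "\<phi> (\<gamma> \<tau>) \<le> ereal ((1 - \<tau>) * Px + \<tau> * Py - l / 2 * \<tau> * (1 - \<tau>) * D\<^sup>2)"
      using conv x y unfolding D_def by fastforce
    also have "(1 - \<tau>) * Px + \<tau> * Py - l / 2 * \<tau> * (1 - \<tau>) * D\<^sup>2 \<le> Px + \<bar>l\<bar> * D\<^sup>2 + \<tau> * max 0 (Py - Px)"
    proof -
      have 1: "\<tau> * (Py - Px) \<le> \<tau> * max 0 (Py - Px)" using \<tau> by (intro mult_left_mono) auto
      have "\<tau> * (1 - \<tau>) \<le> 1 * 1" using \<tau> by (intro mult_mono) auto
      then have 2: "(- l / 2 * D\<^sup>2) * (\<tau> * (1 - \<tau>)) \<le> \<bar>l\<bar> * D\<^sup>2"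
      proof -
        have "(- l / 2 * D\<^sup>2) * (\<tau> * (1 - \<tau>)) \<le> (\<bar>l\<bar> * D\<^sup>2) * (\<tau> * (1 - \<tau>))"
          using \<tau> by (intro mult_right_mono) auto
        also have "\<dots> \<le> (\<bar>l\<bar> * D\<^sup>2) * (1 * 1)"
          using \<open>\<tau> * (1 - \<tau>) \<le> 1 * 1\<close> by (intro mult_left_mono) auto
        finally show ?thesis by simp
      qed
      have "(1 - \<tau>) * Px + \<tau> * Py - l / 2 * \<tau> * (1 - \<tau>) * D\<^sup>2 = Px + \<tau> * (Py - Px) + (- l / 2 * D\<^sup>2) * (\<tau> * (1 - \<tau>))"
        by (simp add: algebra_simps)
      then show ?thesis using 1 2 by linarith
    qed
    finally show ?thesis by simp
  qed
  have bnd': "\<phi> (\<gamma> \<tau>) \<le> ereal (Px + \<bar>l\<bar> * D\<^sup>2 + max 0 (Py - Px))" if \<tau>: "0 \<le> \<tau>" "\<tau> \<le> 1" for \<tau>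
  proof -
    have "\<tau> * max 0 (Py - Px) \<le> 1 * max 0 (Py - Px)" using \<tau> by (intro mult_right_mono) auto
    then show ?thesis using bnd[OF \<tau>] by (elim order_trans) simp
  qed
  have "value_fun \<epsilon> \<phi> y < ereal (Vr y + e)" using value_fun_eq_Vr(1)[OF y] \<open>0 < e\<close> by simp
  then obtain v g where v: "finite_curve v g" "v 0 = y" "energy v g < Vr y + e" by (rule near_minimiser)
  define w h where "w = (\<lambda>t. if t \<le> s then \<gamma> (t / s) else v (t - s))"
    and "h = (\<lambda>t. if t \<le> s then dist (\<gamma> 0) (\<gamma> 1) / s else g (t - s))"
  have \<gamma>v: "\<gamma> 1 = v 0" using \<gamma> v by simp
  note cc = finite_curve_concat[OF v(1) \<gamma>(1) \<gamma>v s bnd', folded w_def h_def]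
  have w: "finite_curve w h" by (rule cc(1))
  have ew: "energy w h = (LBINT r:{0..s}. weight r * (\<epsilon> / 2 * (D / s)\<^sup>2
       + real_of_ereal (\<phi> (\<gamma> (r / s))))) + exp (- s / \<epsilon>) * energy v g"
    using cc(2) \<gamma> by (simp add: D_def)
  have w0: "w 0 = x" using s \<gamma> by (simp add: w_def)
  define C where "C = \<epsilon> * D\<^sup>2 / (2 * s\<^sup>2) + Px + \<bar>l\<bar> * D\<^sup>2"
  define m where "m = max 0 (Py - Px) / (s * \<epsilon>)"
  have hw: "h r = D / s" "potential w r = real_of_ereal (\<phi> (\<gamma> (r / s)))" if "0 \<le> r" "r \<le> s" for r
    using that \<gamma> by (auto simp: h_def w_def D_def potential_def)
  have "(LBINT r:{0..s}. weight r * (\<epsilon> / 2 * (D / s)\<^sup>2 + real_of_ereal (\<phi> (\<gamma> (r / s)))))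
     \<le> (LBINT r:{0..s}. weight r * C + r * m)"
  proof (rule set_integral_mono)
    show "set_integrable lborel {0..s} (\<lambda>r. weight r * (\<epsilon> / 2 * (D / s)\<^sup>2 + real_of_ereal (\<phi> (\<gamma> (r / s)))))"
      by (rule set_integrable_cong[THEN iffD1, OF refl refl _ energy_split(1)[OF w less_imp_le[OF s]]])
        (simp add: hw)
    show "set_integrable lborel {0..s} (\<lambda>r. weight r * C + r * m)"
      by (rule weighted_affine_integral) (use s in simp)
    fix r assume "r \<in> {0..s}"
    then have r: "0 \<le> r / s" "r / s \<le> 1" "0 \<le> r" using s by auto
    have "\<phi> (\<gamma> (r / s)) \<noteq> \<infinity>" using bnd[OF r(1,2)] by auto
    then have "real_of_ereal (\<phi> (\<gamma> (r / s))) \<le> Px + \<bar>l\<bar> * D\<^sup>2 + r / s * max 0 (Py - Px)"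
      using bnd[OF r(1,2)] phi_not_MInf[of "\<gamma> (r / s)"] by (cases "\<phi> (\<gamma> (r / s))") auto
    then have "\<epsilon> / 2 * (D / s)\<^sup>2 + real_of_ereal (\<phi> (\<gamma> (r / s))) \<le> C + r / s * max 0 (Py - Px)"
      unfolding C_def by (simp add: power_divide)
    then have "weight r * (\<epsilon> / 2 * (D / s)\<^sup>2 + real_of_ereal (\<phi> (\<gamma> (r / s))))
      \<le> weight r * (C + r / s * max 0 (Py - Px))"
      using eps by (intro mult_left_mono) auto
    also have "\<dots> = weight r * C + exp (- r / \<epsilon>) * (r * m)"
      using eps s by (simp add: m_def field_simps)
    also have "exp (- r / \<epsilon>) * (r * m) \<le> 1 * (r * m)"
      using r eps s by (intro mult_right_mono) (auto simp: m_def)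
    finally show "weight r * (\<epsilon> / 2 * (D / s)\<^sup>2 + real_of_ereal (\<phi> (\<gamma> (r / s))))
      \<le> weight r * C + r * m" by simp
  qed
  also have "\<dots> = (1 - exp (- s / \<epsilon>)) * C + s / (2 * \<epsilon>) * max 0 (Py - Px)"
    unfolding weighted_affine_integral(2)[OF less_imp_le[OF s]] using s eps by (simp add: m_def power2_eq_square)
  finally have "energy w h \<le> (1 - exp (- s / \<epsilon>)) * C + s / (2 * \<epsilon>) * max 0 (Py - Px) + exp (- s / \<epsilon>) * energy v g"
    unfolding ew by simp
  moreover have "exp (- s / \<epsilon>) * energy v g \<le> exp (- s / \<epsilon>) * (Vr y + e)"
    using v(3) by (intro mult_left_mono) auto
  moreover have "exp (- s / \<epsilon>) * e \<le> 1 * e" using \<open>0 < e\<close> s eps by (intro mult_right_mono) auto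
  moreover have "Vr x \<le> energy w h" using value_fun_le_energy[OF w] w0 by (intro Vr_le) simp
  ultimately show "Vr x \<le> (1 - exp (- s / \<epsilon>)) * (\<epsilon> * (dist x y)\<^sup>2 / (2 * s\<^sup>2) + Px + \<bar>l\<bar> * (dist x y)\<^sup>2)
     + s / (2 * \<epsilon>) * max 0 (Py - Px) + exp (- s / \<epsilon>) * Vr y + e"
    unfolding C_def D_def[symmetric] by (simp add: distrib_left)
qed

lemma Q_bound:
  assumes "dist x y \<le> 1"
  shows "Q y \<le> B * (dist x ustar + 1)\<^sup>2 + A"
proof -
  have "dist y ustar \<le> dist x ustar + 1" using dist_triangle[of y ustar x] assms by (simp add: dist_commute)
  then have "(dist y ustar)\<^sup>2 \<le> (dist x ustar + 1)\<^sup>2" by (intro power_mono) auto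
  then show ?thesis unfolding Q_def using B_nonneg by (simp add: mult_left_mono)
qed

text \<open>The geodesic competitor travelling at speed \<open>k\<close>, i.e. \<open>s = dist x y / k\<close>.\<close>

lemma geodesic_competitor_speed:
  assumes x: "\<phi> x = ereal Px" and y: "\<phi> y = ereal Py" and xy: "x \<noteq> y" and k: "0 < k"
    and Z: "\<epsilon> * k\<^sup>2 / 2 + Px + \<bar>l\<bar> * (dist x y)\<^sup>2 - Vr y + max 0 (Py - Px) / 2 \<le> Z" 
      "max 0 (Py - Px) / 2 \<le> Z"
  shows "Vr x - Vr y \<le> dist x y / (k * \<epsilon>) * Z"
proof -
  define d s where "d = dist x y" and "s = d / k"
  have d: "0 < d" using xy by (simp add: d_def)
  have s: "0 < s" using d k by (simp add: s_def)
  define a where "a = 1 - exp (- s / \<epsilon>)"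
  have a: "0 \<le> a" "a \<le> s / \<epsilon>"
    using exp_ge_add_one_self[of "- s / \<epsilon>"] s eps by (auto simp: a_def)
  define X where "X = \<epsilon> * k\<^sup>2 / 2 + Px + \<bar>l\<bar> * d\<^sup>2 - Vr y"
  have eq: "\<epsilon> * d\<^sup>2 / (2 * s\<^sup>2) = \<epsilon> * k\<^sup>2 / 2" using d k by (simp add: s_def power_divide)
  have "Vr x \<le> a * (\<epsilon> * k\<^sup>2 / 2 + Px + \<bar>l\<bar> * d\<^sup>2) + s / (2 * \<epsilon>) * max 0 (Py - Px) + (1 - a) * Vr y"
    using geodesic_competitor[OF x y s, folded d_def, unfolded eq] unfolding a_def by simp
  then have "Vr x - Vr y \<le> a * X + s / \<epsilon> * (max 0 (Py - Px) / 2)"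
    unfolding X_def by (simp add: algebra_simps)
  also have "a * X \<le> s / \<epsilon> * max 0 X"
    using mult_mono[of a "s / \<epsilon>" "max 0 X" "max 0 X"] a mult_left_mono[of X "max 0 X" a] by linarith
  also have "s / \<epsilon> * max 0 X + s / \<epsilon> * (max 0 (Py - Px) / 2) = s / \<epsilon> * (max 0 X + max 0 (Py - Px) / 2)"
    by (simp only: distrib_left)
  also have "\<dots> \<le> s / \<epsilon> * Z"
    using Z s eps unfolding X_def d_def by (intro mult_left_mono) (auto simp: max_def)
  finally show ?thesis by (simp add: s_def d_def)
qed

text \<open>Speed \<open>1\<close> gives \<open>Vr y \<ge> Vr x - C \<cdot> dist x y\<close>, that is, lower semicontinuity at \<open>x\<close>. With \<open>Vr y\<close> thus
replaced by \<open>Vr x\<close> up to an error \<open>\<theta>\<close>, the bound at speed \<open>k\<close> is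
\<open>k / 2 + (P - Vr x + \<theta>) / (\<epsilon> k)\<close> times the distance, and the optimal speed is the one stated.\<close>

lemma slope_upper_bound:
  assumes x: "\<phi> x = ereal P" and \<theta>: "0 < \<theta>"
  shows "\<exists>\<rho>>0. \<forall>y Py. y \<noteq> x \<longrightarrow> dist x y < \<rho> \<longrightarrow> \<phi> y = ereal Py \<longrightarrow> \<bar>Py - P\<bar> < \<rho> \<longrightarrow>
     Vr x - Vr y \<le> sqrt (2 * (P - Vr x + \<theta>) / \<epsilon>) * dist x y"
proof -
  define k where "k = sqrt (2 * (P - Vr x + \<theta>) / \<epsilon>)"
  have PW: "0 \<le> P - Vr x" using value_fun_eq_Vr(2)[OF x] by simp
  have k: "0 < k" "k\<^sup>2 = 2 * (P - Vr x + \<theta>) / \<epsilon>" using PW \<theta> eps by (auto simp: k_def)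
  define Qb where "Qb = B * (dist x ustar + 1)\<^sup>2 + A"
  have Qb: "0 \<le> Qb" using A_nonneg B_nonneg by (simp add: Qb_def)
  define Z where "Z = \<epsilon> / 2 + \<bar>P\<bar> + \<bar>l\<bar> + Qb + 1"
  define C where "C = Z / \<epsilon>"
  have C: "0 \<le> C" using eps Qb by (simp add: C_def Z_def)
  define \<rho> where "\<rho> = min 1 (\<theta> / (\<bar>l\<bar> + C + 1))"
  have pos: "0 < \<bar>l\<bar> + C + 1" using C by linarith
  have \<rho>: "0 < \<rho>" "\<rho> \<le> 1" using \<theta> pos by (auto simp: \<rho>_def)
  have "(\<bar>l\<bar> + C + 1) * \<rho> \<le> (\<bar>l\<bar> + C + 1) * (\<theta> / (\<bar>l\<bar> + C + 1))"
    using pos by (intro mult_left_mono) (auto simp: \<rho>_def)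
  then have \<rho>\<theta>: "(\<bar>l\<bar> + C + 1) * \<rho> \<le> \<theta>" using pos by simp
  show ?thesis
  proof (intro exI[of _ \<rho>] conjI allI impI \<rho>(1))
    fix y Py assume y: "y \<noteq> x" "dist x y < \<rho>" "\<phi> y = ereal Py" "\<bar>Py - P\<bar> < \<rho>"
    define d where "d = dist x y"
    have d: "0 < d" "d < \<rho>" "d \<le> 1" using y \<rho> by (auto simp: d_def)
    have d2: "d\<^sup>2 \<le> d" using d by (simp add: power2_eq_square mult_left_le)
    have ld: "\<bar>l\<bar> * d\<^sup>2 \<le> \<bar>l\<bar> * d" using d2 by (intro mult_left_mono) auto
    have ld1: "\<bar>l\<bar> * d \<le> \<bar>l\<bar> * 1" using d by (intro mult_left_mono) auto
    have Qy: "Q y \<le> Qb" unfolding Qb_def by (rule Q_bound) (use d in \<open>simp add: d_def\<close>)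
    have Vy: "- Qb \<le> Vr y" using value_fun_eq_Vr(3)[OF y(3)] Qy by simp
    define c where "c = max 0 (Py - P)"
    have m: "0 \<le> c" "c \<le> \<rho>" using y(4) \<rho> by (auto simp: c_def)
    have xy: "x \<noteq> y" using y(1) by simp
    have "Vr x - Vr y \<le> dist x y / (1 * \<epsilon>) * Z"
    proof (rule geodesic_competitor_speed[OF x y(3) xy, folded c_def])
      show "\<epsilon> * 1\<^sup>2 / 2 + P + \<bar>l\<bar> * (dist x y)\<^sup>2 - Vr y + c / 2 \<le> Z"
        unfolding Z_def d_def[symmetric] using ld ld1 Vy m \<rho>(2) abs_ge_self[of P] by simp
      show "c / 2 \<le> Z" unfolding Z_def using m \<rho>(2) Qb eps abs_ge_zero[of P] abs_ge_zero[of l] by linarith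
    qed simp
    then have Vlow: "Vr x - Vr y \<le> C * d" by (simp add: C_def d_def mult.commute)
    have "Vr x - Vr y \<le> dist x y / (k * \<epsilon>) * (\<epsilon> * k\<^sup>2)"
    proof (rule geodesic_competitor_speed[OF x y(3) xy k(1), folded c_def])
      have "\<bar>l\<bar> * d\<^sup>2 + C * d + c \<le> (\<bar>l\<bar> + C + 1) * \<rho>"
      proof -
        have "\<bar>l\<bar> * d \<le> \<bar>l\<bar> * \<rho>" "C * d \<le> C * \<rho>" using d C by (auto intro!: mult_left_mono)
        then have "\<bar>l\<bar> * d\<^sup>2 + C * d + c \<le> \<bar>l\<bar> * \<rho> + C * \<rho> + \<rho>" using ld m by linarith
        then show ?thesis by (simp add: distrib_right)
      qed
      then have sm: "\<bar>l\<bar> * d\<^sup>2 + C * d + c \<le> \<theta>" using \<rho>\<theta> by linarith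
      have ek: "\<epsilon> * k\<^sup>2 = 2 * (P - Vr x + \<theta>)" unfolding k(2) using eps by simp
      show "\<epsilon> * k\<^sup>2 / 2 + P + \<bar>l\<bar> * (dist x y)\<^sup>2 - Vr y + c / 2 \<le> \<epsilon> * k\<^sup>2"
      proof -
        have "2 * (P - W + \<theta>) / 2 + P + L - V + c / 2 \<le> 2 * (P - W + \<theta>)"
          if "L + K + c \<le> \<theta>" "W - V \<le> K" for L K V W using that m(1) by (simp add: field_simps)
        from this[OF sm Vlow] show ?thesis unfolding ek d_def[symmetric] .
      qed
      show "c / 2 \<le> \<epsilon> * k\<^sup>2"
      proof -
        have "c / 2 \<le> 2 * (P - Vr x + \<theta>)" if "L + K + c \<le> \<theta>" "0 \<le> L" "0 \<le> K" for L K
          using that m(1) PW \<theta> by (simp add: field_simps)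
        moreover have "0 \<le> \<bar>l\<bar> * d\<^sup>2" "0 \<le> C * d" using C d(1) by simp_all
        ultimately show ?thesis unfolding ek using sm by blast
      qed
    qed
    also have "dist x y / (k * \<epsilon>) * (\<epsilon> * k\<^sup>2) = k * dist x y"
      using k(1) eps by (simp add: power2_eq_square)
    finally show "Vr x - Vr y \<le> sqrt (2 * (P - Vr x + \<theta>) / \<epsilon>) * dist x y" by (simp add: k_def)
  qed
qed

end

section \<open>Choosing a time along a nearly optimal curve\<close>

lemma quadratic_le_sqrt:
  fixes x :: real
  assumes "0 \<le> x" "x \<le> 1"
  shows "x * (3 - x) / 2 \<le> sqrt x"
proof -
  define y where "y = sqrt x"
  have y: "0 \<le> y" "x = y\<^sup>2" using assms by (auto simp: y_def)
  have "0 \<le> y * (y - 1)\<^sup>2 * (y + 2)" using y by simp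
  also have "y * (y - 1)\<^sup>2 * (y + 2) = 2 * y - x * (3 - x)"
    unfolding y(2) by (simp add: power2_eq_square algebra_simps)
  finally show ?thesis by (simp add: y_def)
qed

text \<open>The true constant is \<open>2 / 3\<close>; the smooth minorant \<open>x (3 - x) / 2\<close> of \<open>sqrt x\<close> gives \<open>7 / 12\<close>. All that
matters is that this exceeds \<open>1 / 2\<close>.\<close>

lemma integral_ge_of_sqrt_bound:
  fixes H :: "real \<Rightarrow> real"
  assumes H: "set_integrable lborel {0..t} H" and t: "0 < t" and S: "0 \<le> S"
    and le: "AE r in lborel. 0 < r \<and> r \<le> t \<longrightarrow> S * sqrt r \<le> H r"
  shows "7 / 12 * S * t * sqrt t \<le> (LBINT r:{0..t}. H r)"
proof -
  let ?q = "\<lambda>r. S * sqrt t * (r / t * (3 - r / t) / 2)"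
  have "(\<integral>r. ?q r * indicator {0..t} r \<partial>lborel) =
     S * sqrt t * (3 * t\<^sup>2 / (4 * t) - t ^ 3 / (6 * t\<^sup>2)) - S * sqrt t * (3 * 0\<^sup>2 / (4 * t) - 0 ^ 3 / (6 * t\<^sup>2))"
    by (rule integral_FTC_Icc_real)
      (use t in \<open>auto intro!: derivative_eq_intros continuous_intros simp: field_simps power2_eq_square\<close>)
  also have "\<dots> = 7 / 12 * S * t * sqrt t"
    using t by (simp add: power2_eq_square power3_eq_cube field_simps)
  also have "(\<integral>r. ?q r * indicator {0..t} r \<partial>lborel) = (LBINT r:{0..t}. ?q r)"
    unfolding set_lebesgue_integral_def by (intro Bochner_Integration.integral_cong) (auto simp: indicator_def)
  finally have "7 / 12 * S * t * sqrt t = (LBINT r:{0..t}. ?q r)" by simp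
  also have "\<dots> \<le> (LBINT r:{0..t}. H r)"
  proof (rule set_integral_mono_AE)
    show "set_integrable lborel {0..t} ?q"
      by (rule borel_integrable_atLeastAtMost') (use t in \<open>intro continuous_intros, auto\<close>)
    show "AE r\<in>{0..t} in lborel. ?q r \<le> H r"
      using le AE_lborel_singleton[of 0]
    proof (eventually_elim, intro impI)
      fix r assume *: "0 < r \<and> r \<le> t \<longrightarrow> S * sqrt r \<le> H r" "r \<noteq> 0" "r \<in> {0..t}"
      have "r / t * (3 - r / t) / 2 \<le> sqrt (r / t)" using * t by (intro quadratic_le_sqrt) auto
      then have "?q r \<le> S * sqrt t * sqrt (r / t)" using S t by (intro mult_left_mono) auto
      also have "\<dots> = S * sqrt r" using t by (simp add: real_sqrt_divide)
      finally show "?q r \<le> H r" using * by auto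
    qed
  qed (rule H)
  finally show ?thesis .
qed

text \<open>A time \<open>t\<close> at which the mean of \<open>H\<close> over \<open>[0, t]\<close> is at least \<open>11 / 20 \<cdot> H t\<close>, where \<open>11 / 20 > 1 / 2\<close>. It
is obtained by nearly minimising \<open>H r / sqrt r\<close>, which makes \<open>H r\<close> at least about \<open>H t \<cdot> sqrt (r / t)\<close>
for \<open>r < t\<close>. Near \<open>0\<close> this quotient is large because \<open>H \<ge> \<eta>\<close>, whereas somewhere it is at most a
constant given by \<open>K\<close> and \<open>T\<close>. Therefore \<open>t\<close> is bounded below by a \<open>\<kappa>\<close> that depends on these bounds
only, and not on \<open>H\<close>. The set \<open>D\<close> collects the times at which \<open>H\<close> may be evaluated.\<close>

lemma good_time_exists:
  fixes T \<eta> K :: real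
  assumes T: "0 < T" and \<eta>: "0 < \<eta>" and K: "0 \<le> K"
  shows "\<exists>\<kappa>>0. \<forall>H D. set_integrable lborel {0..T} H \<longrightarrow> (AE r in lborel. 0 < r \<and> r \<le> T \<longrightarrow> r \<in> D) \<longrightarrow>
     (\<forall>r\<in>D. 0 < r \<and> r \<le> T \<and> \<eta> \<le> H r) \<longrightarrow> (LBINT r:{0..T}. H r) \<le> K \<longrightarrow>
     (\<exists>t\<in>D. \<kappa> \<le> t \<and> 11 / 20 * t * H t \<le> (LBINT r:{0..t}. H r))"
proof -
  define N where "N = 12 * (K + 1) / (7 * (T * sqrt T))"
  have N: "0 < N" using T K by (simp add: N_def)
  define \<kappa> where "\<kappa> = (\<eta> / (2 * N))\<^sup>2"
  show ?thesis
  proof (intro exI[of _ \<kappa>] conjI allI impI)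
    show "0 < \<kappa>" using N \<eta> by (simp add: \<kappa>_def)
    fix H :: "real \<Rightarrow> real" and D
    assume H: "set_integrable lborel {0..T} H" and AD: "AE r in lborel. 0 < r \<and> r \<le> T \<longrightarrow> r \<in> D"
      and D: "\<forall>r\<in>D. 0 < r \<and> r \<le> T \<and> \<eta> \<le> H r" and HK: "(LBINT r:{0..T}. H r) \<le> K"
    define R where "R r = H r / sqrt r" for r
    have RH: "H r = R r * sqrt r" if "r \<in> D" for r using D that by (auto simp: R_def)
    have "\<exists>r0\<in>D. R r0 \<le> N"
    proof (rule ccontr)
      assume "\<not> (\<exists>r0\<in>D. R r0 \<le> N)"
      then have *: "N \<le> R r" if "r \<in> D" for r using that by force
      have "7 / 12 * N * T * sqrt T \<le> (LBINT r:{0..T}. H r)"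
      proof (rule integral_ge_of_sqrt_bound[OF H T less_imp_le[OF N]])
        show "AE r in lborel. 0 < r \<and> r \<le> T \<longrightarrow> N * sqrt r \<le> H r"
          using AD
        proof (eventually_elim, intro impI)
          fix r assume "0 < r \<and> r \<le> T \<longrightarrow> r \<in> D" "0 < r \<and> r \<le> T"
          then have "r \<in> D" "0 < r" by auto
          then show "N * sqrt r \<le> H r" using *[of r] RH[of r] by (simp add: mult_right_mono)
        qed
      qed
      moreover have "7 / 12 * N * T * sqrt T = K + 1" using T by (simp add: N_def)
      ultimately show False using HK by linarith
    qed
    then obtain r0 where r0: "r0 \<in> D" "R r0 \<le> N" by blast
    define S where "S = Inf (R ` D)"
    have lowR: "\<eta> / sqrt T \<le> R r" if "r \<in> D" for r
    proof -
      have "\<eta> / sqrt T \<le> \<eta> / sqrt r" using D that T \<eta> by (intro divide_left_mono) auto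
      also have "\<dots> \<le> R r" unfolding R_def using D that by (intro divide_right_mono) auto
      finally show ?thesis .
    qed
    have bdd: "bdd_below (R ` D)" using lowR by (auto intro!: bdd_belowI[of _ "\<eta> / sqrt T"])
    have SR: "S \<le> R r" if "r \<in> D" for r unfolding S_def using that bdd by (intro cInf_lower) auto
    have "\<eta> / sqrt T \<le> S" unfolding S_def using lowR r0 by (intro cInf_greatest) auto
    then have S: "0 < S" using \<eta> T by (meson divide_pos_pos less_le_trans real_sqrt_gt_zero)
    have SN: "S \<le> N" using SR[OF r0(1)] r0(2) by linarith
    \<comment> \<open>\<open>7 / 12\<close> divided by \<open>35 / 33\<close> is \<open>11 / 20\<close>\<close>
    have "Inf (R ` D) < 35 / 33 * S" using S by (simp add: S_def)
    then obtain t where t: "t \<in> D" "R t < 35 / 33 * S"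
      using cInf_lessD[of "R ` D" "35 / 33 * S"] r0(1) by blast
    have t0: "0 < t" "t \<le> T" "\<eta> \<le> H t" using D t by auto
    have "\<kappa> \<le> t"
    proof -
      have "\<eta> \<le> R t * sqrt t" using t0 RH[OF t(1)] by simp
      also have "\<dots> \<le> (2 * N) * sqrt t" using t(2) SN S t0 by (intro mult_right_mono) auto
      finally have "\<eta> / (2 * N) \<le> sqrt t" using N by (simp add: field_simps)
      then have "(\<eta> / (2 * N))\<^sup>2 \<le> (sqrt t)\<^sup>2" using N \<eta> by (intro power_mono) auto
      then show ?thesis using t0 by (simp add: \<kappa>_def)
    qed
    moreover have "11 / 20 * t * H t \<le> (LBINT r:{0..t}. H r)"
    proof -
      have "11 / 20 * t * H t = (11 / 20 * (t * sqrt t)) * R t" using RH[OF t(1)] by simp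
      also have "\<dots> \<le> (11 / 20 * (t * sqrt t)) * (35 / 33 * S)"
        using t t0 by (intro mult_left_mono) auto
      also have "\<dots> = 7 / 12 * S * t * sqrt t" by simp
      also have "\<dots> \<le> (LBINT r:{0..t}. H r)"
      proof (rule integral_ge_of_sqrt_bound)
        show "set_integrable lborel {0..t} H" by (rule set_integrable_subset[OF H]) (use t0 in auto)
        show "AE r in lborel. 0 < r \<and> r \<le> t \<longrightarrow> S * sqrt r \<le> H r"
          using AD
        proof (eventually_elim, intro impI)
          fix r assume "0 < r \<and> r \<le> T \<longrightarrow> r \<in> D" "0 < r \<and> r \<le> t"
          then have "r \<in> D" "0 < r" using t0 by auto
          then show "S * sqrt r \<le> H r" using SR[of r] RH[of r] by (simp add: mult_right_mono)
        qed
      qed (use t0 S in auto)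
      finally show ?thesis .
    qed
    ultimately show "\<exists>t\<in>D. \<kappa> \<le> t \<and> 11 / 20 * t * H t \<le> (LBINT r:{0..t}. H r)" using t(1) by blast
  qed
qed

text \<open>Here \<open>m = t / \<epsilon>\<close>, \<open>h\<close> stands for the excess of \<open>\<phi>\<close> at the end of the piece of curve, \<open>dd\<close> for the kinetic
term, \<open>V\<close> and \<open>W\<close> for the values at its end and at its start. The lower bound is dynamic programming with
a mean excess of at least \<open>11 / 20 \<cdot> h\<close>; the upper bound is the geodesic competitor with duration
\<open>s = t exp m\<close>, chosen such that its kinetic term is at most \<open>dd\<close> too, and with mean excess \<open>h / 2\<close>.
Subtracting, the kinetic terms cancel and the difference of the coefficients of \<open>h\<close>, at least
\<open>m / 50\<close>, has to absorb errors that add up to at most \<open>5 m \<eta>\<close>.\<close>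

lemma potential_excess_bound:
  fixes m \<eta> P V W \<delta> L K h dd :: real
  defines "z \<equiv> exp m" and "a \<equiv> 1 - exp (- m)" and "b \<equiv> 1 - exp (- (m * exp m))"
  assumes m: "0 < m" and z: "z \<le> 51 / 50" and h: "0 \<le> h" and \<eta>: "0 \<le> \<eta>"
    and lower: "dd + (P - 2 * \<eta>) * a + 11 / 20 * m * exp (- m) * h + (1 - a) * V \<le> W + \<delta>"
    and upper: "W \<le> dd + b * (P + L) + m * z / 2 * h + (1 - b) * V"
    and K: "P - V \<le> K" "0 \<le> K" "(z - 1) * K \<le> \<eta>" and L: "0 \<le> L" "3 * L \<le> \<eta>" and \<delta>: "\<delta> \<le> \<eta> * m"
  shows "h \<le> 250 * \<eta>"
proof -
  have z1: "1 \<le> z" using m by (simp add: z_def)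
  have inv: "exp (- m) = 1 / z" by (simp add: z_def exp_minus divide_inverse)
  have am: "a \<le> m" using exp_ge_add_one_self[of "- m"] by (simp add: a_def)
  have bm: "b \<le> m * z" using exp_ge_add_one_self[of "- (m * exp m)"] by (simp add: b_def z_def)
  have mz: "m * 1 \<le> m * z" using m z1 by (intro mult_left_mono) auto
  have ba0: "a \<le> b" using mz unfolding a_def b_def z_def by simp
  have ba: "b - a \<le> m * (z - 1)"
  proof -
    have "exp (- (m * z)) = exp (- m) * exp (- (m * (z - 1)))" by (simp add: exp_add[symmetric] algebra_simps)
    then have "b - a = exp (- m) * (1 - exp (- (m * (z - 1))))" by (simp add: a_def b_def z_def algebra_simps)
    also have "\<dots> \<le> 1 * (m * (z - 1))"
      using exp_ge_add_one_self[of "- (m * (z - 1))"] m z1 by (intro mult_mono) auto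
    finally show ?thesis by simp
  qed
  have coeff: "1 / 50 \<le> 11 / 20 * (1 / z) - z / 2"
  proof -
    have "50 / 51 \<le> 1 / z" using z z1 by (simp add: field_simps)
    then show ?thesis using z by linarith
  qed
  have "m * (h * (1 / 50)) \<le> m * (h * (11 / 20 * (1 / z) - z / 2))"
    using m h coeff by (intro mult_left_mono) auto
  also have "\<dots> = 11 / 20 * m * exp (- m) * h - m * z / 2 * h" unfolding inv by (simp add: algebra_simps)
  also have "\<dots> \<le> \<delta> + 2 * \<eta> * a + (b - a) * (P - V) + b * L"
    using lower upper by (simp add: algebra_simps)
  also have "\<dots> \<le> \<eta> * m + 2 * \<eta> * m + \<eta> * m + \<eta> * m"
  proof -
    have 1: "2 * \<eta> * a \<le> 2 * \<eta> * m" using am \<eta> by (intro mult_left_mono) auto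
    have "(b - a) * (P - V) \<le> (b - a) * K" using K ba0 by (intro mult_left_mono) auto
    also have "\<dots> \<le> (m * (z - 1)) * K" using ba K by (intro mult_right_mono) auto
    also have "\<dots> = m * ((z - 1) * K)" by simp
    also have "\<dots> \<le> m * \<eta>" using K m by (intro mult_left_mono) auto
    finally have 2: "(b - a) * (P - V) \<le> \<eta> * m" by (simp add: mult.commute)
    have "b * L \<le> (m * z) * L" using bm L by (intro mult_right_mono) auto
    also have "\<dots> \<le> (m * 2) * L" using z m L by (intro mult_right_mono mult_left_mono) auto
    also have "\<dots> = m * (2 * L)" by simp
    also have "\<dots> \<le> m * \<eta>" using L m by (intro mult_left_mono) auto
    finally have 3: "b * L \<le> \<eta> * m" by (simp add: mult.commute)
    show ?thesis using 1 2 3 \<delta> by linarith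
  qed
  finally have "m * (h * (1 / 50)) \<le> m * (5 * \<eta>)" by (simp add: algebra_simps)
  then have "h * (1 / 50) \<le> 5 * \<eta>" using m by simp
  then show ?thesis by simp
qed

text \<open>Up to the errors, \<open>W - V\<close> is at least \<open>d\<^sup>2 / (2 t) + (t / \<epsilon>) (P - W)\<close>, and the inequality \<open>2 p q \<le> p\<^sup>2 + q\<^sup>2\<close>
makes the bound independent of \<open>t\<close>. The second claim is what shows that the curve has moved.\<close>

lemma slope_from_dynamic_programming:
  fixes t \<epsilon> \<eta> P V W \<delta> d :: real
  assumes t: "0 < t" and \<epsilon>: "0 < \<epsilon>" and z: "exp (t / \<epsilon>) \<le> 51 / 50" and \<eta>: "0 < \<eta>" "4 * \<eta> \<le> P - W" and d: "0 \<le> d"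
    and lower: "exp (- t / \<epsilon>) * d\<^sup>2 / (2 * t) + (P - \<eta>) * (1 - exp (- t / \<epsilon>)) + exp (- t / \<epsilon>) * V \<le> W + \<delta>"
    and \<delta>: "0 \<le> \<delta>" "\<delta> \<le> \<eta> / 2" "\<delta> \<le> \<eta> * (t / \<epsilon>) / 2"
  shows "exp (- t / \<epsilon>) * sqrt (2 * (P - W - 3 * \<eta>) / \<epsilon>) * d \<le> W - V" and "0 < W - V"
proof -
  define m z where "m = t / \<epsilon>" and "z = exp m"
  have m: "0 < m" using t \<epsilon> by (simp add: m_def)
  have z1: "1 + m \<le> z" "z \<le> 51 / 50" using z by (auto simp: z_def m_def)
  have inv: "exp (- t / \<epsilon>) = 1 / z" by (simp add: z_def m_def exp_minus divide_inverse)
  have z0: "0 < z" by (simp add: z_def)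
  have Y: "0 < P - W - 3 * \<eta>" using \<eta> by simp
  define e where "e = d\<^sup>2 / (2 * t)"
  have e: "0 \<le> e" using t by (simp add: e_def)
  have "1 / z * e + (P - \<eta>) * (1 - 1 / z) + 1 / z * V \<le> W + \<delta>"
    using lower unfolding inv e_def by simp
  then have "z * (1 / z * e + (P - \<eta>) * (1 - 1 / z) + 1 / z * V) \<le> z * (W + \<delta>)"
    using z0 by (intro mult_left_mono) auto
  also have "z * (1 / z * e + (P - \<eta>) * (1 - 1 / z) + 1 / z * V) = e + (P - \<eta>) * (z - 1) + V"
    using z0 by (simp add: field_simps)
  finally have low: "e + (P - \<eta>) * (z - 1) + V \<le> z * (W + \<delta>)" .
  have z\<delta>: "z * \<delta> \<le> \<eta> * m" "z * \<delta> \<le> \<eta>"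
  proof -
    have "z * \<delta> \<le> 2 * \<delta>" using z1 \<delta> by (intro mult_right_mono) auto
    then show "z * \<delta> \<le> \<eta> * m" "z * \<delta> \<le> \<eta>" using \<delta> by (auto simp: m_def)
  qed
  have "m * (P - W - 3 * \<eta>) \<le> (z - 1) * (P - W - 3 * \<eta>)"
    using z1 Y by (intro mult_right_mono) auto
  moreover have "m * (2 * \<eta>) \<le> (z - 1) * (2 * \<eta>)" using z1 \<eta> by (intro mult_right_mono) auto
  moreover have "0 \<le> \<eta> * m" using \<eta> m by simp
  ultimately have main: "e + m * (P - W - 3 * \<eta>) \<le> W - V"
    using low z\<delta> by (simp add: algebra_simps)
  have amgm: "sqrt (2 * (P - W - 3 * \<eta>) / \<epsilon>) * d \<le> e + m * (P - W - 3 * \<eta>)"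
  proof -
    define p q where "p = sqrt (m * (P - W - 3 * \<eta>))" and "q = d / sqrt (2 * t)"
    have "p\<^sup>2 = m * (P - W - 3 * \<eta>)" "q\<^sup>2 = e" using m Y t by (auto simp: p_def q_def e_def power_divide)
    moreover have "2 * p * q = sqrt (2 * (P - W - 3 * \<eta>) / \<epsilon>) * d"
    proof -
      have "2 * (P - W - 3 * \<eta>) / \<epsilon> = 4 * (m * (P - W - 3 * \<eta>)) / (2 * t)"
        using t \<epsilon> by (simp add: m_def field_simps)
      moreover have "sqrt (4 * X / (2 * t)) = sqrt 4 * sqrt X / sqrt (2 * t)" for X
        by (simp only: real_sqrt_divide real_sqrt_mult)
      ultimately have "sqrt (2 * (P - W - 3 * \<eta>) / \<epsilon>) = 2 * p / sqrt (2 * t)"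
        unfolding p_def by (simp only: real_sqrt_four)
      then show ?thesis by (simp add: q_def)
    qed
    moreover have "2 * p * q \<le> p\<^sup>2 + q\<^sup>2" using zero_le_power2[of "p - q"] by (simp add: power2_diff)
    ultimately show ?thesis by simp
  qed
  have s0: "0 \<le> sqrt (2 * (P - W - 3 * \<eta>) / \<epsilon>) * d" using Y \<epsilon> d by simp
  have "exp (- t / \<epsilon>) * (sqrt (2 * (P - W - 3 * \<eta>) / \<epsilon>) * d) \<le> 1 * (sqrt (2 * (P - W - 3 * \<eta>) / \<epsilon>) * d)"
    using t \<epsilon> s0 by (intro mult_right_mono) auto
  then show "exp (- t / \<epsilon>) * sqrt (2 * (P - W - 3 * \<eta>) / \<epsilon>) * d \<le> W - V" using amgm main by simp
  have "0 < m * (P - W - 3 * \<eta>)" using m Y by simp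
  then show "0 < W - V" using main e by linarith
qed

section \<open>The lower bound for the slope\<close>

context wed_setting begin

lemma weight_compare:
  fixes f :: "real \<Rightarrow> real"
  assumes f[measurable]: "f \<in> borel_measurable borel"
    and kf: "set_integrable lborel {0..t} (\<lambda>r. weight r * f r)"
  shows "set_integrable lborel {0..t} f"
    and "(AE r in lborel. 0 < r \<and> r \<le> t \<longrightarrow> 0 \<le> f r) \<Longrightarrow>
      exp (- t / \<epsilon>) / \<epsilon> * (LBINT r:{0..t}. f r) \<le> (LBINT r:{0..t}. weight r * f r)"
proof -
  have mono: "exp (- t / \<epsilon>) / \<epsilon> \<le> weight r" if "r \<le> t" for r
    using that eps by (simp add: divide_right_mono)
  have "set_integrable lborel {0..t} (\<lambda>r. (\<epsilon> * exp (t / \<epsilon>)) * (weight r * f r))"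
    by (rule set_integrable_mult_right) (rule kf)
  then show fi: "set_integrable lborel {0..t} f"
  proof (rule set_integrable_bound)
    show "AE r in lborel. r \<in> {0..t} \<longrightarrow> norm (f r) \<le> norm ((\<epsilon> * exp (t / \<epsilon>)) * (weight r * f r))"
    proof (intro AE_I2 impI)
      fix r assume r: "r \<in> {0..t}"
      have "1 * \<bar>f r\<bar> \<le> exp ((t - r) / \<epsilon>) * \<bar>f r\<bar>" using r eps by (intro mult_right_mono) auto
      also have "exp ((t - r) / \<epsilon>) = exp (t / \<epsilon>) * exp (- r / \<epsilon>)"
        by (simp add: exp_add[symmetric] diff_divide_distrib)
      finally show "norm (f r) \<le> norm ((\<epsilon> * exp (t / \<epsilon>)) * (weight r * f r))"
        using eps by (simp add: abs_mult mult.assoc)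
    qed
  qed (simp add: set_borel_measurable_def)
  assume pos: "AE r in lborel. 0 < r \<and> r \<le> t \<longrightarrow> 0 \<le> f r"
  have "(LBINT r:{0..t}. exp (- t / \<epsilon>) / \<epsilon> * f r) \<le> (LBINT r:{0..t}. weight r * f r)"
  proof (rule set_integral_mono_AE)
    show "AE r\<in>{0..t} in lborel. exp (- t / \<epsilon>) / \<epsilon> * f r \<le> weight r * f r"
      using pos AE_lborel_singleton[of 0]
    proof (eventually_elim, intro impI)
      fix r assume "0 < r \<and> r \<le> t \<longrightarrow> 0 \<le> f r" "r \<noteq> 0" "r \<in> {0..t}"
      then show "exp (- t / \<epsilon>) / \<epsilon> * f r \<le> weight r * f r"
        by (intro mult_right_mono[OF mono]) auto
    qed
  qed (use fi kf in auto)
  then show "exp (- t / \<epsilon>) / \<epsilon> * (LBINT r:{0..t}. f r) \<le> (LBINT r:{0..t}. weight r * f r)"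
    by simp
qed

lemma finite_curve_weighted:
  assumes u: "finite_curve u g" and t: "0 \<le> t"
  shows "set_integrable lborel {0..t} (\<lambda>r. weight r * (g r)\<^sup>2)"
    and "set_integrable lborel {0..t} (\<lambda>r. weight r * potential u r)"
proof -
  have [measurable]: "g \<in> borel_measurable borel" by (rule metric_speed_measurable[OF finite_curve_speed[OF u]])
  show "set_integrable lborel {0..t} (\<lambda>r. weight r * (g r)\<^sup>2)"
    using iffD1[OF wed_measure_split(1)[OF eps _ t] finite_curve_square[OF u]] by simp
  show "set_integrable lborel {0..t} (\<lambda>r. weight r * potential u r)"
    using iffD1[OF wed_measure_split(1)[OF eps potential_measurable[OF finite_curve_speed[OF u]] t] finite_curve_potential[OF u]] by simp
qed

lemma action_le:
  assumes u: "finite_curve u g" and t: "0 \<le> t"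
  shows "exp (- t / \<epsilon>) / \<epsilon> * (LBINT r:{0..t}. (g r)\<^sup>2) \<le> 4 / \<epsilon> * (energy u g + Q (u 0))"
proof -
  have [measurable]: "g \<in> borel_measurable borel" by (rule metric_speed_measurable[OF finite_curve_speed[OF u]])
  have gm: "(\<lambda>r. (g r)\<^sup>2) \<in> borel_measurable borel" by measurable
  have "exp (- t / \<epsilon>) / \<epsilon> * (LBINT r:{0..t}. (g r)\<^sup>2) \<le> (LBINT r:{0..t}. weight r * (g r)\<^sup>2)"
    by (rule weight_compare(2)[OF gm finite_curve_weighted(1)[OF u t]]) simp
  also have "\<dots> \<le> (\<integral>r. (g r)\<^sup>2 \<partial>\<mu>)"
    unfolding wed_measure_split(2)[OF eps gm t finite_curve_square[OF u]] by simp
  also have "\<dots> = 4 / \<epsilon> * (\<epsilon> / 4 * (\<integral>r. (g r)\<^sup>2 \<partial>\<mu>))" using eps by simp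
  also have "\<dots> \<le> 4 / \<epsilon> * (energy u g + Q (u 0))"
    using energy_lower_bound[OF u] eps by (intro mult_left_mono) auto
  finally show ?thesis .
qed

text \<open>Dynamic programming with the kinetic part estimated by the distance covered, for any reference
level \<open>c\<close> of the potential.\<close>

lemma dynamic_programming_split:
  assumes u: "finite_curve u g" and t: "0 < t"
  shows "exp (- t / \<epsilon>) * (dist (u 0) (u t))\<^sup>2 / (2 * t)
      + (LBINT r:{0..t}. weight r * (potential u r - c)) + c * (1 - exp (- t / \<epsilon>))
      + exp (- t / \<epsilon>) * Vr (u t) \<le> energy u g"
proof -
  have t0: "0 \<le> t" using t by simp
  note w = finite_curve_weighted[OF u t0]
  have [measurable]: "g \<in> borel_measurable borel" by (rule metric_speed_measurable[OF finite_curve_speed[OF u]])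
  have gm: "(\<lambda>r. (g r)\<^sup>2) \<in> borel_measurable borel" by measurable
  let ?k = "\<lambda>r. weight r"
  have kc: "set_integrable lborel {0..t} (\<lambda>r. ?k r * c)" "(LBINT r:{0..t}. ?k r * c) = (1 - exp (- t / \<epsilon>)) * c"
    using weighted_affine_integral[OF t0, of c 0] by simp_all
  have "(LBINT r:{0..t}. ?k r * (\<epsilon> / 2 * (g r)\<^sup>2 + potential u r))
     = (LBINT r:{0..t}. \<epsilon> / 2 * (?k r * (g r)\<^sup>2) + ((?k r * potential u r - ?k r * c) + ?k r * c))"
    by (rule set_lebesgue_integral_cong) (auto simp: algebra_simps)
  also have "\<dots> = \<epsilon> / 2 * (LBINT r:{0..t}. ?k r * (g r)\<^sup>2)
     + ((LBINT r:{0..t}. ?k r * potential u r - ?k r * c) + (1 - exp (- t / \<epsilon>)) * c)"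
  proof -
    have s1: "set_integrable lborel {0..t} (\<lambda>r. \<epsilon> / 2 * (?k r * (g r)\<^sup>2))"
      by (rule set_integrable_mult_right) (rule w(1))
    have s2: "set_integrable lborel {0..t} (\<lambda>r. ?k r * potential u r - ?k r * c)"
      by (rule set_integral_diff(1)[OF w(2) kc(1)])
    show ?thesis
      unfolding set_integral_add(2)[OF s1 set_integral_add(1)[OF s2 kc(1)]] set_integral_add(2)[OF s2 kc(1)] kc(2)
      by simp
  qed
  also have "(LBINT r:{0..t}. ?k r * potential u r - ?k r * c) = (LBINT r:{0..t}. ?k r * (potential u r - c))"
    by (simp only: right_diff_distrib)
  finally have eq: "(LBINT r:{0..t}. ?k r * (\<epsilon> / 2 * (g r)\<^sup>2 + potential u r)) =
     \<epsilon> / 2 * (LBINT r:{0..t}. ?k r * (g r)\<^sup>2)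
     + ((LBINT r:{0..t}. ?k r * (potential u r - c)) + (1 - exp (- t / \<epsilon>)) * c)" .
  have "exp (- t / \<epsilon>) * (dist (u 0) (u t))\<^sup>2 / (2 * t) \<le> exp (- t / \<epsilon>) * (t * (LBINT r:{0..t}. (g r)\<^sup>2)) / (2 * t)"
    using dist_square_le_energy[OF finite_curve_speed[OF u] t] t by (intro divide_right_mono mult_left_mono) auto
  also have "\<dots> = \<epsilon> / 2 * (exp (- t / \<epsilon>) / \<epsilon> * (LBINT r:{0..t}. (g r)\<^sup>2))"
    using t eps by (simp add: field_simps)
  also have "\<dots> \<le> \<epsilon> / 2 * (LBINT r:{0..t}. ?k r * (g r)\<^sup>2)"
    using weight_compare(2)[OF gm w(1)] eps by (intro mult_left_mono) auto
  finally show ?thesis using dynamic_programming[OF u t0] unfolding eq by (simp add: mult.commute)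
qed

end

lemma eventually_at_right_0_less:
  fixes F :: "real \<Rightarrow> real"
  assumes "isCont F 0" "F 0 < c"
  shows "eventually (\<lambda>t. F t < c) (at_right 0)"
proof -
  have "(F \<longlongrightarrow> F 0) (at 0)" using assms(1) by (simp add: isCont_def)
  then have "(F \<longlongrightarrow> F 0) (at_right 0)" by (rule tendsto_mono[rotated]) (simp add: at_le)
  then show ?thesis by (rule order_tendstoD(2)) (rule assms(2))
qed

lemma at_right_0_witness:
  assumes "eventually P (at_right (0::real))"
  obtains t where "0 < t" "P t"
proof -
  have "eventually (\<lambda>t. P t \<and> 0 < t) (at_right (0::real))"
    using assms eventually_at_right_less[of "0::real"] by (rule eventually_conj)
  then have "\<exists>t. P t \<and> 0 < t" by (rule eventually_happens'[rotated]) simp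
  then show ?thesis using that by blast
qed

context wed_setting begin

text \<open>Everything is fixed in the order \<open>\<eta>\<close>, \<open>\<rho>\<close>, \<open>T\<close>, \<open>\<kappa>\<close>, \<open>\<delta>\<close> and only then the curve \<open>u\<close>, nearly minimising up to
\<open>\<delta>\<close>; the good time \<open>t\<close> of this curve satisfies \<open>t \<ge> \<kappa>\<close>, so \<open>\<delta>\<close> is small compared with \<open>\<eta> t\<close>. At this
time the excess of \<open>\<phi> (u t)\<close> over \<open>P\<close> is \<open>O(\<eta>)\<close>, which makes \<open>y = u t\<close> admissible for the
conditioned slope, and dynamic programming gives the slope.\<close>

theorem slope_lower_bound:
  assumes x: "\<phi> x = ereal P" and gap: "Vr x < P" and \<theta>: "0 < \<theta>"
  shows "\<exists>y Py. y \<noteq> x \<and> dist x y < \<theta> \<and> \<phi> y = ereal Py \<and> \<bar>Py - P\<bar> < \<theta> \<and>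
     (sqrt (2 * (P - Vr x) / \<epsilon>) - \<theta>) * dist x y \<le> Vr x - Vr y"
proof -
  define W where "W = Vr x"
  define G where "G = sqrt (2 * (P - W) / \<epsilon>)"
  \<comment> \<open>\<open>252\<close> is the constant of \<open>potential_excess_bound\<close> plus the \<open>2\<close> from the shift in \<open>H\<close>\<close>
  have "eventually (\<lambda>\<eta>. 252 * \<eta> < \<theta> \<and> 4 * \<eta> < P - W \<and> - sqrt (2 * (P - W - 3 * \<eta>) / \<epsilon>) < - (G - \<theta> / 2)) (at_right 0)"
    using \<theta> gap eps
    by (intro eventually_conj eventually_at_right_0_less) (auto simp: W_def G_def intro!: continuous_intros)
  then obtain \<eta> where \<eta>: "0 < \<eta>" "252 * \<eta> < \<theta>" "4 * \<eta> < P - W" "G - \<theta> / 2 < sqrt (2 * (P - W - 3 * \<eta>) / \<epsilon>)"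
    by (rule at_right_0_witness) auto
  have "x \<in> {y. ereal (P - \<eta>) < \<phi> y}" using x \<eta> by simp
  then obtain \<rho>0 where \<rho>0: "0 < \<rho>0" "ball x \<rho>0 \<subseteq> {y. ereal (P - \<eta>) < \<phi> y}"
    using lsc[of "ereal (P - \<eta>)"] openE by blast
  define \<rho> where "\<rho> = min \<rho>0 (min 1 \<theta>)"
  have \<rho>: "0 < \<rho>" "\<rho> \<le> 1" "\<rho> \<le> \<theta>" using \<rho>0 \<theta> by (auto simp: \<rho>_def)
  have low: "ereal (P - \<eta>) < \<phi> y" if "dist x y < \<rho>" for y
    using \<rho>0(2) that by (auto simp: \<rho>_def subset_iff)
  define Qb where "Qb = B * (dist x ustar + 1)\<^sup>2 + A"
  have Qb: "0 \<le> Qb" using A_nonneg B_nonneg by (simp add: Qb_def)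
  \<comment> \<open>bounds the integral of \<open>g\<^sup>2\<close> over \<open>[0, T]\<close> for curves of energy at most \<open>W + 1\<close>, by \<open>action_le\<close>\<close>
  define K1 where "K1 = 8 * (W + 1 + Q x)"
  have W_low: "- Q x \<le> W" unfolding W_def by (rule value_fun_eq_Vr(3)[OF x])
  then have K1: "0 < K1" by (simp add: K1_def)
  define K3 where "K3 = max 0 (P + Qb)"
  \<comment> \<open>\<open>51 / 50\<close> keeps \<open>11 / 20 \<cdot> exp (- T / \<epsilon>)\<close> above \<open>1 / 2 \<cdot> exp (T / \<epsilon>)\<close>\<close>
  have "eventually (\<lambda>T. T * K1 < \<rho>\<^sup>2 \<and> exp (T / \<epsilon>) < 51 / 50 \<and> (exp (T / \<epsilon>) - 1) * K3 < \<eta> \<and>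
      3 * (\<bar>l\<bar> * (T * K1)) < \<eta> \<and> (exp (T / \<epsilon>) - 1) * G < \<theta> / 2) (at_right 0)"
    using \<theta> \<eta> eps \<rho> by (intro eventually_conj eventually_at_right_0_less) (auto intro!: continuous_intros)
  then obtain T where T: "0 < T" "T * K1 < \<rho>\<^sup>2" "exp (T / \<epsilon>) < 51 / 50" "(exp (T / \<epsilon>) - 1) * K3 < \<eta>"
      "3 * (\<bar>l\<bar> * (T * K1)) < \<eta>" "(exp (T / \<epsilon>) - 1) * G < \<theta> / 2"
    by (rule at_right_0_witness) auto
  have expT: "exp (t / \<epsilon>) \<le> exp (T / \<epsilon>)" if "t \<le> T" for t using that eps by (simp add: divide_right_mono)
  have expT2: "1 / 2 \<le> exp (- t / \<epsilon>)" if "t \<le> T" for t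
  proof -
    have "exp (t / \<epsilon>) \<le> 2" using expT[OF that] T(3) by linarith
    then have "inverse 2 \<le> inverse (exp (t / \<epsilon>))" by (intro le_imp_inverse_le) auto
    then show ?thesis by (simp add: exp_minus)
  qed
  define K2 where "K2 = 2 * \<epsilon> * (W + 1 + Qb + \<bar>P\<bar> + 2 * \<eta>)"
  have "Q x \<le> Qb" unfolding Qb_def by (rule Q_bound) simp
  then have K2: "0 \<le> K2" using W_low Qb eps \<eta>(1) by (simp add: K2_def)
  obtain \<kappa> where \<kappa>: "0 < \<kappa>" and select: "\<And>H D. set_integrable lborel {0..T} H \<Longrightarrow>
     (AE r in lborel. 0 < r \<and> r \<le> T \<longrightarrow> r \<in> D) \<Longrightarrow>
     (\<forall>r\<in>D. 0 < r \<and> r \<le> T \<and> \<eta> \<le> H r) \<Longrightarrow> (LBINT r:{0..T}. H r) \<le> K2 \<Longrightarrow>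
     (\<exists>t\<in>D. \<kappa> \<le> t \<and> 11 / 20 * t * H t \<le> (LBINT r:{0..t}. H r))"
    using good_time_exists[OF T(1) \<eta>(1) K2] by blast
  define \<delta> where "\<delta> = min 1 (min (\<eta> / 2) (\<eta> * (\<kappa> / \<epsilon>) / 2))"
  have \<delta>: "0 < \<delta>" "\<delta> \<le> 1" "\<delta> \<le> \<eta> / 2" "\<delta> \<le> \<eta> * (\<kappa> / \<epsilon>) / 2" using \<eta>(1) \<kappa> eps by (auto simp: \<delta>_def)
  have "value_fun \<epsilon> \<phi> x < ereal (W + \<delta>)" using value_fun_eq_Vr(1)[OF x] \<delta>(1) by (simp add: W_def)
  then obtain u g where u: "finite_curve u g" "u 0 = x" "energy u g < W + \<delta>" by (rule near_minimiser)
  note us = finite_curve_speed[OF u(1)]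
  have J: "(LBINT r:{0..t}. (g r)\<^sup>2) \<le> K1" if t: "0 \<le> t" "t \<le> T" for t
  proof -
    define J where "J = (LBINT r:{0..t}. (g r)\<^sup>2)"
    have J0: "0 \<le> J" unfolding J_def set_lebesgue_integral_def by (intro Bochner_Integration.integral_nonneg) simp
    have "1 / 2 * J \<le> exp (- t / \<epsilon>) * J" using expT2[OF t(2)] J0 by (intro mult_right_mono) auto
    also have "\<dots> = \<epsilon> * (exp (- t / \<epsilon>) / \<epsilon> * J)" using eps by simp
    also have "\<dots> \<le> \<epsilon> * (4 / \<epsilon> * (energy u g + Q x))"
      using action_le[OF u(1) t(1)] u(2) eps unfolding J_def by (intro mult_left_mono) auto
    also have "\<dots> = 4 * (energy u g + Q x)" using eps by simp
    also have "\<dots> \<le> 4 * (W + 1 + Q x)" using u(3) \<delta>(2) by simp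
    finally show ?thesis unfolding J_def K1_def by simp
  qed
  have dist2: "(dist x (u t))\<^sup>2 \<le> T * K1" if t: "0 < t" "t \<le> T" for t
  proof -
    have "(dist x (u t))\<^sup>2 \<le> t * (LBINT r:{0..t}. (g r)\<^sup>2)"
      using dist_square_le_energy[OF us t(1)] u(2) by simp
    also have "\<dots> \<le> t * K1" using J[of t] t by (intro mult_left_mono) auto
    also have "\<dots> \<le> T * K1" using t K1 by (intro mult_right_mono) auto
    finally show ?thesis .
  qed
  have dist\<rho>: "dist x (u t) < \<rho>" if t: "0 < t" "t \<le> T" for t
    using dist2[OF t] T(2) \<rho>(1) by (intro power2_less_imp_less[of _ \<rho>]) auto
  \<comment> \<open>lower semicontinuity gives \<open>potential u r > P - \<eta>\<close>, so the shift by \<open>2 * \<eta>\<close> leaves \<open>H \<ge> \<eta>\<close>\<close>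
  define H where "H r = potential u r - (P - 2 * \<eta>)" for r
  have Hm[measurable]: "H \<in> borel_measurable borel"
    unfolding H_def using potential_measurable[OF us] by measurable
  define D where "D = {r. 0 < r \<and> r \<le> T \<and> \<phi> (u r) = ereal (potential u r)}"
  have AD: "AE r in lborel. 0 < r \<and> r \<le> T \<longrightarrow> r \<in> D"
    using finite_curve_AE[OF u(1)] unfolding AE_wed_measure[OF eps] by eventually_elim (simp add: D_def)
  have HD: "\<forall>r\<in>D. 0 < r \<and> r \<le> T \<and> \<eta> \<le> H r"
  proof
    fix r assume "r \<in> D"
    then have r: "0 < r" "r \<le> T" "\<phi> (u r) = ereal (potential u r)" by (auto simp: D_def)
    have "P - \<eta> < potential u r" using low[OF dist\<rho>[OF r(1,2)]] r(3) by simp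
    then show "0 < r \<and> r \<le> T \<and> \<eta> \<le> H r" using r by (simp add: H_def)
  qed
  have AH: "AE r in lborel. 0 < r \<and> r \<le> T \<longrightarrow> \<eta> \<le> H r"
    using AD by eventually_elim (use HD in blast)
  let ?k = "\<lambda>r. weight r"
  have kH: "set_integrable lborel {0..t} (\<lambda>r. ?k r * (potential u r - c))" if t: "0 \<le> t" for t c
  proof -
    have "set_integrable lborel {0..t} (\<lambda>r. ?k r * potential u r - ?k r * c)"
      using finite_curve_weighted(2)[OF u(1) t] weighted_affine_integral(1)[OF t, of c 0] by (intro set_integral_diff) simp_all
    then show ?thesis by (simp only: right_diff_distrib)
  qed
  have V_low: "- Qb \<le> Vr (u t)" if t: "0 < t" "t \<le> T" for t
  proof -
    have "Q (u t) \<le> Qb" unfolding Qb_def by (rule Q_bound) (use dist\<rho>[OF t] \<rho>(2) in simp)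
    then show ?thesis using Vr_ge[of "u t"] by simp
  qed
  have HK: "(LBINT r:{0..T}. H r) \<le> K2"
  proof -
    define E where "E = exp (- T / \<epsilon>)"
    have E: "1 / 2 \<le> E" "E \<le> 1" using expT2[of T] T(1) eps by (auto simp: E_def)
    define I J where "I = (LBINT r:{0..T}. H r)" and "J = (LBINT r:{0..T}. ?k r * H r)"
    have T0: "0 \<le> T" using T(1) by simp
    have H0: "AE r in lborel. 0 < r \<and> r \<le> T \<longrightarrow> 0 \<le> H r" using AH by eventually_elim (use \<eta>(1) in auto)
    have I0: "0 \<le> I"
      unfolding I_def set_lebesgue_integral_def
    proof (rule integral_nonneg_AE)
      show "AE r in lborel. 0 \<le> indicator {0..T} r *\<^sub>R H r"
        using H0 AE_lborel_singleton[of 0] by eventually_elim (auto simp: indicator_def)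
    qed
    have "0 \<le> E * (dist (u 0) (u T))\<^sup>2 / (2 * T)" using E T(1) by simp
    then have "J + (P - 2 * \<eta>) * (1 - E) + E * Vr (u T) \<le> W + \<delta>"
      using dynamic_programming_split[OF u(1) T(1), of "P - 2 * \<eta>"] u(3) unfolding J_def H_def E_def by linarith
    moreover have "- Qb \<le> E * Vr (u T)"
    proof -
      have "E * Qb \<le> 1 * Qb" using E Qb by (intro mult_right_mono) auto
      moreover have "E * (- Qb) \<le> E * Vr (u T)" using V_low[OF T(1)] E by (intro mult_left_mono) auto
      ultimately show ?thesis by simp
    qed
    moreover have "- (\<bar>P\<bar> + 2 * \<eta>) \<le> (P - 2 * \<eta>) * (1 - E)"
    proof -
      have "\<bar>(P - 2 * \<eta>) * (1 - E)\<bar> \<le> (\<bar>P\<bar> + 2 * \<eta>) * 1"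
        unfolding abs_mult using E \<eta>(1) by (intro mult_mono) auto
      from order_trans[OF abs_ge_minus_self this]
      have "- ((P - 2 * \<eta>) * (1 - E)) \<le> \<bar>P\<bar> + 2 * \<eta>" by (simp only: mult_1_right)
      then show ?thesis by (rule iffD1[OF minus_le_iff])
    qed
    ultimately have JK: "J \<le> W + 1 + Qb + \<bar>P\<bar> + 2 * \<eta>" using \<delta>(2) by linarith
    have "1 / 2 * I \<le> E * I" using E(1) I0 by (rule mult_right_mono)
    also have "\<dots> = \<epsilon> * (E / \<epsilon> * I)" using eps by simp
    also have "\<dots> \<le> \<epsilon> * J"
      using weight_compare(2)[OF Hm _ H0] kH[OF T0, of "P - 2 * \<eta>"] eps unfolding I_def J_def E_def H_def
      by (intro mult_left_mono) auto
    also have "\<dots> \<le> \<epsilon> * (W + 1 + Qb + \<bar>P\<bar> + 2 * \<eta>)" using JK eps by (intro mult_left_mono) auto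
    finally show ?thesis unfolding I_def K2_def by simp
  qed
  have Hi: "set_integrable lborel {0..T} H"
    by (rule weight_compare(1)[OF Hm]) (use kH[of T] T(1) in \<open>simp add: H_def\<close>)
  obtain t where t: "t \<in> D" "\<kappa> \<le> t" "11 / 20 * t * H t \<le> (LBINT r:{0..t}. H r)"
    using select[OF Hi AD HD HK] by blast
  have tD: "0 < t" "t \<le> T" "\<phi> (u t) = ereal (potential u t)" using t(1) unfolding D_def by simp_all
  have Ht: "\<eta> \<le> H t" using t(1) HD by blast
  define y where "y = u t"
  define Py where "Py = potential u t"
  define V where "V = Vr y"
  define d where "d = dist x y"
  define m where "m = t / \<epsilon>"
  have m: "0 < m" using tD eps by (simp add: m_def)
  have em: "exp (- t / \<epsilon>) = exp (- m)" by (simp add: m_def)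
  have zT: "exp m \<le> exp (T / \<epsilon>)" unfolding m_def by (rule expT[OF tD(2)])
  have z: "exp m \<le> 51 / 50" using zT T(3) by linarith
  have y: "\<phi> y = ereal Py" using tD(3) by (simp add: y_def Py_def)
  have PyH: "Py = P - 2 * \<eta> + H t" by (simp add: Py_def H_def)
  have d\<rho>: "d < \<rho>" and d2: "d\<^sup>2 \<le> T * K1" unfolding d_def y_def by (rule dist\<rho>[OF tD(1,2)], rule dist2[OF tD(1,2)])
  have \<delta>m: "\<delta> \<le> \<eta> * m / 2"
  proof -
    have "\<eta> * (\<kappa> / \<epsilon>) / 2 \<le> \<eta> * m / 2" unfolding m_def
      using \<eta>(1) eps t(2) by (intro divide_right_mono mult_left_mono) auto
    then show ?thesis using \<delta>(4) by linarith
  qed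
  have t0: "0 \<le> t" using tD by simp
  define dd where "dd = exp (- m) * d\<^sup>2 / (2 * t)"
  have lower: "dd + (LBINT r:{0..t}. ?k r * (potential u r - c)) + c * (1 - exp (- m)) + exp (- m) * V \<le> W + \<delta>" for c
    using dynamic_programming_split[OF u(1) tD(1), of c] u(2,3)
    unfolding dd_def d_def y_def V_def em[symmetric] by simp
  have AHt: "AE r in lborel. 0 < r \<and> r \<le> t \<longrightarrow> \<eta> \<le> H r"
    using AH by eventually_elim (use tD in auto)
  have excess: "H t \<le> 250 * \<eta>"
  proof (rule potential_excess_bound[where m = m and P = P and V = V and W = W and \<delta> = \<delta> and L = "\<bar>l\<bar> * d\<^sup>2" and K = K3 and dd = dd])
    show "dd + (P - 2 * \<eta>) * (1 - exp (- m)) + 11 / 20 * m * exp (- m) * H t + (1 - (1 - exp (- m))) * V \<le> W + \<delta>"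
    proof -
      have "11 / 20 * m * exp (- m) * H t = exp (- t / \<epsilon>) / \<epsilon> * (11 / 20 * t * H t)"
        unfolding em[symmetric] by (simp add: m_def ac_simps)
      also have "\<dots> \<le> exp (- t / \<epsilon>) / \<epsilon> * (LBINT r:{0..t}. H r)"
        using t(3) eps by (intro mult_left_mono) auto
      also have "\<dots> \<le> (LBINT r:{0..t}. ?k r * H r)"
      proof (rule weight_compare(2)[OF Hm])
        show "set_integrable lborel {0..t} (\<lambda>r. ?k r * H r)" unfolding H_def by (rule kH[OF t0])
        show "AE r in lborel. 0 < r \<and> r \<le> t \<longrightarrow> 0 \<le> H r" using AHt by eventually_elim (use \<eta>(1) in auto)
      qed
      finally have 1: "11 / 20 * m * exp (- m) * H t \<le> (LBINT r:{0..t}. ?k r * H r)" .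
      have "dd + (LBINT r:{0..t}. ?k r * H r) + (P - 2 * \<eta>) * (1 - exp (- m)) + exp (- m) * V \<le> W + \<delta>"
        using lower[of "P - 2 * \<eta>"] unfolding H_def .
      moreover have "1 - (1 - exp (- m)) = exp (- m)" by simp
      ultimately show ?thesis using 1 by (simp only:)
    qed
    \<comment> \<open>with this duration the kinetic term of the geodesic is at most \<open>dd\<close>, the one of the curve\<close>
    define s where "s = t * exp m"
    have s: "0 < s" using tD by (simp add: s_def)
    have es: "exp (- s / \<epsilon>) = exp (- (m * exp m))" by (simp add: s_def m_def)
    define b where "b = 1 - exp (- (m * exp m))"
    have b: "b \<le> s / \<epsilon>" using exp_ge_add_one_self[of "- s / \<epsilon>"] unfolding b_def es[symmetric] by simp
    have "b * (\<epsilon> * d\<^sup>2 / (2 * s\<^sup>2)) \<le> s / \<epsilon> * (\<epsilon> * d\<^sup>2 / (2 * s\<^sup>2))"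
      using b eps by (intro mult_right_mono) auto
    also have "\<dots> = dd"
      using tD eps by (simp add: dd_def s_def power2_eq_square exp_minus field_simps)
    finally have b1: "b * (\<epsilon> * d\<^sup>2 / (2 * s\<^sup>2)) \<le> dd" .
    have "max 0 (Py - P) \<le> H t" using PyH \<eta>(1) Ht by auto
    then have "s / (2 * \<epsilon>) * max 0 (Py - P) \<le> s / (2 * \<epsilon>) * H t"
      using s eps by (intro mult_left_mono) auto
    also have "s / (2 * \<epsilon>) * H t = m * exp m / 2 * H t" by (simp add: s_def m_def)
    finally have b2: "s / (2 * \<epsilon>) * max 0 (Py - P) \<le> m * exp m / 2 * H t" .
    have "W \<le> b * (\<epsilon> * d\<^sup>2 / (2 * s\<^sup>2) + P + \<bar>l\<bar> * d\<^sup>2) + s / (2 * \<epsilon>) * max 0 (Py - P) + (1 - b) * V"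
      using geodesic_competitor[OF x y s] unfolding es W_def V_def d_def b_def by simp
    also have "b * (\<epsilon> * d\<^sup>2 / (2 * s\<^sup>2) + P + \<bar>l\<bar> * d\<^sup>2) = b * (\<epsilon> * d\<^sup>2 / (2 * s\<^sup>2)) + b * (P + \<bar>l\<bar> * d\<^sup>2)"
      by (simp only: distrib_left add.assoc)
    finally have "W \<le> dd + b * (P + \<bar>l\<bar> * d\<^sup>2) + m * exp m / 2 * H t + (1 - b) * V" using b1 b2 by linarith
    then show "W \<le> dd + (1 - exp (- (m * exp m))) * (P + \<bar>l\<bar> * d\<^sup>2) + m * exp m / 2 * H t + (1 - (1 - exp (- (m * exp m)))) * V"
      unfolding b_def .
    show "P - V \<le> K3" using V_low[OF tD(1,2)] by (simp add: K3_def V_def y_def)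
    show "0 \<le> K3" by (simp add: K3_def)
    have "(exp m - 1) * K3 \<le> (exp (T / \<epsilon>) - 1) * K3" using zT by (intro mult_right_mono) (auto simp: K3_def)
    then show "(exp m - 1) * K3 \<le> \<eta>" using T(4) by linarith
    have "\<bar>l\<bar> * d\<^sup>2 \<le> \<bar>l\<bar> * (T * K1)" using d2 by (intro mult_left_mono) auto
    then show "3 * (\<bar>l\<bar> * d\<^sup>2) \<le> \<eta>" using T(5) by linarith
    show "\<delta> \<le> \<eta> * m" using \<delta>m \<eta>(1) m mult_pos_pos[OF \<eta>(1) m] by linarith
  qed (use m z \<eta>(1) Ht in auto)
  have nonneg: "0 \<le> (LBINT r:{0..t}. ?k r * (potential u r - (P - \<eta>)))"
    unfolding set_lebesgue_integral_def
  proof (rule integral_nonneg_AE)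
    show "AE r in lborel. 0 \<le> indicator {0..t} r *\<^sub>R (?k r * (potential u r - (P - \<eta>)))"
      using AHt AE_lborel_singleton[of 0]
      by eventually_elim (use eps in \<open>auto simp: indicator_def H_def\<close>)
  qed
  have low': "exp (- t / \<epsilon>) * d\<^sup>2 / (2 * t) + (P - \<eta>) * (1 - exp (- t / \<epsilon>)) + exp (- t / \<epsilon>) * V \<le> W + \<delta>"
    using lower[of "P - \<eta>"] nonneg unfolding em dd_def by linarith
  have d0: "0 \<le> d" by (simp add: d_def)
  have zt: "exp (t / \<epsilon>) \<le> 51 / 50" using z by (simp add: m_def)
  have \<delta>t: "\<delta> \<le> \<eta> * (t / \<epsilon>) / 2" using \<delta>m by (simp add: m_def)
  note sl = slope_from_dynamic_programming[OF tD(1) eps zt \<eta>(1) less_imp_le[OF \<eta>(3)] d0 low' less_imp_le[OF \<delta>(1)] \<delta>(3) \<delta>t]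
  have "y \<noteq> x" using sl(2) by (auto simp: V_def W_def)
  moreover have "dist x y < \<theta>" using d\<rho> \<rho>(3) by (simp add: d_def)
  moreover have "\<bar>Py - P\<bar> < \<theta>" using PyH excess Ht \<eta>(1,2) by auto
  moreover have "(G - \<theta>) * d \<le> W - V"
  proof -
    define E where "E = exp (- t / \<epsilon>)"
    have E: "0 < E" "E \<le> 1" using tD eps by (auto simp: E_def)
    have "1 - E \<le> exp m - 1"
      using exp_ge_add_one_self[of m] exp_ge_add_one_self[of "- m"] unfolding E_def em by linarith
    also have "\<dots> \<le> exp (T / \<epsilon>) - 1" using zT by simp
    finally have 1: "1 - E \<le> exp (T / \<epsilon>) - 1" .
    have G0: "0 \<le> G" using gap eps by (simp add: G_def W_def)
    have "(1 - E) * G \<le> (exp (T / \<epsilon>) - 1) * G" using 1 G0 by (rule mult_right_mono)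
    then have 2: "(1 - E) * G \<le> \<theta> / 2" using T(6) by linarith
    have "E * (G - \<theta> / 2) \<le> E * sqrt (2 * (P - W - 3 * \<eta>) / \<epsilon>)" using \<eta>(4) E by (intro mult_left_mono) auto
    moreover have "E * (\<theta> / 2) \<le> 1 * (\<theta> / 2)" using E \<theta> by (intro mult_right_mono) auto
    ultimately have "G - \<theta> \<le> E * sqrt (2 * (P - W - 3 * \<eta>) / \<epsilon>)" using 2 by (simp add: algebra_simps)
    then have "(G - \<theta>) * d \<le> E * sqrt (2 * (P - W - 3 * \<eta>) / \<epsilon>) * d" using d0 by (rule mult_right_mono)
    then show ?thesis using sl(1) unfolding E_def by linarith
  qed
  ultimately show ?thesis using y unfolding G_def W_def V_def d_def by blast
qed


section \<open>The conditioned slope of the value function\<close>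

lemma eventually_conditioned:
  assumes x: "\<phi> x = ereal P"
  shows "eventually R (inf (at x) (filtercomap \<phi> (nhds (\<phi> x)))) \<longleftrightarrow>
    (\<exists>\<rho>>0. \<forall>y p. y \<noteq> x \<longrightarrow> dist x y < \<rho> \<longrightarrow> \<phi> y = ereal p \<longrightarrow> \<bar>p - P\<bar> < \<rho> \<longrightarrow> R y)"
proof
  assume "eventually R (inf (at x) (filtercomap \<phi> (nhds (\<phi> x))))"
  then obtain R1 R2 where R: "eventually R1 (at x)" "eventually R2 (filtercomap \<phi> (nhds (\<phi> x)))"
    "\<And>y. R1 y \<Longrightarrow> R2 y \<Longrightarrow> R y"
    unfolding eventually_inf by blast
  obtain \<rho>1 where \<rho>1: "0 < \<rho>1" "\<And>y. y \<noteq> x \<Longrightarrow> dist y x < \<rho>1 \<Longrightarrow> R1 y"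
    using R(1) unfolding eventually_at by auto
  obtain R3 where R3: "eventually R3 (nhds (\<phi> x))" "\<And>y. R3 (\<phi> y) \<Longrightarrow> R2 y"
    using R(2) unfolding eventually_filtercomap by blast
  obtain S where S: "open S" "\<phi> x \<in> S" "\<And>q. q \<in> S \<Longrightarrow> R3 q"
    using R3(1) unfolding eventually_nhds by blast
  have "open (ereal -` S)" using S(1) by (rule open_vimage) (intro continuous_intros)
  moreover have "P \<in> ereal -` S" using S(2) x by simp
  ultimately obtain \<rho>2 where \<rho>2: "0 < \<rho>2" "ball P \<rho>2 \<subseteq> ereal -` S" by (meson openE)
  show "\<exists>\<rho>>0. \<forall>y p. y \<noteq> x \<longrightarrow> dist x y < \<rho> \<longrightarrow> \<phi> y = ereal p \<longrightarrow> \<bar>p - P\<bar> < \<rho> \<longrightarrow> R y"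
  proof (intro exI[of _ "min \<rho>1 \<rho>2"] conjI allI impI)
    fix y p assume y: "y \<noteq> x" "dist x y < min \<rho>1 \<rho>2" "\<phi> y = ereal p" "\<bar>p - P\<bar> < min \<rho>1 \<rho>2"
    have "p \<in> ball P \<rho>2" using y(4) by (simp add: dist_real_def abs_minus_commute)
    then have "\<phi> y \<in> S" using \<rho>2(2) y(3) by auto
    then show "R y" using R(3) R3(2) S(3) \<rho>1(2)[of y] y by (simp add: dist_commute)
  qed (use \<rho>1 \<rho>2 in auto)
next
  assume "\<exists>\<rho>>0. \<forall>y p. y \<noteq> x \<longrightarrow> dist x y < \<rho> \<longrightarrow> \<phi> y = ereal p \<longrightarrow> \<bar>p - P\<bar> < \<rho> \<longrightarrow> R y"
  then obtain \<rho> where \<rho>: "0 < \<rho>"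
    "\<And>y p. y \<noteq> x \<Longrightarrow> dist x y < \<rho> \<Longrightarrow> \<phi> y = ereal p \<Longrightarrow> \<bar>p - P\<bar> < \<rho> \<Longrightarrow> R y" by blast
  have 1: "eventually (\<lambda>y. y \<noteq> x \<and> dist y x < \<rho>) (at x)"
    unfolding eventually_at using \<rho>(1) by auto
  have "eventually (\<lambda>q. q \<in> {ereal (P - \<rho>)<..<ereal (P + \<rho>)}) (nhds (\<phi> x))"
    using x \<rho>(1) by (intro eventually_nhds_in_open) auto
  then have 2: "eventually (\<lambda>y. \<phi> y \<in> {ereal (P - \<rho>)<..<ereal (P + \<rho>)}) (filtercomap \<phi> (nhds (\<phi> x)))"
    by (rule eventually_filtercomapI)
  show "eventually R (inf (at x) (filtercomap \<phi> (nhds (\<phi> x))))"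
    unfolding eventually_inf
  proof (intro exI conjI allI impI)
    fix y assume y: "(y \<noteq> x \<and> dist y x < \<rho>) \<and> \<phi> y \<in> {ereal (P - \<rho>)<..<ereal (P + \<rho>)}"
    then obtain p where "\<phi> y = ereal p" "P - \<rho> < p" "p < P + \<rho>" by (cases "\<phi> y") auto
    then show "R y" using y \<rho>(2)[of y p] by (simp add: dist_commute abs_less_iff)
  qed (rule 1, rule 2)
qed

text \<open>If \<open>Vr x = P\<close> the right-hand side is \<open>0\<close> and the outer maximum in the definition of the slope gives the
lower bound, even if the filter is trivial. Otherwise \<open>slope_lower_bound\<close> provides points in every set
of the filter at which the quotient nearly reaches the right-hand side.\<close>

theorem conditioned_slope_eq:
  assumes x: "\<phi> x = ereal P"
  shows "conditioned_slope \<phi> (value_fun \<epsilon> \<phi>) x = ereal (sqrt (2 * (P - Vr x) / \<epsilon>))"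
proof -
  define F where "F = inf (at x) (filtercomap \<phi> (nhds (\<phi> x)))"
  define q where "q v = max 0 (value_fun \<epsilon> \<phi> x - value_fun \<epsilon> \<phi> v) / ereal (dist x v)" for v
  define G where "G = sqrt (2 * (P - Vr x) / \<epsilon>)"
  have q: "q y = ereal (max 0 (Vr x - Vr y) / dist x y)" if "\<phi> y = ereal p" "y \<noteq> x" for y p
    unfolding q_def value_fun_eq_Vr(1)[OF x] value_fun_eq_Vr(1)[OF that(1)] using that(2)
    by (simp add: ereal_max[symmetric] zero_ereal_def del: ereal_max)
  have PW: "Vr x \<le> P" by (rule value_fun_eq_Vr(2)[OF x])
  have G0: "0 \<le> G" using PW eps by (simp add: G_def)
  have "max 0 (Limsup F q) \<le> ereal G"
  proof (rule ereal_le_epsilon2)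
    fix e :: real assume "0 < e"
    have "eventually (\<lambda>\<theta>. sqrt (2 * (P - Vr x + \<theta>) / \<epsilon>) < G + e) (at_right 0)"
      using \<open>0 < e\<close> eps by (intro eventually_at_right_0_less) (auto simp: G_def intro!: continuous_intros)
    then obtain \<theta> where \<theta>: "0 < \<theta>" "sqrt (2 * (P - Vr x + \<theta>) / \<epsilon>) < G + e" by (rule at_right_0_witness)
    have "eventually (\<lambda>y. q y \<le> ereal (G + e)) F"
      unfolding F_def eventually_conditioned[OF x]
    proof -
      obtain \<rho> where \<rho>: "0 < \<rho>" "\<And>y Py. y \<noteq> x \<Longrightarrow> dist x y < \<rho> \<Longrightarrow> \<phi> y = ereal Py \<Longrightarrow> \<bar>Py - P\<bar> < \<rho> \<Longrightarrow>
         Vr x - Vr y \<le> sqrt (2 * (P - Vr x + \<theta>) / \<epsilon>) * dist x y"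
        using slope_upper_bound[OF x \<theta>(1)] by blast
      have "q y \<le> ereal (G + e)" if y: "y \<noteq> x" "dist x y < \<rho>" "\<phi> y = ereal p" "\<bar>p - P\<bar> < \<rho>" for y p
      proof -
        have d: "0 < dist x y" using y(1) by simp
        have "sqrt (2 * (P - Vr x + \<theta>) / \<epsilon>) * dist x y \<le> (G + e) * dist x y"
          using \<theta>(2) by (intro mult_right_mono) auto
        moreover have "0 \<le> (G + e) * dist x y" using G0 \<open>0 < e\<close> by simp
        ultimately have "max 0 (Vr x - Vr y) \<le> (G + e) * dist x y" using \<rho>(2)[OF y] by simp
        then show ?thesis using d by (simp add: q[OF y(3,1)] divide_le_eq)
      qed
      then show "\<exists>\<rho>>0. \<forall>y p. y \<noteq> x \<longrightarrow> dist x y < \<rho> \<longrightarrow> \<phi> y = ereal p \<longrightarrow> \<bar>p - P\<bar> < \<rho> \<longrightarrow> q y \<le> ereal (G + e)"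
        using \<rho>(1) by blast
    qed
    then have "Limsup F q \<le> ereal (G + e)" by (rule Limsup_bounded)
    then show "max 0 (Limsup F q) \<le> ereal G + ereal e" using G0 \<open>0 < e\<close> by simp
  qed
  moreover have "ereal G \<le> max 0 (Limsup F q)"
  proof (cases "Vr x = P")
    case True
    then show ?thesis by (simp add: G_def zero_ereal_def[symmetric])
  next
    case False
    then have gap: "Vr x < P" using PW by simp
    have "ereal G \<le> Limsup F q"
    proof (rule ereal_le_epsilon2)
      fix e :: real assume e: "0 < e"
      have "ereal (G - e) \<le> Limsup F q"
        unfolding Limsup_def
      proof (rule INF_greatest)
        fix R assume "R \<in> {R. eventually R F}"
        then obtain \<rho> where \<rho>: "0 < \<rho>" "\<And>y p. y \<noteq> x \<Longrightarrow> dist x y < \<rho> \<Longrightarrow> \<phi> y = ereal p \<Longrightarrow> \<bar>p - P\<bar> < \<rho> \<Longrightarrow> R y"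
          unfolding F_def mem_Collect_eq eventually_conditioned[OF x] by blast
        have m: "0 < min \<rho> e" using \<rho>(1) e by simp
        obtain y p where y: "y \<noteq> x" "dist x y < min \<rho> e" "\<phi> y = ereal p" "\<bar>p - P\<bar> < min \<rho> e"
           "(G - min \<rho> e) * dist x y \<le> Vr x - Vr y"
          using slope_lower_bound[OF x gap m] unfolding G_def by blast
        have d: "0 < dist x y" using y(1) by simp
        have "(G - e) * dist x y \<le> (G - min \<rho> e) * dist x y" by (intro mult_right_mono) auto
        then have "(G - e) * dist x y \<le> max 0 (Vr x - Vr y)" using y(5) by simp
        then have "ereal (G - e) \<le> q y" using d by (simp add: q[OF y(3,1)] le_divide_eq)
        moreover have "R y" using \<rho>(2)[OF y(1) _ y(3)] y(2,4) by simp
        ultimately show "ereal (G - e) \<le> Sup (q ` Collect R)" by (intro SUP_upper2[of y]) auto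
      qed
      then have "ereal (G - e) + ereal e \<le> Limsup F q + ereal e" by (rule add_right_mono)
      then show "ereal G \<le> Limsup F q + ereal e" by simp
    qed
    then show ?thesis by (simp add: le_max_iff_disj)
  qed
  ultimately show ?thesis unfolding conditioned_slope_def F_def q_def G_def by (rule antisym)
qed

end

text \<open>Condition (MT2) makes every \<open>\<sigma>\<close>-neighbourhood a metric neighbourhood, because a small distance to \<open>v0\<close>
is a small distance to \<open>V\<close>.\<close>

lemma compatible_tendsto_imp_limitin:
  fixes \<sigma> :: "('a::metric_space) topology"
  assumes c: "compatible \<sigma>" and v: "v \<longlonglongrightarrow> v0"
  shows "limitin \<sigma> v v0 sequentially"
  unfolding limitin_def
proof (intro conjI allI impI)
  show "v0 \<in> topspace \<sigma>" using c by (simp add: compatible_def)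
  fix U assume "openin \<sigma> U \<and> v0 \<in> U"
  then obtain V \<delta> where V: "v0 \<in> V" "\<delta> > 0" "\<And>y. infdist y V < \<delta> \<Longrightarrow> y \<in> U"
    using c unfolding compatible_def by metis
  have "eventually (\<lambda>n. dist (v n) v0 < \<delta>) sequentially" using v V(2) by (rule tendstoD)
  then show "eventually (\<lambda>n. v n \<in> U) sequentially"
  proof eventually_elim
    case (elim n)
    have "infdist (v n) V \<le> dist (v n) v0" using V(1) by (rule infdist_le)
    then show ?case using elim V(3) by simp
  qed
qed

lemma LSCC_imp_open_superlevel:
  fixes \<sigma> :: "('a::metric_space) topology"
  assumes c: "compatible \<sigma>" and L: "LSCC \<sigma> \<phi> ustar A B"
  shows "open {y. c < \<phi> y}"
proof -
  have "closed {y. \<phi> y \<le> c}"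
    unfolding closed_sequential_limits
  proof (intro allI impI)
    fix v v0 assume v: "(\<forall>n. v n \<in> {y. \<phi> y \<le> c}) \<and> v \<longlonglongrightarrow> v0"
    then have lim: "v \<longlonglongrightarrow> v0" by simp
    have "bounded (range v)" by (rule convergent_imp_bounded[OF lim])
    then have "\<exists>C. \<forall>n m. dist (v n) (v m) \<le> C"
      unfolding bounded_two_points by (metis rangeI)
    then have "\<phi> v0 \<le> liminf (\<lambda>n. \<phi> (v n))"
      using L compatible_tendsto_imp_limitin[OF c lim] unfolding LSCC_def by blast
    also have "\<dots> \<le> liminf (\<lambda>n. c)" by (rule Liminf_mono) (use v in auto)
    also have "\<dots> = c" by (rule Liminf_const) simp
    finally show "v0 \<in> {y. \<phi> y \<le> c}" by simp
  qed
  moreover have "{y. c < \<phi> y} = - {y. \<phi> y \<le> c}" by auto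
  ultimately show ?thesis by (simp add: open_Compl)
qed

theorem theorem7p1:
  fixes \<sigma> :: "('a::complete_space) topology"
    and \<phi> :: "'a \<Rightarrow> ereal"
    and ustar :: 'a
    and A B l \<epsilon> :: real
  assumes "compatible \<sigma>"
    and "proper_fun \<phi>"
    and "LSCC \<sigma> \<phi> ustar A B"
    and "geodesically_convex l \<phi>"
    and "\<epsilon> > 0"
    and "1 / (16 * \<epsilon>) > B"
  shows "\<forall>u\<in>eff_dom \<phi>.
           ereal_sqrt (2 * (\<phi> u - value_fun \<epsilon> \<phi> u) / ereal \<epsilon>) = G_fun \<epsilon> \<phi> u \<and>
           G_fun \<epsilon> \<phi> u = conditioned_slope \<phi> (value_fun \<epsilon> \<phi>) u"
proof
  fix u assume u: "u \<in> eff_dom \<phi>"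
  interpret wed_setting \<phi> ustar A B l \<epsilon>
  proof
    show "open {y. c < \<phi> y}" for c by (rule LSCC_imp_open_superlevel[OF assms(1,3)])
    show "\<phi> y \<noteq> - \<infinity>" for y using assms(2) by (simp add: proper_fun_def)
    show "ereal (- B * (dist u v)\<^sup>2 - (B * (dist v ustar)\<^sup>2 + A)) \<le> \<phi> u" for u v
      using assms(3) unfolding LSCC_def by blast
    show "0 \<le> A" "0 \<le> B" using assms(3) unfolding LSCC_def by (blast+)
  qed (use assms in auto)
  obtain P where P: "\<phi> u = ereal P"
    using u phi_not_MInf[of u] by (cases "\<phi> u") (auto simp: eff_dom_def)
  have V: "value_fun \<epsilon> \<phi> u = ereal (Vr u)" by (rule value_fun_eq_Vr(1)[OF P])
  have "ereal_sqrt (2 * (\<phi> u - value_fun \<epsilon> \<phi> u) / ereal \<epsilon>) = ereal (sqrt (2 * (P - Vr u) / \<epsilon>))"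
    unfolding P V using eps by (simp add: ereal_sqrt_def)
  moreover have "G_fun \<epsilon> \<phi> u = ereal_sqrt (2 * (\<phi> u - value_fun \<epsilon> \<phi> u) / ereal \<epsilon>)"
    by (simp add: G_fun_def eff_dom_def V)
  ultimately show "ereal_sqrt (2 * (\<phi> u - value_fun \<epsilon> \<phi> u) / ereal \<epsilon>) = G_fun \<epsilon> \<phi> u \<and>
           G_fun \<epsilon> \<phi> u = conditioned_slope \<phi> (value_fun \<epsilon> \<phi>) u"
    by (simp add: conditioned_slope_eq[OF P])
qed

end
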